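(* Let $E\subset\mathbb{R}$ be a closed set. Suppose that $\mu_s(E)=0$ for all $\mu\in\mathcal{R}_0(E)$. Then $\nu_s(E)=0$ for all $\nu\in\mathcal{R}(E)$.
   Context: A Herglotz function is a holomorphic mapping $F$ of $\mathbb{C}^+=\{z\in\mathbb{C}:\operatorname{Im} z>0\}$ to itself; for such $F$ the limit $F(t)=\lim_{y\to0+}F(t+iy)$ exists for Lebesgue almost every $t\in\mathbb{R}$. $\mathcal{N}(E)$ is the set of Herglotz functions that are reflectionless on $E$, i.e. $\operatorname{Re}F(t)=0$ for almost every $t\in E$. Every Herglotz function has a unique representation $$F(z)=F_\mu(z)=a+bz+\int_{-\infty}^\infty\left(\frac1{t-z}-\frac{t}{t^2+1}\right)d\mu(t),$$ with $a\in\mathbb{R}$, $b\ge0$ and a positive Borel measure $\mu$ on $\mathbb{R}$ with $\int_{\mathbb{R}}\frac{d\mu(t)}{t^2+1}<\infty$. $\mathcal{R}(E)$ is the set of all such measures $\mu$ for which $F_\mu\in\mathcal{N}(E)$ for some choice of $a\in\mathbb{R}$, $b\ge0$, and $\mathcal{R}_0(E)=\{\mu\in\mathcal{R}(E):\mu(E^c)=0\}$. $\mu_s$ denotes the singular part of $\mu$ with respect to Lebesgue measure. *)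

theory Defs
  imports "HOL-Complex_Analysis.Complex_Analysis"
begin

section \<open>Herglotz functions\<close>

definition upper_half_plane :: "complex set" where
  "upper_half_plane = {z. Im z > 0}"

definition herglotz :: "(complex \<Rightarrow> complex) \<Rightarrow> bool" where
  "herglotz F \<longleftrightarrow> F holomorphic_on upper_half_plane \<and> F ` upper_half_plane \<subseteq> upper_half_plane"

text \<open>The boundary value \<open>F(t)\<close> is the limit of \<open>F(t + iy)\<close> as \<open>y\<close> decreases to \<open>0\<close>. It
  exists for almost every \<open>t\<close>, so including its existence in the condition below does not affect
  the notion.\<close>

definition reflectionless_on :: "(complex \<Rightarrow> complex) \<Rightarrow> real set \<Rightarrow> bool" where
  "reflectionless_on F E \<longleftrightarrow>
     (AE t in lborel. t \<in> E \<longrightarrow> (\<exists>l. ((\<lambda>y. F (Complex t y)) \<longlongrightarrow> l) (at_right 0) \<and> Re l = 0))"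

definition herglotz_reflectionless :: "real set \<Rightarrow> (complex \<Rightarrow> complex) set"  ("\<N>") where
  "\<N> E = {F. herglotz F \<and> reflectionless_on F E}"

definition herglotz_measure :: "real measure \<Rightarrow> bool" where
  "herglotz_measure \<mu> \<longleftrightarrow> sets \<mu> = sets borel \<and> (\<integral>\<^sup>+ t. ennreal (1 / (t\<^sup>2 + 1)) \<partial>\<mu>) < \<infinity>"

definition herglotz_fun :: "real \<Rightarrow> real \<Rightarrow> real measure \<Rightarrow> complex \<Rightarrow> complex" where
  "herglotz_fun a b \<mu> z =
     of_real a + of_real b * z +
     (LINT t|\<mu>. 1 / (of_real t - z) - of_real (t / (t\<^sup>2 + 1)))"

definition reflectionless_measures :: "real set \<Rightarrow> real measure set"  ("\<R>") where
  "\<R> E = {\<mu>. herglotz_measure \<mu> \<and> (\<exists>a b. b \<ge> 0 \<and> herglotz_fun a b \<mu> \<in> \<N> E)}"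

definition reflectionless_measures_supported :: "real set \<Rightarrow> real measure set"  ("\<R>\<^sub>0") where
  "\<R>\<^sub>0 E = {\<mu> \<in> \<R> E. emeasure \<mu> (- E) = 0}"


section \<open>The singular part of a measure\<close>

definition mutually_singular :: "'a measure \<Rightarrow> 'a measure \<Rightarrow> bool" where
  "mutually_singular M N \<longleftrightarrow>
     (\<exists>A \<in> sets M. emeasure M A = 0 \<and> emeasure N (space M - A) = 0)"

definition lebesgue_decomposition :: "real measure \<Rightarrow> real measure \<Rightarrow> real measure \<Rightarrow> bool" where
  "lebesgue_decomposition \<mu> \<mu>ac \<mu>s \<longleftrightarrow>
     sets \<mu>ac = sets borel \<and> sets \<mu>s = sets borel \<and>
     (\<forall>A \<in> sets borel. emeasure \<mu> A = emeasure \<mu>ac A + emeasure \<mu>s A) \<and>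
     absolutely_continuous lborel \<mu>ac \<and> mutually_singular lborel \<mu>s"

definition singular_part :: "real measure \<Rightarrow> real measure" where
  "singular_part \<mu> = (THE \<mu>s. \<exists>\<mu>ac. lebesgue_decomposition \<mu> \<mu>ac \<mu>s)"

text \<open>The description in \<^const>\<open>singular_part\<close> denotes: the decomposition exists and its singular
  part is unique for all measures considered here.\<close>

lemma lebesgue_decomposition_singular:
  assumes "lebesgue_decomposition \<mu> \<mu>ac \<mu>s"
  obtains N where "N \<in> null_sets lborel"
    and "\<And>M A. \<lbrakk>M \<in> null_sets lborel; N \<subseteq> M; A \<in> sets borel\<rbrakk>
           \<Longrightarrow> emeasure \<mu>s A = emeasure \<mu> (A \<inter> M)"
proof -
  have sac[simp]: "sets \<mu>ac = sets borel" and ss[simp]: "sets \<mu>s = sets borel"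
    and add: "\<And>A. A \<in> sets borel \<Longrightarrow> emeasure \<mu> A = emeasure \<mu>ac A + emeasure \<mu>s A"
    and ac: "null_sets lborel \<subseteq> null_sets \<mu>ac"
    and sing: "mutually_singular lborel \<mu>s"
    using assms by (auto simp: lebesgue_decomposition_def absolutely_continuous_def)
  obtain N where N: "N \<in> sets borel" "emeasure lborel N = 0" "emeasure \<mu>s (- N) = 0"
    using sing by (auto simp: mutually_singular_def Compl_eq_Diff_UNIV)
  show thesis
  proof (rule that)
    show "N \<in> null_sets lborel" using N by auto
    fix M A :: "real set" assume M: "M \<in> null_sets lborel" and NM: "N \<subseteq> M" and A: "A \<in> sets borel"
    have Mb: "M \<in> sets borel" using M by auto
    have "A \<inter> M \<in> null_sets lborel" using M A by (auto intro: null_set_Int1)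
    then have "emeasure \<mu>ac (A \<inter> M) = 0" using ac by auto
    then have 1: "emeasure \<mu> (A \<inter> M) = emeasure \<mu>s (A \<inter> M)" using add[of "A \<inter> M"] A Mb by simp
    have "emeasure \<mu>s (A - M) \<le> emeasure \<mu>s (- N)"
      using N(1) NM by (intro emeasure_mono) auto
    then have 2: "emeasure \<mu>s (A - M) = 0" using N by simp
    have "emeasure \<mu>s A = emeasure \<mu>s (A \<inter> M) + emeasure \<mu>s (A - M)"
      using A Mb by (subst plus_emeasure) (auto simp: Int_Diff_Un)
    then show "emeasure \<mu>s A = emeasure \<mu> (A \<inter> M)" using 1 2 by simp
  qed
qed

lemma lebesgue_decomposition_unique:
  assumes d1: "lebesgue_decomposition \<mu> \<mu>ac \<mu>s" and d2: "lebesgue_decomposition \<mu> \<mu>ac' \<mu>s'"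
  shows "\<mu>s = \<mu>s'"
proof -
  obtain N where N: "N \<in> null_sets lborel"
    "\<And>M A. M \<in> null_sets lborel \<Longrightarrow> N \<subseteq> M \<Longrightarrow> A \<in> sets borel \<Longrightarrow> emeasure \<mu>s A = emeasure \<mu> (A \<inter> M)"
    using lebesgue_decomposition_singular[OF d1] by metis
  obtain N' where N': "N' \<in> null_sets lborel"
    "\<And>M A. M \<in> null_sets lborel \<Longrightarrow> N' \<subseteq> M \<Longrightarrow> A \<in> sets borel \<Longrightarrow> emeasure \<mu>s' A = emeasure \<mu> (A \<inter> M)"
    using lebesgue_decomposition_singular[OF d2] by metis
  have U: "N \<union> N' \<in> null_sets lborel" using N N' by auto
  have "sets \<mu>s = sets borel" "sets \<mu>s' = sets borel"
    using d1 d2 by (auto simp: lebesgue_decomposition_def)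
  then show ?thesis
    using N(2)[OF U] N'(2)[OF U] by (intro measure_eqI) auto
qed

lemma singular_part_eqI:
  assumes "lebesgue_decomposition \<mu> \<mu>ac \<mu>s"
  shows "singular_part \<mu> = \<mu>s"
  unfolding singular_part_def
  using assms lebesgue_decomposition_unique by (intro the_equality) blast+

lemma lebesgue_decomposition_exists:
  assumes "herglotz_measure \<mu>"
  shows "\<exists>\<mu>ac. lebesgue_decomposition \<mu> \<mu>ac (singular_part \<mu>)"
proof -
  define h where "h = (\<lambda>t::real. ennreal (1 / (t\<^sup>2 + 1)))"
  have sm[simp, measurable_cong]: "sets \<mu> = sets borel" and fin: "(\<integral>\<^sup>+ t. h t \<partial>\<mu>) < \<infinity>"
    using assms by (auto simp: herglotz_measure_def h_def)
  have spm[simp]: "space \<mu> = UNIV" using sets_eq_imp_space_eq[OF sm] by simp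
  have hpos: "h t > 0" for t
    unfolding h_def by (simp add: add_nonneg_pos)
  have [measurable]: "h \<in> borel_measurable borel" unfolding h_def by measurable
  define \<nu> where "\<nu> = density \<mu> h"
  have sn[simp]: "sets \<nu> = sets borel" by (simp add: \<nu>_def)
  interpret \<nu>: finite_measure \<nu>
    using fin by (intro finite_measureI) (simp add: \<nu>_def emeasure_density)
  have null: "emeasure \<mu> A = 0" if "emeasure \<nu> A = 0" "A \<in> sets borel" for A
  proof -
    have "A \<in> null_sets (density \<mu> h)" using that by (auto simp: \<nu>_def)
    then have "AE x in \<mu>. x \<in> A \<longrightarrow> h x = 0"
      by (subst (asm) null_sets_density_iff) auto
    then have "AE x in \<mu>. x \<notin> A"
      by eventually_elim (use hpos in \<open>metis less_irrefl\<close>)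
    then show ?thesis using that(2) by (subst (asm) AE_iff_null_sets[symmetric]) auto
  qed
  let ?S = "SUP N \<in> null_sets lborel. emeasure \<nu> N"
  have ne: "null_sets (lborel :: real measure) \<noteq> {}" by auto
  obtain f :: "nat \<Rightarrow> ennreal" where
    f: "range f \<subseteq> emeasure \<nu> ` null_sets lborel" "?S = Sup (range f)"
    using ennreal_SUP_countable_SUP[OF ne, of "emeasure \<nu>"] by auto
  have "\<forall>n. \<exists>N. N \<in> null_sets lborel \<and> f n = emeasure \<nu> N" using f(1) by blast
  then obtain Ns where Ns: "\<And>n. Ns n \<in> null_sets lborel" "\<And>n. f n = emeasure \<nu> (Ns n)"
    by metis
  define N where "N = (\<Union>n. Ns n)"
  have N: "N \<in> null_sets lborel" unfolding N_def using Ns by auto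
  then have Nb[measurable]: "N \<in> sets borel" by auto
  have le: "?S \<le> emeasure \<nu> N"
    unfolding f(2) using Nb by (auto simp: Ns(2) N_def intro!: SUP_least emeasure_mono)
  have key: "emeasure \<mu> (A - N) = 0" if A: "A \<in> null_sets lborel" for A
  proof -
    have Ab: "A \<in> sets borel" using A by auto
    have "emeasure \<nu> (A - N) + emeasure \<nu> N = emeasure \<nu> (A \<union> N)"
      using Ab Nb by (subst plus_emeasure) auto
    also have "\<dots> \<le> ?S" using A N by (intro SUP_upper) auto
    also have "\<dots> \<le> 0 + emeasure \<nu> N" using le by simp
    finally have "emeasure \<nu> (A - N) = 0"
      using \<nu>.emeasure_finite[of N] by (simp add: ennreal_add_left_cancel_le add.commute less_top)
    then show ?thesis using Ab Nb by (intro null) auto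
  qed
  let ?ac = "density \<mu> (indicator (- N))" and ?s = "density \<mu> (indicator N)"
  have eac: "emeasure ?ac A = emeasure \<mu> (A - N)" if "A \<in> sets borel" for A
    using that by (simp add: emeasure_density indicator_inter_arith[symmetric] Diff_eq Int_commute)
  have es: "emeasure ?s A = emeasure \<mu> (A \<inter> N)" if "A \<in> sets borel" for A
    using that by (simp add: emeasure_density indicator_inter_arith[symmetric] Int_commute)
  have d: "lebesgue_decomposition \<mu> ?ac ?s"
    unfolding lebesgue_decomposition_def
  proof (intro conjI ballI)
    fix A :: "real set" assume A: "A \<in> sets borel"
    show "emeasure \<mu> A = emeasure ?ac A + emeasure ?s A"
      using A Nb unfolding eac[OF A] es[OF A]
      by (subst plus_emeasure) (auto intro!: arg_cong[where f = "emeasure \<mu>"])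
  next
    show "absolutely_continuous lborel ?ac"
      unfolding absolutely_continuous_def
      using key by (auto simp: null_sets_def eac)
    show "mutually_singular lborel ?s"
      unfolding mutually_singular_def
      proof (intro bexI[of _ N] conjI)
      have "- N \<inter> N = {}" by auto
      then show "emeasure ?s (space lborel - N) = 0"
        using Nb es[of "- N"] by (simp add: Compl_eq_Diff_UNIV)
    qed (use N in auto)
  qed auto
  then show ?thesis using singular_part_eqI[OF d] by auto
qed

end

theory Submission
  imports Defs "HOL-Probability.Probability"
begin

text \<open>The boundary condition \<open>Re F = 0\<close> on \<open>E\<close> is linear in \<open>F\<close>, so the part of \<open>\<nu>\<close> off \<open>E\<close> can be
  swept onto \<open>E\<close>. Let \<open>[c, d]\<close> be disjoint from \<open>E\<close>. Replacing a point mass at \<open>t \<in> (c, d)\<close> by the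
  harmonic measure \<open>\<omega>\<close> of the complement of \<open>\<real> - (c, d)\<close> with respect to \<open>t\<close>, weighted by
  \<open>(1 + s\<^sup>2) / (1 + t\<^sup>2)\<close>, adds to \<open>F\<close> a function that is imaginary on \<open>\<real> - [c, d]\<close>, preserves
  \<open>\<integral> d\<nu> / (1 + t\<^sup>2)\<close>, does not change \<open>a\<close> and \<open>b\<close>, and only increases the measure on \<open>E\<close>.
  Among all measures obtained from \<open>\<nu>\<close> under these constraints a compactness argument yields one
  with maximal mass on \<open>E \<union> {\<infinity>}\<close>; it uses that pointwise limits of functions in \<open>\<N> E\<close> are again
  in \<open>\<N> E\<close>, a consequence of Fatou's theorem and the Poisson formula for \<open>(F - \<i>) / (F + \<i>)\<close>. If
  \<open>E\<close> has positive length, the maximal measure cannot charge the complement of \<open>E\<close>, because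
  sweeping would move some of that mass to \<open>E\<close>; if \<open>E\<close> is a null set the condition is void and the
  mass off \<open>E\<close> may be moved to \<open>\<infinity>\<close>. The result lies in \<open>\<R>\<^sub>0 E\<close> and dominates \<open>\<nu>\<close> on \<open>E\<close>, and so does
  its singular part.\<close>

section \<open>The Poisson formula in the upper half plane\<close>


text \<open>Sweeping (c, d) spreads its mass over everything outside (c, d), so points off E may
  receive some of it. A maximum is therefore taken instead of an iteration over gaps. For it to
  exist, no mass may be lost at infinity: in the coordinate t = tan theta, with nu normalised by 1 /
  (1 + t^2), the competitors are probability laws on [-pi/2, pi/2], mass at the endpoints acts as an
  addition to the coefficient of z, and the weight in the overview disappears. E together with
  infinity becomes a closed set, and the mass of a closed set is upper semicontinuous under weak
  convergence.

  The second obstacle is that an almost everywhere condition on the boundary is not visibly stable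
  under pointwise limits inside the half plane. It is turned into an inequality at interior points:
  |Im ((F - i) / (F + i))| is at most the harmonic measure of the complement of E. Poisson integrals
  are written throughout as expectations under one standard Cauchy law, because the Poisson kernel
  at x + i y is the law of x + y v for a Cauchy variable v.\<close>

definition cauchy_law :: "real measure" where
  "cauchy_law = density lborel (\<lambda>v. ennreal (1 / (pi * (1 + v\<^sup>2))))"

lemma sets_cauchy_law [simp, measurable_cong]: "sets cauchy_law = sets borel"
  by (simp add: cauchy_law_def)

lemma space_cauchy_law [simp]: "space cauchy_law = UNIV"
  by (simp add: cauchy_law_def)

lemma one_plus_square_pos: "0 < 1 + (x::real)\<^sup>2"
  by (simp add: add_pos_nonneg)

lemma integrable_one_plus_square: "integrable lborel (\<lambda>v::real. 1 / (1 + v\<^sup>2))"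
  using integrable_inverse_1_plus_square by (simp add: set_integrable_def inverse_eq_divide)

lemma integral_one_plus_square: "(LINT v|lborel. 1 / (1 + v\<^sup>2)) = pi"
  using LBINT_inverse_1_plus_square
  by (simp add: interval_lebesgue_integral_def set_lebesgue_integral_def inverse_eq_divide)

lemma integral_cauchy_law:
  fixes f :: "real \<Rightarrow> complex"
  assumes [measurable]: "f \<in> borel_measurable borel"
  shows "(LINT v|cauchy_law. f v) = (LINT v|lborel. f v / of_real (pi * (1 + v\<^sup>2)))"
  unfolding cauchy_law_def
  by (subst integral_density)
     (auto simp: scaleR_conv_of_real less_imp_le[OF one_plus_square_pos] field_simps intro!: Bochner_Integration.integral_cong)

lemma prob_space_cauchy_law: "prob_space cauchy_law"
proof
  have "emeasure cauchy_law (space cauchy_law) = (\<integral>\<^sup>+v. ennreal (1 / (pi * (1 + v\<^sup>2))) \<partial>lborel)"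
    by (simp add: cauchy_law_def emeasure_density)
  also have "\<dots> = ennreal (LINT v|lborel. (1 / pi) * (1 / (1 + v\<^sup>2)))"
    using integrable_mult_right[OF integrable_one_plus_square, of "1 / pi"] one_plus_square_pos
    by (subst nn_integral_eq_integral[symmetric]) (auto simp: less_imp_le)
  also have "\<dots> = 1"
    by (simp only: integral_mult_right_zero integral_one_plus_square) simp
  finally show "emeasure cauchy_law (space cauchy_law) = 1" .
qed

interpretation cauchy: prob_space cauchy_law
  by (rule prob_space_cauchy_law)

interpretation cauchy: real_distribution cauchy_law
  by unfold_locales auto

lemma AE_cauchy_law_iff: "(AE v in cauchy_law. P v) \<longleftrightarrow> (AE v in lborel. P v)"
  unfolding cauchy_law_def
  by (subst AE_density) (auto simp: zero_less_divide_iff zero_less_mult_iff one_plus_square_pos)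

lemma distr_uminus_cauchy_law: "distr cauchy_law borel uminus = cauchy_law"
proof (rule measure_eqI)
  fix A :: "real set" assume "A \<in> sets (distr cauchy_law borel uminus)"
  then have A [measurable]: "A \<in> sets borel" by simp
  have "emeasure (distr cauchy_law borel uminus) A
      = (\<integral>\<^sup>+v. ennreal (1 / (pi * (1 + v\<^sup>2))) * indicator A (-v) \<partial>lborel)"
    unfolding cauchy_law_def
    by (subst emeasure_distr) (auto simp: emeasure_density indicator_def vimage_def intro!: nn_integral_cong)
  also have "\<dots> = (\<integral>\<^sup>+v. ennreal (1 / (pi * (1 + (-v)\<^sup>2))) * indicator A (-v) \<partial>lborel)" by simp
  also have "\<dots> = (\<integral>\<^sup>+v. ennreal (1 / (pi * (1 + v\<^sup>2))) * indicator A v \<partial>distr lborel borel uminus)"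
    by (subst nn_integral_distr) auto
  also have "\<dots> = emeasure cauchy_law A"
    unfolding cauchy_law_def by (simp add: lborel_distr_uminus emeasure_density)
  finally show "emeasure (distr cauchy_law borel uminus) A = emeasure cauchy_law A" .
qed simp

text \<open>The primitive of \<open>(f - f \<i>) / (w\<^sup>2 + 1)\<close> changes by \<open>O(1 / R)\<close> along the two sides of the
  triangle with vertices \<open>-R\<close>, \<open>\<i> R\<close>, \<open>R\<close>, so the integral of this function over the real line
  vanishes.\<close>

lemma Poisson_formula_i:
  assumes holf: "f holomorphic_on {w. Im w > - \<delta>}" and "\<delta> > 0"
    and bdd: "\<And>w. Im w \<ge> 0 \<Longrightarrow> norm (f w) \<le> M"
  shows "(LINT v|cauchy_law. f (of_real v)) = f \<i>"
proof -
  \<comment> \<open>The cap at 1 keeps the pole -i of \<open>g\<close> out of \<open>S\<close>; the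
    other zero i of w^2 + 1 is removable in \<open>q\<close>.\<close>
  define S where "S = {w. Im w > - min \<delta> 1}"
  have openS: "open S" and convS: "convex S"
    unfolding S_def by (auto intro: open_halfspace_Im_gt convex_halfspace_Im_gt)
  have fS: "f holomorphic_on S"
    using holf by (rule holomorphic_on_subset) (auto simp: S_def)
  define q where "q = (\<lambda>w. if w = \<i> then deriv f \<i> else (f w - f \<i>) / (w - \<i>))"
  have q: "q holomorphic_on S" unfolding q_def by (rule pole_lemma_open[OF fS openS])
  define g where "g = (\<lambda>w. q w / (w + \<i>))"
  have nz: "w + \<i> \<noteq> 0" if "w \<in> S" for w
    using that by (auto simp: S_def complex_eq_iff)
  have g: "g holomorphic_on S" unfolding g_def using nz q by (intro holomorphic_intros) auto
  have "\<exists>G. \<forall>w\<in>S. (G has_field_derivative g w) (at w within S)"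
    by (rule holomorphic_convex_primitive'[OF convS openS g]) auto
  then obtain G where G: "\<forall>w\<in>S. (G has_field_derivative g w) (at w within S)" ..
  have G': "(G has_field_derivative g w) (at w)" if "w \<in> S" for w
    using bspec[OF G that] unfolding at_within_open[OF that openS] .
  have realS: "of_real v \<in> S" for v using \<open>\<delta> > 0\<close> by (auto simp: S_def)
  have M0: "M \<ge> 0" using order_trans[OF norm_ge_zero bdd[of 0]] by simp
  have greal: "g (of_real v) = (f (of_real v) - f \<i>) / of_real (1 + v\<^sup>2)" for v
  proof -
    have n: "complex_of_real v \<noteq> \<i>" by (auto simp: complex_eq_iff)
    have e: "(of_real v - \<i>) * (of_real v + \<i>) = complex_of_real (1 + v\<^sup>2)"
      by (simp add: algebra_simps power2_eq_square)
    show ?thesis unfolding g_def q_def e[symmetric] using n by simp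
  qed
  \<comment> \<open>\<open>R / sqrt 2\<close> is the distance from 0 to the slanted sides of the
    triangle. \<open>R \<ge> 4\<close> keeps w away from i and lets R^2 / 2 absorb the constant in
    w^2 + 1.\<close>
  have gbound: "norm (g w) \<le> 8 * M / R\<^sup>2" if "Im w \<ge> 0" "norm w \<ge> R / sqrt 2" "R \<ge> 4" for w R
  proof -
    have r2: "sqrt 2 \<le> 2" by (rule real_le_lsqrt) auto
    have "R / 2 \<le> R / sqrt 2" using r2 \<open>R \<ge> 4\<close> by (intro divide_left_mono) auto
    then have n: "norm w \<ge> R / 2" "norm w \<ge> 2" using that by linarith+
    then have w: "w \<noteq> \<i>" by auto
    have "norm (w\<^sup>2) \<le> norm (w\<^sup>2 + 1) + norm (1::complex)"
      by (metis add_diff_cancel_right' norm_triangle_ineq4)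
    then have "norm (w\<^sup>2 + 1) \<ge> (norm w)\<^sup>2 - 1" by (simp add: norm_power)
    moreover have "(norm w)\<^sup>2 \<ge> R\<^sup>2 / 2"
      using power_mono[OF that(2), of 2] \<open>R \<ge> 4\<close> by (simp add: power_divide)
    moreover have "R\<^sup>2 \<ge> 4\<^sup>2" using \<open>R \<ge> 4\<close> by (intro power_mono) auto
    ultimately have d: "norm (w\<^sup>2 + 1) \<ge> R\<^sup>2 / 4" by simp
    have "g w = (f w - f \<i>) / (w\<^sup>2 + 1)"
      using w by (simp add: g_def q_def divide_divide_eq_left algebra_simps power2_eq_square)
    then have "norm (g w) = norm (f w - f \<i>) / norm (w\<^sup>2 + 1)" by (simp add: norm_divide)
    also have "\<dots> \<le> (2 * M) / (R\<^sup>2 / 4)"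
    proof (rule frac_le)
      show "norm (f w - f \<i>) \<le> 2 * M"
        using norm_triangle_ineq4[of "f w" "f \<i>"] bdd[of w] bdd[of \<i>] that by auto
    qed (use M0 d \<open>R \<ge> 4\<close> in auto)
    also have "\<dots> = 8 * M / R\<^sup>2" by simp
    finally show ?thesis .
  qed
  have Gside: "norm (G (of_real (s * R)) - G (\<i> * of_real R)) \<le> 8 * M / R\<^sup>2 * (2 * R)"
    if "R \<ge> 4" "s = 1 \<or> s = -1" for R s :: real
  proof -
    let ?L = "closed_segment (of_real (s * R)) (\<i> * of_real R)"
    have L: "Im w \<ge> 0 \<and> norm w \<ge> R / sqrt 2" if "w \<in> ?L" for w
    proof -
      obtain u where u: "0 \<le> u" "u \<le> 1" "w = (1 - u) *\<^sub>R of_real (s * R) + u *\<^sub>R (\<i> * of_real R)"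
        using \<open>w \<in> ?L\<close> by (auto simp: in_segment)
      then have im: "Im w = u * R" and re: "Re w = (1 - u) * (s * R)" by auto
      have "(norm w)\<^sup>2 = (1 - u)\<^sup>2 * R\<^sup>2 + u\<^sup>2 * R\<^sup>2"
        using \<open>s = 1 \<or> s = -1\<close> by (auto simp: cmod_power2 im re power_mult_distrib)
      also have "\<dots> = R\<^sup>2 / 2 + 2 * (u - 1/2)\<^sup>2 * R\<^sup>2" by (simp add: power2_eq_square field_simps)
      also have "\<dots> \<ge> R\<^sup>2 / 2" by simp
      finally have "(norm w)\<^sup>2 \<ge> (R / sqrt 2)\<^sup>2" by (simp add: power_divide)
      then have "norm w \<ge> R / sqrt 2" by (rule power2_le_imp_le) auto
      then show ?thesis using im u \<open>R \<ge> 4\<close> by auto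
    qed
    have "norm (G (of_real (s * R)) - G (\<i> * of_real R))
        \<le> 8 * M / R\<^sup>2 * norm (of_real (s * R) - \<i> * of_real R)"
    proof (rule field_differentiable_bound[of ?L _ g])
      fix w assume w: "w \<in> ?L"
      then have "w \<in> S" using L[OF w] \<open>\<delta> > 0\<close> by (auto simp: S_def)
      then show "(G has_field_derivative g w) (at w within ?L)"
        using G' has_field_derivative_at_within by blast
      show "norm (g w) \<le> 8 * M / R\<^sup>2" using L[OF w] gbound \<open>R \<ge> 4\<close> by auto
    qed auto
    also have "\<dots> \<le> 8 * M / R\<^sup>2 * (2 * R)"
    proof (rule mult_left_mono)
      have "norm (of_real (s * R) - \<i> * of_real R) \<le> norm (complex_of_real (s * R)) + norm (\<i> * of_real R)"
        by (rule norm_triangle_ineq4)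
      also have "\<dots> = 2 * R" using \<open>R \<ge> 4\<close> \<open>s = 1 \<or> s = -1\<close> by (auto simp: norm_mult)
      finally show "norm (of_real (s * R) - \<i> * of_real R) \<le> 2 * R" .
    qed (use M0 in auto)
    finally show ?thesis .
  qed
  have contg: "continuous_on UNIV (\<lambda>v. g (of_real v))"
  proof (rule continuous_on_compose2[OF holomorphic_on_imp_continuous_on[OF g]])
    show "continuous_on UNIV complex_of_real" by (intro continuous_intros)
  qed (use realS in auto)
  have contf: "continuous_on UNIV (\<lambda>v. f (of_real v))"
  proof (rule continuous_on_compose2[OF holomorphic_on_imp_continuous_on[OF fS]])
    show "continuous_on UNIV complex_of_real" by (intro continuous_intros)
  qed (use realS in auto)
  have [measurable]: "(\<lambda>v. g (of_real v)) \<in> borel_measurable borel"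
    "(\<lambda>v. f (of_real v)) \<in> borel_measurable borel"
    using contg contf by (auto intro: borel_measurable_continuous_onI)
  have FTC: "(LINT v|lborel. indicator {-R..R} v *\<^sub>R g (of_real v)) = G (of_real R) - G (of_real (-R))"
    if "R \<ge> 0" for R
  proof (rule integral_FTC_Icc)
    show "((\<lambda>v. G (of_real v)) has_vector_derivative g (of_real v)) (at v within {-R..R})" for v
    proof -
      have "((G \<circ> of_real) has_vector_derivative (1 * g (of_real v))) (at v within {-R..R})"
      proof (rule field_vector_diff_chain_within)
        show "(complex_of_real has_vector_derivative 1) (at v within {-R..R})"
          using bounded_linear.has_vector_derivative[OF bounded_linear_of_real has_vector_derivative_id]
          by simp
        show "(G has_field_derivative g (of_real v)) (at (of_real v) within complex_of_real ` {-R..R})"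
          by (rule has_field_derivative_at_within[OF G'[OF realS]])
      qed
      then show ?thesis by (simp add: o_def)
    qed
    show "continuous_on {-R..R} (\<lambda>v. g (of_real v))"
      using contg by (rule continuous_on_subset) auto
  qed (use that in auto)
  have norm_greal: "norm (g (of_real v)) \<le> 2 * M * (1 / (1 + v\<^sup>2))" for v
  proof -
    have "norm (g (of_real v)) = norm (f (of_real v) - f \<i>) / (1 + v\<^sup>2)"
      unfolding greal norm_divide norm_of_real using one_plus_square_pos[of v] by simp
    also have "\<dots> \<le> 2 * M / (1 + v\<^sup>2)"
      using norm_triangle_ineq4[of "f (of_real v)" "f \<i>"] bdd[of "of_real v"] bdd[of \<i>] one_plus_square_pos[of v]
      by (intro divide_right_mono) auto
    finally show ?thesis by simp
  qed
  have intg: "integrable lborel (\<lambda>v. g (of_real v))"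
    using norm_greal
    by (intro Bochner_Integration.integrable_bound[OF integrable_mult_right[OF integrable_one_plus_square, of "2 * M"]])
       (auto simp: abs_mult M0 less_imp_le[OF one_plus_square_pos] intro: order_trans)
  have lim: "(\<lambda>n. LINT v|lborel. indicator {- real n..real n} v *\<^sub>R g (of_real v))
      \<longlonglongrightarrow> (LINT v|lborel. g (of_real v))"
  proof (rule integral_dominated_convergence[where w = "\<lambda>v. norm (g (of_real v))"])
    show "AE v in lborel. (\<lambda>n. indicator {- real n..real n} v *\<^sub>R g (of_real v)) \<longlonglongrightarrow> g (of_real v)"
    proof (rule AE_I2)
      fix v :: real
      obtain N where "\<bar>v\<bar> \<le> real N" using real_arch_simple by blast
      then have "eventually (\<lambda>n. indicator {- real n..real n} v *\<^sub>R g (of_real v) = g (of_real v)) sequentially"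
        by (intro eventually_mono[OF eventually_ge_at_top[of N]]) (auto simp: indicator_def)
      then show "(\<lambda>n. indicator {- real n..real n} v *\<^sub>R g (of_real v)) \<longlonglongrightarrow> g (of_real v)"
        by (rule tendsto_eventually)
    qed
  qed (use intg in \<open>auto simp: indicator_def\<close>)
  have "(\<lambda>n. LINT v|lborel. indicator {- real n..real n} v *\<^sub>R g (of_real v)) \<longlonglongrightarrow> 0"
  proof (rule Lim_null_comparison)
    show "eventually (\<lambda>n. norm (LINT v|lborel. indicator {- real n..real n} v *\<^sub>R g (of_real v)) \<le> 32 * M / real n) sequentially"
      using eventually_ge_at_top[of 4]
    proof eventually_elim
      case (elim n)
      have "norm (G (of_real (real n)) - G (of_real (- real n)))
          \<le> norm (G (of_real (real n)) - G (\<i> * of_real (real n))) + norm (G (of_real (- real n)) - G (\<i> * of_real (real n)))"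
        using norm_triangle_ineq4[of "G (of_real (real n)) - G (\<i> * of_real (real n))" "G (of_real (- real n)) - G (\<i> * of_real (real n))"]
        by simp
      also have "\<dots> \<le> 2 * (8 * M / (real n)\<^sup>2 * (2 * real n))"
        using Gside[of "real n" 1] Gside[of "real n" "-1"] elim by auto
      also have "\<dots> = 32 * M / real n" using elim by (simp add: power2_eq_square field_simps)
      finally show ?case by (subst FTC) auto
    qed
    show "(\<lambda>n. 32 * M / real n) \<longlonglongrightarrow> 0" by (rule lim_const_over_n)
  qed
  with lim have int0: "(LINT v|lborel. g (of_real v)) = 0" by (rule LIMSEQ_unique)
  have int1: "integrable lborel (\<lambda>v. f \<i> * of_real (1 / (1 + v\<^sup>2)))"
    using integrable_one_plus_square by (intro integrable_mult_right integrable_of_real)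
  have "(LINT v|lborel. f (of_real v) / of_real (pi * (1 + v\<^sup>2)))
      = (LINT v|lborel. (g (of_real v) + f \<i> * of_real (1 / (1 + v\<^sup>2))) / of_real pi)"
  proof (rule Bochner_Integration.integral_cong)
    fix v :: real
    have "complex_of_real (1 + v\<^sup>2) \<noteq> 0"
      using one_plus_square_pos[of v] unfolding of_real_eq_0_iff by linarith
    then have "f (of_real v) = (g (of_real v) + f \<i> * of_real (1 / (1 + v\<^sup>2))) * of_real (1 + v\<^sup>2)"
      unfolding greal of_real_divide by (simp add: distrib_right del: of_real_add)
    then show "f (of_real v) / of_real (pi * (1 + v\<^sup>2)) = (g (of_real v) + f \<i> * of_real (1 / (1 + v\<^sup>2))) / of_real pi"
      using \<open>complex_of_real (1 + v\<^sup>2) \<noteq> 0\<close> by (simp del: of_real_add)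
  qed simp
  also have "\<dots> = ((LINT v|lborel. g (of_real v)) + f \<i> * (LINT v|lborel. of_real (1 / (1 + v\<^sup>2)))) / of_real pi"
    by (simp only: integral_divide_zero Bochner_Integration.integral_add[OF intg int1] integral_mult_right_zero)
  also have "\<dots> = f \<i>"
    unfolding int0 integral_complex_of_real integral_one_plus_square by simp
  finally show ?thesis by (simp add: integral_cauchy_law)
qed


text \<open>The map w -> x + y w + i eps takes i to x + i (y + eps) and the real line to height eps,
  so the formula at i applies. The shift by eps provides the neighbourhood of the closed half plane
  that a function on the open half plane lacks.\<close>

lemma Poisson_formula_shift:
  assumes holf: "f holomorphic_on {w. Im w > 0}"
    and bdd: "\<And>w. Im w > 0 \<Longrightarrow> norm (f w) \<le> M"
    and "\<epsilon> > 0" "y > 0"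
  shows "(LINT v|cauchy_law. f (Complex (x + y * v) \<epsilon>)) = f (Complex x (y + \<epsilon>))"
proof -
  let ?a = "\<lambda>w. of_real x + of_real y * w + \<i> * of_real \<epsilon>"
  have "(LINT v|cauchy_law. (f \<circ> ?a) (of_real v)) = (f \<circ> ?a) \<i>"
  proof (rule Poisson_formula_i)
    have "\<epsilon> + y * Im w > 0" if "Im w > - (\<epsilon> / y)" for w
      using that \<open>y > 0\<close> by (simp add: field_simps)
    then show "(f \<circ> ?a) holomorphic_on {w. Im w > - (\<epsilon> / y)}"
      by (intro holomorphic_on_compose holomorphic_on_subset[OF holf] holomorphic_intros) (auto simp: add.commute)
    show "norm ((f \<circ> ?a) w) \<le> M" if "Im w \<ge> 0" for w
      using that assms by (auto simp: add_nonneg_pos intro!: bdd)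
  qed (use assms in auto)
  moreover have "?a (of_real v) = Complex (x + y * v) \<epsilon>" for v by (simp add: complex_eq_iff)
  moreover have "?a \<i> = Complex x (y + \<epsilon>)" by (simp add: complex_eq_iff)
  ultimately show ?thesis by (simp add: o_def)
qed

section \<open>Boundary values of bounded holomorphic functions\<close>

lemma AE_lborel_uminus_iff:
  fixes P :: "real \<Rightarrow> bool"
  assumes "AE x in lborel. P x"
  shows "AE x in lborel. P (- x)"
proof -
  have "AE x in distr lborel borel uminus. P x"
    unfolding lborel_distr_uminus by (rule assms)
  then show ?thesis by (rule AE_distrD[rotated]) simp
qed

lemma set_integrable_bounded_Icc:
  fixes f :: "real \<Rightarrow> real"
  assumes [measurable]: "f \<in> borel_measurable borel" and bdd: "\<And>x. \<bar>f x\<bar> \<le> M"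
  shows "set_integrable lborel {a..b} f"
  unfolding set_integrable_def
  using bdd by (intro integrableI_bounded_set_indicator[where B = M]) (auto simp: emeasure_lborel_Icc_eq)

text \<open>One-sided Lebesgue differentiation theorem: in dimension one the boxes of
  \<open>integrable_ccontinuous_explicit\<close> are exactly the intervals from x to x + h.\<close>

lemma AE_tendsto_average_right:
  fixes f :: "real \<Rightarrow> real"
  assumes int: "\<And>a b. set_integrable lborel {a..b} f"
  shows "AE x in lborel. ((\<lambda>h. (LINT s:{x..x+h}|lborel. f s) / h) \<longlongrightarrow> f x) (at_right 0)"
proof -
  have eq: "integral {a..b} f = (LINT s:{a..b}|lborel. f s)" for a b
    using set_borel_integral_eq_integral(2)[OF int] by simp
  have "f integrable_on cbox a b" for a b :: real
    using set_borel_integral_eq_integral(1)[OF int] by simp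
  then obtain N where N: "negligible N" "\<And>x e. \<lbrakk>x \<notin> N; 0 < e\<rbrakk> \<Longrightarrow>
      \<exists>d>0. \<forall>h. 0 < h \<and> h < d \<longrightarrow> norm (integral (cbox x (x + h *\<^sub>R One)) f /\<^sub>R h ^ DIM(real) - f x) < e"
    by (rule integrable_ccontinuous_explicit) blast
  have "((\<lambda>h. (LINT s:{x..x+h}|lborel. f s) / h) \<longlongrightarrow> f x) (at_right 0)" if "x \<notin> N" for x
    unfolding tendsto_iff
  proof (intro allI impI)
    fix e :: real assume "e > 0"
    from N(2)[OF that this] obtain d where "d > 0"
      "\<And>h. 0 < h \<Longrightarrow> h < d \<Longrightarrow> norm (integral (cbox x (x + h *\<^sub>R One)) f /\<^sub>R h ^ DIM(real) - f x) < e"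
      by blast
    then show "\<forall>\<^sub>F h in at_right 0. dist ((LINT s:{x..x+h}|lborel. f s) / h) (f x) < e"
      by (intro eventually_mono[OF eventually_at_right_less[of 0]] eventually_at_rightI[of 0 d])
         (auto simp: dist_norm eq divide_inverse mult.commute)
  qed
  moreover have "AE x in lebesgue. x \<notin> N"
    using N(1) by (intro AE_not_in) (simp add: negligible_iff_null_sets)
  ultimately have "AE x in lebesgue. ((\<lambda>h. (LINT s:{x..x+h}|lborel. f s) / h) \<longlongrightarrow> f x) (at_right 0)"
    by auto
  then show ?thesis by (simp add: AE_completion_iff)
qed

text \<open>Differentiation is applied to |f - q| for all q in a countable dense set, outside one
  common null set; then q is chosen close to f x. Left averages come from right averages by
  reflection. The divisor h in place of 2 h does not affect a limit 0.\<close>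

lemma AE_Lebesgue_point:
  fixes f :: "real \<Rightarrow> complex"
  assumes [measurable]: "f \<in> borel_measurable borel" and bdd: "\<And>x. norm (f x) \<le> M"
  shows "AE x in lborel. ((\<lambda>h. (LINT s:{x-h..x+h}|lborel. norm (f s - f x)) / h) \<longlongrightarrow> 0) (at_right 0)"
proof -
  obtain D :: "complex set" where D: "countable D" "\<And>X. open X \<Longrightarrow> X \<noteq> {} \<Longrightarrow> \<exists>d\<in>D. d \<in> X"
    by (rule countable_dense_setE) blast
  define g where "g = (\<lambda>q s. norm (f s - q))"
  have [measurable]: "g q \<in> borel_measurable borel" for q unfolding g_def by measurable
  have gb: "\<bar>g q s\<bar> \<le> M + norm q" for q s
    unfolding g_def using norm_triangle_ineq4[of "f s" q] bdd[of s] by simp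
  have gint: "set_integrable lborel {a..b} (g q)" for a b q
    using gb[of q] by (intro set_integrable_bounded_Icc) auto
  have right: "AE x in lborel. ((\<lambda>h. (LINT s:{x..x+h}|lborel. g q s) / h) \<longlongrightarrow> g q x) (at_right 0)" for q
    by (intro AE_tendsto_average_right gint)
  have refl: "(LINT s:{-x..h-x}|lborel. g q (- s)) = (LINT s:{x-h..x}|lborel. g q s)" for x h q
    unfolding set_lebesgue_integral_def
    by (subst lborel_integral_real_affine[of "-1" _ 0])
       (auto simp: indicator_def intro!: Bochner_Integration.integral_cong)
  have left: "AE x in lborel. ((\<lambda>h. (LINT s:{x-h..x}|lborel. g q s) / h) \<longlongrightarrow> g q x) (at_right 0)" for q
  proof -
    have "AE x in lborel. ((\<lambda>h. (LINT s:{x..x+h}|lborel. g q (- s)) / h) \<longlongrightarrow> g q (- x)) (at_right 0)"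
      using gb[of q] by (intro AE_tendsto_average_right set_integrable_bounded_Icc) auto
    from AE_lborel_uminus_iff[OF this] show ?thesis by (simp add: refl)
  qed
  have "AE x in lborel. \<forall>q\<in>D. ((\<lambda>h. (LINT s:{x..x+h}|lborel. g q s) / h) \<longlongrightarrow> g q x) (at_right 0) \<and>
      ((\<lambda>h. (LINT s:{x-h..x}|lborel. g q s) / h) \<longlongrightarrow> g q x) (at_right 0)"
    using D(1) left right by (subst AE_ball_countable) auto
  then show ?thesis
  proof eventually_elim
    case (elim x)
    show ?case unfolding tendsto_iff
    proof (intro allI impI)
      fix e :: real assume "e > 0"
      \<comment> \<open>The two one-sided averages of |f - q| contribute less than 2 e / 6.
        Replacing q by f x costs e / 6 on an interval of length 2 h, hence another 2 e / 6 after
        division by h.\<close>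
      obtain q where q: "q \<in> D" "q \<in> ball (f x) (e / 6)"
        using D(2)[of "ball (f x) (e / 6)"] \<open>e > 0\<close> by auto
      have gx: "g q x < e / 6" using q by (simp add: g_def dist_norm)
      have "((\<lambda>h. (LINT s:{x-h..x}|lborel. g q s) / h + (LINT s:{x..x+h}|lborel. g q s) / h) \<longlongrightarrow> g q x + g q x) (at_right 0)"
        using elim q by (intro tendsto_add) auto
      then have "\<forall>\<^sub>F h in at_right 0. (LINT s:{x-h..x}|lborel. g q s) / h + (LINT s:{x..x+h}|lborel. g q s) / h < 2 * e / 6"
        by (rule order_tendstoD) (use gx in simp)
      then show "\<forall>\<^sub>F h in at_right 0. dist ((LINT s:{x-h..x+h}|lborel. norm (f s - f x)) / h) 0 < e"
        using eventually_at_right_less[of 0]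
      proof eventually_elim
        case (elim h)
        then have "h > 0" by simp
        have int: "integrable lborel (\<lambda>s. indicator {x-h..x} s *\<^sub>R g q s)"
          "integrable lborel (\<lambda>s. indicator {x..x+h} s *\<^sub>R g q s)"
          "integrable lborel (\<lambda>s. indicator {x-h..x+h} s *\<^sub>R g (f x) s)"
          "integrable lborel (\<lambda>s. indicator {x-h..x+h} s *\<^sub>R (e / 6))"
          using gint set_integrable_bounded_Icc[of "\<lambda>_. e / 6" "\<bar>e / 6\<bar>" "x - h" "x + h"]
          unfolding set_integrable_def by (simp_all only: borel_measurable_const order_refl)
        have "(LINT s:{x-h..x+h}|lborel. norm (f s - f x))
           = (LINT s|lborel. indicator {x-h..x+h} s *\<^sub>R g (f x) s)"
          by (simp only: g_def set_lebesgue_integral_def)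
        also have "\<dots> \<le> (LINT s|lborel. indicator {x-h..x} s *\<^sub>R g q s + indicator {x..x+h} s *\<^sub>R g q s
              + indicator {x-h..x+h} s *\<^sub>R (e / 6))"
        proof (rule integral_mono)
          fix s
          have "g (f x) s \<le> g q s + e / 6"
            using norm_triangle_ineq[of "f s - q" "q - f x"] q by (simp add: g_def dist_norm norm_minus_commute)
          moreover have "g q s \<ge> 0" by (simp add: g_def)
          ultimately show "indicator {x-h..x+h} s *\<^sub>R g (f x) s
              \<le> indicator {x-h..x} s *\<^sub>R g q s + indicator {x..x+h} s *\<^sub>R g q s + indicator {x-h..x+h} s *\<^sub>R (e / 6)"
            by (auto simp: indicator_def)
        qed (intro int Bochner_Integration.integrable_add)+
        also have "\<dots> = (LINT s:{x-h..x}|lborel. g q s) + (LINT s:{x..x+h}|lborel. g q s) + 2 * h * (e / 6)"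
          using int \<open>h > 0\<close> unfolding set_lebesgue_integral_def by simp
        finally have "(LINT s:{x-h..x+h}|lborel. norm (f s - f x)) / h
           \<le> ((LINT s:{x-h..x}|lborel. g q s) + (LINT s:{x..x+h}|lborel. g q s) + 2 * h * (e / 6)) / h"
          using \<open>h > 0\<close> by (intro divide_right_mono) auto
        also have "\<dots> = (LINT s:{x-h..x}|lborel. g q s) / h + (LINT s:{x..x+h}|lborel. g q s) / h + 2 * e / 6"
          using \<open>h > 0\<close> by (simp add: add_divide_distrib)
        also have "\<dots> < e" using elim(1) \<open>e > 0\<close> by linarith
        finally have "(LINT s:{x-h..x+h}|lborel. norm (f s - f x)) / h < e" .
        moreover have "(LINT s:{x-h..x+h}|lborel. norm (f s - f x)) \<ge> 0"
          unfolding set_lebesgue_integral_def by (intro Bochner_Integration.integral_nonneg) auto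
        ultimately show ?case using \<open>h > 0\<close> by (simp add: dist_norm)
      qed
    qed
  qed
qed


section \<open>Almost everywhere convergence of Poisson integrals\<close>

lemma integral_cauchy_law_le:
  fixes g :: "real \<Rightarrow> real"
  assumes [measurable]: "g \<in> borel_measurable borel" and "\<And>v. 0 \<le> g v" "\<And>v. g v \<le> M"
  shows "(LINT v|cauchy_law. indicator {-K..K} v * g v) \<le> (1 / pi) * (LINT v:{-K..K}|lborel. g v)"
proof -
  have "set_integrable lborel {-K..K} g"
    using assms by (intro set_integrable_bounded_Icc[where M = M]) auto
  then have int: "integrable lborel (\<lambda>v. indicator {-K..K} v * g v)" by (simp add: set_integrable_def)
  have le: "(1 / (pi * (1 + v\<^sup>2))) * (indicator {-K..K} v * g v) \<le> (1 / pi) * (indicator {-K..K} v * g v)" for v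
    using assms(2)[of v] one_plus_square_pos[of v]
    by (intro mult_right_mono frac_le) (auto simp: zero_less_mult_iff)
  have nn: "(1 / (pi * (1 + v\<^sup>2))) * (indicator {-K..K} v * g v) \<ge> 0" for v
    using assms(2)[of v] one_plus_square_pos[of v] by auto
  have "(LINT v|cauchy_law. indicator {-K..K} v * g v)
      = (LINT v|lborel. (1 / (pi * (1 + v\<^sup>2))) * (indicator {-K..K} v * g v))"
    unfolding cauchy_law_def
    by (subst integral_density) (auto simp: less_imp_le[OF one_plus_square_pos])
  also have "\<dots> \<le> (LINT v|lborel. (1 / pi) * (indicator {-K..K} v * g v))"
  proof (rule integral_mono[OF _ _ le])
    show int': "integrable lborel (\<lambda>v. (1 / pi) * (indicator {-K..K} v * g v))"
      using int by (rule integrable_mult_right)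
    show "integrable lborel (\<lambda>v. (1 / (pi * (1 + v\<^sup>2))) * (indicator {-K..K} v * g v))"
    proof (rule Bochner_Integration.integrable_bound[OF int'], measurable, rule AE_I2)
      fix v show "norm ((1 / (pi * (1 + v\<^sup>2))) * (indicator {-K..K} v * g v)) \<le> norm ((1 / pi) * (indicator {-K..K} v * g v))"
        using le[of v] nn[of v] by (simp only: real_norm_def)
    qed
  qed
  finally show ?thesis by (simp add: set_lebesgue_integral_def)
qed

lemma cauchy_law_tail:
  assumes "e > 0"
  obtains K :: real where "K > 0" "measure cauchy_law (- {-K..K}) < e"
proof -
  have "(\<lambda>n. measure cauchy_law {- real n..real n}) \<longlonglongrightarrow> measure cauchy_law (\<Union>n. {- real n..real n})"
    by (intro cauchy.finite_Lim_measure_incseq) (auto simp: incseq_def)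
  moreover have "(\<Union>n. {- real n..real n}) = UNIV"
    by (auto simp: abs_le_iff[symmetric] minus_le_iff intro: real_arch_simple[of "\<bar>_\<bar>"])
       (metis abs_le_iff minus_le_iff real_arch_simple)
  ultimately have "(\<lambda>n. measure cauchy_law {- real n..real n}) \<longlonglongrightarrow> 1"
    using cauchy.prob_space by simp
  then have "\<forall>\<^sub>F n in sequentially. measure cauchy_law {- real n..real n} > 1 - e"
    by (rule order_tendstoD) (use \<open>e > 0\<close> in simp)
  then have "\<forall>\<^sub>F n in sequentially. measure cauchy_law {- real n..real n} > 1 - e \<and> n > 0"
    using eventually_gt_at_top[of 0] by (rule eventually_conj)
  then obtain n where n: "measure cauchy_law {- real n..real n} > 1 - e" "n > 0"
    by (metis (no_types, lifting) eventually_sequentially order_refl)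
  then show thesis
    using cauchy.prob_compl[of "{- real n..real n}"] by (intro that[of "real n"]) (auto simp: Compl_eq_Diff_UNIV)
qed

text \<open>Convergence holds at every Lebesgue point x. For |v| at most K the Cauchy density is at
  most 1 / pi, and substituting s = x + y v gives an average of |f - f x| over a window of radius K
  y; the remaining v carry little Cauchy mass and |f - f x| is bounded.\<close>

lemma AE_Poisson_integral_tendsto:
  fixes f :: "real \<Rightarrow> complex"
  assumes [measurable]: "f \<in> borel_measurable borel" and bdd: "\<And>x. norm (f x) \<le> M"
  shows "AE x in lborel. ((\<lambda>y. LINT v|cauchy_law. f (x + y * v)) \<longlongrightarrow> f x) (at_right 0)"
  using AE_Lebesgue_point[OF assms]
proof eventually_elim
  case (elim x)
  define d where "d = (\<lambda>s. norm (f s - f x))"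
  have [measurable]: "d \<in> borel_measurable borel" unfolding d_def by measurable
  have M0: "M \<ge> 0" using order_trans[OF norm_ge_zero bdd] by blast
  have d2M: "d s \<le> 2 * M" for s
    unfolding d_def using norm_triangle_ineq4[of "f s" "f x"] bdd[of s] bdd[of x] by linarith
  have d0: "d s \<ge> 0" for s by (simp add: d_def)
  have intf: "integrable cauchy_law (\<lambda>v. f (x + y * v))" for y
    using bdd by (intro cauchy.integrable_const_bound[where B = M]) auto
  have intd: "integrable cauchy_law (\<lambda>v. d (x + y * v))" for y
    using d2M d0 by (intro cauchy.integrable_const_bound[where B = "2 * M"]) auto
  show ?case unfolding tendsto_iff
  proof (intro allI impI)
    fix e :: real assume "e > 0"
    \<comment> \<open>Chosen so that the tail, where the integrand is at most 2 M, contributes at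
      most e / 2; the summand 1 covers M = 0.\<close>
    have "e / (4 * M + 1) > 0" using M0 \<open>e > 0\<close> by simp
    then obtain K where K: "K > 0" "measure cauchy_law (- {-K..K}) < e / (4 * M + 1)"
      by (rule cauchy_law_tail)
    have "2 * M * measure cauchy_law (- {-K..K}) \<le> 2 * M * (e / (4 * M + 1))"
      using K M0 by (intro mult_left_mono) auto
    also have "\<dots> \<le> e / 2" using M0 \<open>e > 0\<close> by (simp add: field_simps)
    finally have tail: "2 * M * measure cauchy_law (- {-K..K}) \<le> e / 2" .
    have "filterlim (\<lambda>y. K * y) (at_right 0) (at_right 0)"
      using K by real_asymp
    with elim have "((\<lambda>y. (LINT s:{x-K*y..x+K*y}|lborel. d s) / (K * y)) \<longlongrightarrow> 0) (at_right 0)"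
      unfolding d_def by (rule filterlim_compose)
    then have "((\<lambda>y. (K / pi) * ((LINT s:{x-K*y..x+K*y}|lborel. d s) / (K * y))) \<longlongrightarrow> (K / pi) * 0) (at_right 0)"
      by (intro tendsto_intros)
    then have "\<forall>\<^sub>F y in at_right 0. (K / pi) * ((LINT s:{x-K*y..x+K*y}|lborel. d s) / (K * y)) < e / 2"
      by (rule order_tendstoD) (use \<open>e > 0\<close> in simp)
    then show "\<forall>\<^sub>F y in at_right 0. dist (LINT v|cauchy_law. f (x + y * v)) (f x) < e"
      using eventually_at_right_less[of 0]
    proof eventually_elim
      case (elim y)
      then have "y > 0" by simp
      have "(LINT v|cauchy_law. f (x + y * v)) - f x = (LINT v|cauchy_law. f (x + y * v) - f x)"
        using intf cauchy.prob_space by (subst Bochner_Integration.integral_diff) auto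
      also have "norm \<dots> \<le> (LINT v|cauchy_law. d (x + y * v))"
        unfolding d_def by (rule integral_norm_bound)
      also have "\<dots> \<le> (LINT v|cauchy_law. indicator {-K..K} v * d (x + y * v) + (2 * M) * indicator (- {-K..K}) v)"
        using d2M d0 M0
        by (intro integral_mono intd Bochner_Integration.integrable_add
              cauchy.integrable_const_bound[where B = "2 * M"]) (auto simp: indicator_def)
      also have "\<dots> = (LINT v|cauchy_law. indicator {-K..K} v * d (x + y * v)) + 2 * M * measure cauchy_law (- {-K..K})"
      proof -
        have "integrable cauchy_law (\<lambda>v. indicator {-K..K} v * d (x + y * v))"
          using d2M d0 M0 by (intro cauchy.integrable_const_bound[where B = "2 * M"]) (auto simp: indicator_def)
        moreover have "integrable cauchy_law (indicat_real (- {-K..K}))"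
          by (intro cauchy.integrable_const_bound[where B = 1]) (auto simp: indicator_def)
        ultimately show ?thesis
          by (subst Bochner_Integration.integral_add) auto
      qed
      also have "(LINT v|cauchy_law. indicator {-K..K} v * d (x + y * v))
          \<le> (1 / pi) * (LINT v:{-K..K}|lborel. d (x + y * v))"
        using d2M d0 by (intro integral_cauchy_law_le[where M = "2 * M"]) auto
      also have "(LINT v:{-K..K}|lborel. d (x + y * v)) = (LINT s:{x-K*y..x+K*y}|lborel. d s) / y"
      proof -
        have "(LINT s:{x-K*y..x+K*y}|lborel. d s)
            = \<bar>y\<bar> *\<^sub>R (LINT v|lborel. indicator {x-K*y..x+K*y} (x + y * v) *\<^sub>R d (x + y * v))"
          unfolding set_lebesgue_integral_def
          by (rule lborel_integral_real_affine) (use \<open>y > 0\<close> in simp)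
        also have "(\<lambda>v. indicat_real {x-K*y..x+K*y} (x + y * v)) = indicator {-K..K}"
        proof
          fix v
          have "x - K * y \<le> x + y * v \<longleftrightarrow> y * (- K) \<le> y * v" "x + y * v \<le> x + K * y \<longleftrightarrow> y * v \<le> y * K"
            by (auto simp: algebra_simps)
          then show "indicat_real {x-K*y..x+K*y} (x + y * v) = indicator {-K..K} v"
            using \<open>y > 0\<close> unfolding mult_le_cancel_left_pos[OF \<open>y > 0\<close>] indicator_def by auto
        qed
        finally show ?thesis using \<open>y > 0\<close> by (simp add: set_lebesgue_integral_def)
      qed
      also have "(1 / pi) * ((LINT s:{x-K*y..x+K*y}|lborel. d s) / y)
          = (K / pi) * ((LINT s:{x-K*y..x+K*y}|lborel. d s) / (K * y))"
        using K by simp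
      finally show ?case using elim(1) tail by (simp add: dist_norm)
    qed
  qed
qed

text \<open>Adding a steep linear function makes \<open>g\<close> an increasing bi-Lipschitz
  bijection \<open>H\<close>. The image of Lebesgue measure under its inverse gives [a, b] the mass
  H b - H a and is absolutely continuous, so difference quotients of \<open>H\<close> are averages
  of a Radon-Nikodym density, and Lebesgue differentiation applies.\<close>

lemma Lipschitz_AE_right_derivative_real:
  fixes g :: "real \<Rightarrow> real"
  assumes lip: "\<And>x y. \<bar>g x - g y\<bar> \<le> K * \<bar>x - y\<bar>"
  obtains f where "f \<in> borel_measurable borel" "\<And>x. \<bar>f x\<bar> \<le> K"
    "AE x in lborel. ((\<lambda>h. (g (x + h) - g x) / h) \<longlongrightarrow> f x) (at_right 0)"
proof -
  have K0: "K \<ge> 0" using lip[of 1 0] by simp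
  \<comment> \<open>With this choice the slopes of \<open>H\<close> lie between L and 3 L, and L is
    positive even when K = 0.\<close>
  define L where "L = K + 1"
  have L: "L > 0" "L \<ge> K" using K0 by (auto simp: L_def)
  define H where "H = (\<lambda>x. g x + 2 * L * x)"
  have Hlow: "L * (y - x) \<le> H y - H x" and Hup: "H y - H x \<le> 3 * L * (y - x)" if "x \<le> y" for x y
  proof -
    have "\<bar>g y - g x\<bar> \<le> K * (y - x)" using lip[of y x] that by simp
    also have "\<dots> \<le> L * (y - x)" using L that by (intro mult_right_mono) auto
    finally show "L * (y - x) \<le> H y - H x" "H y - H x \<le> 3 * L * (y - x)"
      by (auto simp: H_def algebra_simps)
  qed
  have mono: "H x < H y" if "x < y" for x y
    using Hlow[of x y] that L by (smt (verit) mult_pos_pos)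
  then have smono: "strict_mono H" by (simp add: strict_mono_def)
  then have injH: "inj H" by (rule strict_mono_imp_inj_on)
  have Hlip: "\<bar>H y - H x\<bar> \<le> 3 * L * \<bar>y - x\<bar>" for x y
    using Hup[of x y] Hup[of y x] Hlow[of x y] Hlow[of y x] L
    by (cases "x \<le> y") (auto simp: abs_if algebra_simps split: if_splits)
  have contH: "continuous_on UNIV H"
    by (rule lipschitz_on_continuous_on[where L = "3 * L"])
       (use Hlip L in \<open>auto simp: lipschitz_on_def dist_real_def\<close>)
  have surjH: "\<exists>x. H x = y" for y
  proof -
    define r where "r = (\<bar>y\<bar> + \<bar>H 0\<bar>) / L"
    have r: "r \<ge> 0" "L * r = \<bar>y\<bar> + \<bar>H 0\<bar>" using L by (auto simp: r_def)
    have "H (-r) \<le> y" "y \<le> H r" using Hlow[of "-r" 0] Hlow[of 0 r] r by auto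
    then show ?thesis
      using IVT'[of H "-r" y r] r continuous_on_subset[OF contH] by auto
  qed
  define G where "G = inv H"
  have HG: "H (G y) = y" and GH: "G (H x) = x" for x y
    using surjH injH by (auto simp: G_def f_inv_into_f image_iff inv_f_f) (metis f_inv_into_f rangeI)
  have monoG: "mono G"
    by (rule monoI) (metis HG less_le_not_le mono not_le)
  then have [measurable]: "G \<in> borel_measurable borel" by (rule borel_measurable_mono)
  define m where "m = distr lborel borel G"
  have vim: "G -` N = H ` N" for N
  proof (rule set_eqI)
    fix y show "y \<in> G -` N \<longleftrightarrow> y \<in> H ` N" using HG[of y] GH by (metis image_iff vimage_eq)
  qed
  \<comment> \<open>The preimage of a null set under \<open>G\<close> is its image under the
    Lipschitz map \<open>H\<close>, hence again null.\<close>
  have "absolutely_continuous lborel m"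
    unfolding absolutely_continuous_def
  proof
    fix N :: "real set" assume N: "N \<in> null_sets lborel"
    then have "negligible N" by (simp add: negligible_iff_null_sets null_sets_completionI)
    then have "negligible (H ` N)"
    proof (rule negligible_locally_Lipschitz_image[rotated])
      show "\<exists>T B. open T \<and> x \<in> T \<and> (\<forall>y\<in>N \<inter> T. norm (H y - H x) \<le> B * norm (y - x))" for x
        using Hlip by (intro exI[of _ UNIV] exI[of _ "3 * L"]) auto
    qed simp
    moreover have "G -` N \<in> sets borel" using N measurable_sets_borel[of G borel N] by auto
    ultimately have "emeasure lborel (G -` N) = 0"
      by (simp add: vim negligible_iff_null_sets null_sets_completion_iff null_setsD1)
    then show "N \<in> null_sets m" using N by (intro null_setsI) (auto simp: m_def emeasure_distr null_setsD2)
  qed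
  then obtain f0 where f0 [measurable]: "f0 \<in> borel_measurable borel" and dens: "density lborel f0 = m"
    using sigma_finite_measure.Radon_Nikodym[OF sigma_finite_lborel, of m] by (auto simp: m_def)
  have mIcc: "(\<integral>\<^sup>+x. f0 x * indicator {a..b} x \<partial>lborel) = ennreal (H b - H a)" if "a \<le> b" for a b
  proof -
    have "(\<integral>\<^sup>+x. f0 x * indicator {a..b} x \<partial>lborel) = emeasure m {a..b}"
      by (simp add: dens[symmetric] emeasure_density)
    also have "\<dots> = emeasure lborel (G -` {a..b})" by (simp add: m_def emeasure_distr)
    also have "G -` {a..b} = {H a..H b}"
      using monoG HG GH unfolding mono_def by (auto simp: vimage_def) (metis HG smono strict_mono_less_eq)+
    finally show ?thesis using Hlow[OF that] L that by (simp add: emeasure_lborel_Icc_eq)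
       (smt (verit) mult_nonneg_nonneg)
  qed
  define f1 where "f1 = (\<lambda>x. enn2real (f0 x))"
  have [measurable]: "f1 \<in> borel_measurable borel" unfolding f1_def by measurable
  have fin: "AE x in lborel. f0 x < \<infinity>"
  proof -
    have "AE x in lborel. f0 x * indicator {- real n..real n} x \<noteq> \<infinity>" for n
      by (rule nn_integral_PInf_AE) (auto simp: mIcc)
    then have "AE x in lborel. \<forall>n. f0 x * indicator {- real n..real n} x \<noteq> \<infinity>"
      by (simp add: AE_all_countable)
    then show ?thesis
    proof eventually_elim
      case (elim x)
      obtain n where "\<bar>x\<bar> \<le> real n" using real_arch_simple by blast
      then show ?case using elim[rule_format, of n] by (auto simp: indicator_def abs_le_iff less_top)
    qed
  qed
  have hbi: "has_bochner_integral lborel (\<lambda>x. indicator {a..b} x *\<^sub>R f1 x) (H b - H a)" if "a \<le> b" for a b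
  proof (rule has_bochner_integral_nn_integral)
    have "(\<integral>\<^sup>+x. ennreal (indicator {a..b} x *\<^sub>R f1 x) \<partial>lborel) = (\<integral>\<^sup>+x. f0 x * indicator {a..b} x \<partial>lborel)"
      by (rule nn_integral_cong_AE, use fin in eventually_elim)
         (auto simp: f1_def indicator_def)
    then show "(\<integral>\<^sup>+x. ennreal (indicator {a..b} x *\<^sub>R f1 x) \<partial>lborel) = ennreal (H b - H a)"
      using mIcc[OF that] by simp
    have "0 \<le> L * (b - a)" using L that by simp
    then show "0 \<le> H b - H a" using Hlow[OF that] by linarith
  qed (auto simp: f1_def)
  have int: "set_integrable lborel {a..b} f1" for a b
    using hbi[of a b] by (cases "a \<le> b") (auto simp: set_integrable_def has_bochner_integral_iff)
  have "AE x in lborel. ((\<lambda>h. (LINT s:{x..x+h}|lborel. f1 s) / h) \<longlongrightarrow> f1 x) (at_right 0)"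
    by (rule AE_tendsto_average_right[OF int])
  then have der: "AE x in lborel. ((\<lambda>h. (g (x + h) - g x) / h) \<longlongrightarrow> f1 x - 2 * L) (at_right 0)"
  proof eventually_elim
    case (elim x)
    have "((\<lambda>h. (LINT s:{x..x+h}|lborel. f1 s) / h - 2 * L) \<longlongrightarrow> f1 x - 2 * L) (at_right 0)"
      by (intro tendsto_intros elim)
    moreover have "\<forall>\<^sub>F h in at_right 0. (LINT s:{x..x+h}|lborel. f1 s) / h - 2 * L = (g (x + h) - g x) / h"
      using eventually_at_right_less[of 0]
    proof eventually_elim
      case (elim h)
      then have "(LINT s:{x..x+h}|lborel. f1 s) = H (x + h) - H x"
        using hbi[of x "x + h"] by (simp add: has_bochner_integral_iff set_lebesgue_integral_def)
      then show ?case using elim by (simp add: H_def field_simps)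
    qed
    ultimately show ?case by (rule Lim_transform_eventually)
  qed
  \<comment> \<open>The difference quotients are bounded by K, so the truncation alters the
    derivative on a null set only. It gives measurability and the bound at every point.\<close>
  define f where "f = (\<lambda>x. if \<bar>f1 x - 2 * L\<bar> \<le> K then f1 x - 2 * L else 0)"
  show thesis
  proof (rule that)
    show "f \<in> borel_measurable borel" unfolding f_def by measurable
    show "\<bar>f x\<bar> \<le> K" for x using K0 by (simp add: f_def)
    show "AE x in lborel. ((\<lambda>h. (g (x + h) - g x) / h) \<longlongrightarrow> f x) (at_right 0)"
      using der
    proof eventually_elim
      case (elim x)
      have "\<bar>f1 x - 2 * L\<bar> \<le> K"
      proof (rule tendsto_upperbound)
        show "((\<lambda>h. \<bar>(g (x + h) - g x) / h\<bar>) \<longlongrightarrow> \<bar>f1 x - 2 * L\<bar>) (at_right 0)"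
          by (intro tendsto_rabs elim)
        show "\<forall>\<^sub>F h in at_right 0. \<bar>(g (x + h) - g x) / h\<bar> \<le> K"
          using eventually_at_right_less[of 0]
        proof eventually_elim
          case (elim h)
          then show ?case using lip[of "x + h" x] by (simp add: abs_div field_simps)
        qed
      qed simp
      then show ?case using elim by (simp add: f_def)
    qed
  qed
qed


section \<open>Boundary functions of bounded holomorphic functions\<close>

lemma AE_lborel_affine:
  fixes P :: "real \<Rightarrow> bool"
  assumes "AE x in lborel. P x" "c \<noteq> 0"
  shows "AE x in lborel. P (t + c * x)"
proof -
  have "AE x in density (distr lborel borel (\<lambda>x. t + c * x)) (\<lambda>_. ennreal \<bar>c\<bar>). P x"
    unfolding lborel_real_affine[OF assms(2), of t, symmetric] by (rule assms)
  then have "AE x in distr lborel borel (\<lambda>x. t + c * x). P x"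
    using \<open>c \<noteq> 0\<close> by (subst (asm) AE_density) auto
  then show ?thesis by (rule AE_distrD[rotated]) simp
qed

lemma tendsto_at_right_seq:
  fixes f :: "real \<Rightarrow> 'a::topological_space"
  assumes "(f \<longlongrightarrow> l) (at_right 0)"
  shows "(\<lambda>n. f (1 / real (Suc n))) \<longlonglongrightarrow> l"
proof (rule filterlim_compose[OF assms])
  show "filterlim (\<lambda>n. 1 / real (Suc n)) (at_right 0) sequentially"
    using LIMSEQ_Suc[OF lim_1_over_n[where ?'a = real]] by (auto simp: filterlim_at simp del: of_nat_Suc)
qed

text \<open>A primitive of \<open>f\<close> is Lipschitz, so it extends to the real line with a
  Lipschitz trace \<open>gr\<close>; the boundary function is the almost everywhere derivative of
  \<open>gr\<close>. The Poisson formula is taken for difference quotients of the primitive and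
  passed to the limit. The bound is 2 M because the real and imaginary parts are differentiated
  separately, each with bound M.\<close>

lemma bounded_holomorphic_Poisson:
  assumes holf: "f holomorphic_on {w. Im w > 0}"
    and bdd: "\<And>w. Im w > 0 \<Longrightarrow> norm (f w) \<le> M"
  obtains b where "b \<in> borel_measurable borel" "\<And>x. norm (b x) \<le> 2 * M"
    "\<And>x y. y > 0 \<Longrightarrow> f (Complex x y) = (LINT v|cauchy_law. b (x + y * v))"
proof -
  define U where "U = {w. Im w > 0}"
  have openU: "open U" and convU: "convex U"
    unfolding U_def by (auto intro: open_halfspace_Im_gt convex_halfspace_Im_gt)
  have M0: "M \<ge> 0" using order_trans[OF norm_ge_zero bdd[of \<i>]] by simp
  have "\<exists>\<Phi>. \<forall>w\<in>U. (\<Phi> has_field_derivative f w) (at w within U)"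
    by (rule holomorphic_convex_primitive'[OF convU openU holf[folded U_def]]) auto
  then obtain \<Phi> where \<Phi>: "\<forall>w\<in>U. (\<Phi> has_field_derivative f w) (at w within U)" ..
  have \<Phi>at: "(\<Phi> has_field_derivative f w) (at w)" if "w \<in> U" for w
    using bspec[OF \<Phi> that] unfolding at_within_open[OF that openU] .
  have lip: "norm (\<Phi> w - \<Phi> z) \<le> M * norm (w - z)" if "w \<in> U" "z \<in> U" for w z
    by (rule field_differentiable_bound[OF convU]) (use \<Phi> bdd that in \<open>auto simp: U_def\<close>)
  have "M-lipschitz_on U \<Phi>"
    using lip M0 by (auto intro!: lipschitz_onI simp: dist_norm)
  from lipschitz_extend_closure[OF this]
  obtain g where g: "M-lipschitz_on (closure U) g" "\<And>w. w \<in> U \<Longrightarrow> g w = \<Phi> w" by blast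
  have inU: "Complex x y \<in> U" if "y > 0" for x y using that by (simp add: U_def)
  have clos: "Complex x 0 \<in> closure U" for x
    unfolding closure_sequential
  proof (intro exI[of _ "\<lambda>n. Complex x (1 / real (Suc n))"] conjI allI)
    show "(\<lambda>n. Complex x (1 / real (Suc n))) \<longlonglongrightarrow> Complex x 0"
      by (intro tendsto_Complex tendsto_const LIMSEQ_Suc lim_1_over_n)
  qed (auto simp: U_def)
  define gr where "gr = (\<lambda>t. g (Complex t 0))"
  have grlip: "norm (gr s - gr t) \<le> M * \<bar>s - t\<bar>" for s t
    using lipschitz_onD[OF g(1) clos clos, of s t] by (simp add: gr_def dist_norm cmod_def)
  have grlim: "((\<lambda>\<epsilon>. \<Phi> (Complex t \<epsilon>)) \<longlongrightarrow> gr t) (at_right 0)" for t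
  proof (rule LIM_zero_cancel, rule Lim_null_comparison)
    show "\<forall>\<^sub>F \<epsilon> in at_right 0. norm (\<Phi> (Complex t \<epsilon>) - gr t) \<le> M * \<epsilon>"
      using eventually_at_right_less[of 0]
    proof eventually_elim
      case (elim \<epsilon>)
      show ?case
        using lipschitz_onD[OF g(1), of "Complex t \<epsilon>" "Complex t 0"] clos g(2)[OF inU[OF elim]]
          inU[OF elim, of t] closure_subset[of U] elim
        by (auto simp: gr_def dist_norm cmod_def)
    qed
    show "((\<lambda>\<epsilon>. M * \<epsilon>) \<longlongrightarrow> 0) (at_right 0)"
      by (auto intro!: tendsto_eq_intros)
  qed
  obtain b1 where b1: "b1 \<in> borel_measurable borel" "\<And>x. \<bar>b1 x\<bar> \<le> M"
    "AE x in lborel. ((\<lambda>h. (Re (gr (x + h)) - Re (gr x)) / h) \<longlongrightarrow> b1 x) (at_right 0)"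
  proof (rule Lipschitz_AE_right_derivative_real)
    show "\<bar>Re (gr x) - Re (gr y)\<bar> \<le> M * \<bar>x - y\<bar>" for x y
      using order_trans[OF abs_Re_le_cmod grlip[of x y]] by simp
  qed blast
  obtain b2 where b2: "b2 \<in> borel_measurable borel" "\<And>x. \<bar>b2 x\<bar> \<le> M"
    "AE x in lborel. ((\<lambda>h. (Im (gr (x + h)) - Im (gr x)) / h) \<longlongrightarrow> b2 x) (at_right 0)"
  proof (rule Lipschitz_AE_right_derivative_real)
    show "\<bar>Im (gr x) - Im (gr y)\<bar> \<le> M * \<bar>x - y\<bar>" for x y
      using order_trans[OF abs_Im_le_cmod grlip[of x y]] by simp
  qed blast
  define b where "b = (\<lambda>x. Complex (b1 x) (b2 x))"
  note [measurable] = b1(1) b2(1)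
  have bm [measurable]: "b \<in> borel_measurable borel"
    unfolding b_def Complex_eq by measurable
  have "continuous_on UNIV gr"
    by (rule lipschitz_on_continuous_on[where L = M])
       (use grlip M0 in \<open>auto simp: lipschitz_on_def dist_norm\<close>)
  then have [measurable]: "gr \<in> borel_measurable borel" by (rule borel_measurable_continuous_onI)
  have der: "AE x in lborel. ((\<lambda>h. (gr (x + h) - gr x) / of_real h) \<longlongrightarrow> b x) (at_right 0)"
    using b1(3) b2(3)
  proof eventually_elim
    case (elim x)
    have "((\<lambda>h. Complex ((Re (gr (x + h)) - Re (gr x)) / h) ((Im (gr (x + h)) - Im (gr x)) / h)) \<longlongrightarrow> b x) (at_right 0)"
      unfolding b_def by (intro tendsto_Complex elim)
    moreover have "Complex ((Re (gr (x + h)) - Re (gr x)) / h) ((Im (gr (x + h)) - Im (gr x)) / h)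
       = (gr (x + h) - gr x) / of_real h" for h
      by (simp add: complex_eq_iff)
    ultimately show ?case by simp
  qed
  have contPhi: "continuous_on U \<Phi>"
    using \<Phi>at DERIV_continuous continuous_at_imp_continuous_on by blast
  have measPhi: "(\<lambda>v. \<Phi> (Complex (x + y * v) \<epsilon>)) \<in> borel_measurable borel" if "\<epsilon> > 0" for x y \<epsilon>
    by (intro borel_measurable_continuous_onI continuous_on_compose2[OF contPhi] continuous_intros)
       (use inU[OF that] in auto)
  \<comment> \<open>The quotient \<open>q\<close> is holomorphic and bounded by M whatever h is. So
    the Poisson formula holds at every height, and dominated convergence lets the height tend to 0;
    the same bound later serves for h tending to 0.\<close>
  have quot: "(\<Phi> (Complex (x + h) y) - \<Phi> (Complex x y)) / of_real h
      = (LINT v|cauchy_law. (gr (x + y * v + h) - gr (x + y * v)) / of_real h)" if "y > 0" "h > 0" for x y h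
  proof -
    define q where "q = (\<lambda>w. (\<Phi> (w + of_real h) - \<Phi> w) / of_real h)"
    have shift: "w + of_real h \<in> U" if "w \<in> U" for w using that by (simp add: U_def)
    have holPhi: "\<Phi> holomorphic_on U"
      using \<Phi>at by (auto simp: holomorphic_on_def field_differentiable_def intro: has_field_derivative_at_within)
    have "(\<Phi> \<circ> (\<lambda>w. w + of_real h)) holomorphic_on U"
      by (intro holomorphic_on_compose holomorphic_on_subset[OF holPhi] holomorphic_intros) (use shift in auto)
    then have holq: "q holomorphic_on U"
      unfolding q_def o_def using holPhi \<open>h > 0\<close> by (intro holomorphic_intros) auto
    have bq: "norm (q w) \<le> M" if "w \<in> U" for w
      using lip[OF shift[OF that] that] \<open>h > 0\<close> by (simp add: q_def norm_divide field_simps)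
    have Pq: "(LINT v|cauchy_law. q (Complex (x + y * v) \<epsilon>)) = q (Complex x (y + \<epsilon>))" if "\<epsilon> > 0" for \<epsilon>
      by (rule Poisson_formula_shift[where M = M]) (use holq bq that \<open>y > 0\<close> in \<open>auto simp: U_def\<close>)
    have qC: "q (Complex s \<epsilon>) = (\<Phi> (Complex (s + h) \<epsilon>) - \<Phi> (Complex s \<epsilon>)) / of_real h" for s \<epsilon>
    proof -
      have "Complex s \<epsilon> + of_real h = Complex (s + h) \<epsilon>" by (simp add: complex_eq_iff)
      then show ?thesis by (simp add: q_def)
    qed
    let ?e = "\<lambda>n. 1 / real (Suc n)"
    have "(\<lambda>n. LINT v|cauchy_law. q (Complex (x + y * v) (?e n)))
        \<longlonglongrightarrow> (LINT v|cauchy_law. (gr (x + y * v + h) - gr (x + y * v)) / of_real h)"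
    proof (rule integral_dominated_convergence[where w = "\<lambda>_. M"])
      show "AE v in cauchy_law. (\<lambda>n. q (Complex (x + y * v) (?e n))) \<longlonglongrightarrow> (gr (x + y * v + h) - gr (x + y * v)) / of_real h"
        unfolding qC using tendsto_at_right_seq[OF grlim] \<open>h > 0\<close>
        by (intro AE_I2 tendsto_intros) auto
      show "AE v in cauchy_law. norm (q (Complex (x + y * v) (?e n))) \<le> M" for n
        by (intro AE_I2 bq inU) simp
      show "(\<lambda>v. q (Complex (x + y * v) (?e n))) \<in> borel_measurable cauchy_law" for n
        using measPhi[of "?e n" "x + h" y] measPhi[of "?e n" x y]
        unfolding qC by (simp add: ac_simps)
    qed auto
    moreover have "(\<lambda>n. q (Complex x (y + ?e n))) \<longlonglongrightarrow> q (Complex x y)"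
    proof (rule isCont_tendsto_compose[where g = q])
      show "isCont q (Complex x y)"
        using holomorphic_on_imp_continuous_on[OF holq] openU inU[OF \<open>y > 0\<close>] by (simp add: continuous_on_eq_continuous_at)
      have "(\<lambda>n. y + ?e n) \<longlonglongrightarrow> y + 0"
        by (intro tendsto_intros LIMSEQ_Suc lim_1_over_n)
      then show "(\<lambda>n. Complex x (y + ?e n)) \<longlonglongrightarrow> Complex x y"
        by (intro tendsto_Complex) auto
    qed
    ultimately have "q (Complex x y) = (LINT v|cauchy_law. (gr (x + y * v + h) - gr (x + y * v)) / of_real h)"
      using Pq[of "?e _"] by (intro LIMSEQ_unique[of "\<lambda>n. q (Complex x (y + ?e n))"]) simp_all
    then show ?thesis by (simp add: qC)
  qed
  have rep: "f (Complex x y) = (LINT v|cauchy_law. b (x + y * v))" if "y > 0" for x y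
  proof -
    let ?h = "\<lambda>n. 1 / real (Suc n)"
    have lim1: "(\<lambda>n. LINT v|cauchy_law. (gr (x + y * v + ?h n) - gr (x + y * v)) / of_real (?h n))
        \<longlonglongrightarrow> (LINT v|cauchy_law. b (x + y * v))"
    proof (rule integral_dominated_convergence[where w = "\<lambda>_. M"])
      have "AE v in lborel. ((\<lambda>h. (gr (x + y * v + h) - gr (x + y * v)) / of_real h) \<longlongrightarrow> b (x + y * v)) (at_right 0)"
        using AE_lborel_affine[OF der, of y x] that by simp
      then show "AE v in cauchy_law. (\<lambda>n. (gr (x + y * v + ?h n) - gr (x + y * v)) / of_real (?h n)) \<longlonglongrightarrow> b (x + y * v)"
        unfolding AE_cauchy_law_iff by eventually_elim (rule tendsto_at_right_seq)
      show "AE v in cauchy_law. norm ((gr (x + y * v + ?h n) - gr (x + y * v)) / of_real (?h n)) \<le> M" for n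
      proof (rule AE_I2)
        fix v
        show "norm ((gr (x + y * v + ?h n) - gr (x + y * v)) / of_real (?h n)) \<le> M"
          using grlip[of "x + y * v + ?h n" "x + y * v"] unfolding norm_divide norm_of_real
          by (simp add: field_simps)
      qed
    qed auto
    have lim2: "(\<lambda>n. (\<Phi> (Complex (x + ?h n) y) - \<Phi> (Complex x y)) / of_real (?h n)) \<longlonglongrightarrow> f (Complex x y)"
    proof -
      have "((\<lambda>h. (\<Phi> (Complex x y + h) - \<Phi> (Complex x y)) / h) \<longlongrightarrow> f (Complex x y)) (at 0)"
        using \<Phi>at[OF inU[OF that]] by (simp add: DERIV_def)
      moreover have "filterlim (\<lambda>n. complex_of_real (?h n)) (at 0) sequentially"
        using LIMSEQ_Suc[OF lim_1_over_n[where ?'a = complex]]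
        by (auto simp: filterlim_at simp del: of_nat_Suc)
      ultimately have "(\<lambda>n. (\<Phi> (Complex x y + of_real (?h n)) - \<Phi> (Complex x y)) / of_real (?h n)) \<longlonglongrightarrow> f (Complex x y)"
        by (rule filterlim_compose)
      moreover have "Complex x y + of_real h = Complex (x + h) y" for h by (simp add: complex_eq_iff)
      ultimately show ?thesis by (simp only:)
    qed
    have eq: "(LINT v|cauchy_law. (gr (x + y * v + ?h n) - gr (x + y * v)) / of_real (?h n))
        = (\<Phi> (Complex (x + ?h n) y) - \<Phi> (Complex x y)) / of_real (?h n)" for n
      by (rule quot[OF that, symmetric]) simp
    show ?thesis by (rule LIMSEQ_unique[OF lim2 lim1[unfolded eq]])
  qed
  show thesis
  proof (rule that[OF bm _ rep])
    show "norm (b x) \<le> 2 * M" for x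
      using cmod_le[of "b x"] b1(2)[of x] b2(2)[of x] by (simp add: b_def)
  qed
qed

text \<open>Fatou's theorem: the density in the Poisson representation is also the almost everywhere
  vertical limit, since Poisson integrals converge at Lebesgue points.\<close>

lemma bounded_holomorphic_boundary_function:
  assumes "f holomorphic_on {w. Im w > 0}" "\<And>w. Im w > 0 \<Longrightarrow> norm (f w) \<le> M"
  obtains b where "b \<in> borel_measurable borel" "\<And>x. norm (b x) \<le> 2 * M"
    "\<And>x y. y > 0 \<Longrightarrow> f (Complex x y) = (LINT v|cauchy_law. b (x + y * v))"
    "AE x in lborel. ((\<lambda>y. f (Complex x y)) \<longlongrightarrow> b x) (at_right 0)"
proof -
  obtain b where b: "b \<in> borel_measurable borel" "\<And>x. norm (b x) \<le> 2 * M"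
    "\<And>x y. y > 0 \<Longrightarrow> f (Complex x y) = (LINT v|cauchy_law. b (x + y * v))"
    using bounded_holomorphic_Poisson[OF assms] by blast
  have "AE x in lborel. ((\<lambda>y. f (Complex x y)) \<longlongrightarrow> b x) (at_right 0)"
    using AE_Poisson_integral_tendsto[OF b(1,2)]
  proof eventually_elim
    case (elim x)
    show ?case
      by (rule Lim_transform_eventually[OF elim eventually_mono[OF eventually_at_right_less[of 0]]])
         (simp add: b(3))
  qed
  with b show thesis by (rule that)
qed

text \<open>On the set where \<open>D\<close> tends to \<open>0\<close> the functions \<open>1 / (1 + k D)\<close> have boundary value \<open>1\<close>,
  while their values at \<open>\<i>\<close> tend to \<open>0\<close> as \<open>k\<close> grows.\<close>

lemma AE_not_tendsto_zero:
  assumes hol: "D holomorphic_on {w. Im w > 0}" and pos: "\<And>w. Im w > 0 \<Longrightarrow> Re (D w) > 0"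
  shows "AE x in lborel. \<not> ((\<lambda>y. D (Complex x y)) \<longlongrightarrow> 0) (at_right 0)"
proof -
  define R where "R = (\<lambda>k w. 1 / (1 + of_nat k * D w))"
  have Re1: "Re (1 + of_nat k * D w) \<ge> 1" if "Im w > 0" for k w
    using pos[OF that] by simp
  have nz: "1 + of_nat k * D w \<noteq> 0" if "Im w > 0" for k w
    using Re1[OF that, of k] by (metis zero_complex.sel(1) not_one_le_zero)
  have holR: "R k holomorphic_on {w. Im w > 0}" for k
    unfolding R_def using nz by (intro holomorphic_intros hol) auto
  have bdd: "norm (R k w) \<le> 1" if "Im w > 0" for k w
  proof -
    have "1 \<le> norm (1 + of_nat k * D w)"
      using Re1[OF that, of k] complex_Re_le_cmod order_trans by blast
    then show ?thesis unfolding R_def norm_divide by (simp add: divide_le_eq_1)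
  qed
  have ReR: "Re (R k w) \<ge> 0" if "Im w > 0" for k w
    using Re1[OF that, of k] unfolding R_def by (simp add: Re_divide)
  define P where "P = (\<lambda>(k::nat) b. b \<in> borel_measurable borel \<and> (\<forall>x. norm (b x) \<le> 2 * 1) \<and>
    (\<forall>x y. y > 0 \<longrightarrow> R k (Complex x y) = (LINT v|cauchy_law. b (x + y * v))) \<and>
    (AE x in lborel. ((\<lambda>y. R k (Complex x y)) \<longlongrightarrow> b x) (at_right 0)))"
  have "\<forall>k. \<exists>b. P k b"
  proof
    fix k
    show "\<exists>b. P k b"
      by (rule bounded_holomorphic_boundary_function[OF holR[of k] bdd[of _ k]])
         (unfold P_def, blast+)
  qed
  from choice[OF this] obtain b where Pb: "\<forall>k. P k (b k)" ..
  then have b [measurable]: "b k \<in> borel_measurable borel"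
    and bb: "norm (b k x) \<le> 2"
    and rep: "y > 0 \<Longrightarrow> R k (Complex x y) = (LINT v|cauchy_law. b k (x + y * v))"
    and lim: "AE x in lborel. ((\<lambda>y. R k (Complex x y)) \<longlongrightarrow> b k x) (at_right 0)" for k x y
    by (simp_all add: P_def)
  have bpos: "AE x in cauchy_law. Re (b k x) \<ge> 0" for k
    unfolding AE_cauchy_law_iff using lim[of k]
  proof eventually_elim
    case (elim x)
    have "\<forall>\<^sub>F y in at_right 0. Re (R k (Complex x y)) \<ge> 0"
      by (intro eventually_mono[OF eventually_at_right_less[of 0]] ReR) simp
    then show ?case by (rule tendsto_lowerbound[OF tendsto_Re[OF elim]]) simp
  qed
  \<comment> \<open>Outside a null set every x at which D tends to 0 lies in \<open>B\<close>. As Re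
    (b k) is nonnegative and equals 1 on \<open>B\<close>, the Cauchy mass of \<open>B\<close> is at
    most the mean Re (R k i), for every k.\<close>
  define B where "B = {x. \<forall>k. b k x = 1}"
  have [measurable]: "B \<in> sets borel" unfolding B_def by measurable
  have mB: "measure cauchy_law B \<le> Re (R k \<i>)" for k
  proof -
    have intb: "integrable cauchy_law (b k)"
      using bb by (intro cauchy.integrable_const_bound[where B = 2]) auto
    have "measure cauchy_law B = (LINT v|cauchy_law. indicator B v)" by simp
    also have "\<dots> \<le> (LINT v|cauchy_law. Re (b k v))"
    proof (rule integral_mono_AE)
      show "AE v in cauchy_law. indicator B v \<le> Re (b k v)"
        using bpos[of k] by eventually_elim (auto simp: indicator_def B_def)
    qed (use intb in \<open>auto intro!: cauchy.integrable_const_bound[where B = 1]\<close>)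
    also have "\<dots> = Re (LINT v|cauchy_law. b k v)" using intb by simp
    also have "\<dots> = Re (R k \<i>)"
      using rep[of 1 k 0] by (simp add: imaginary_unit.code)
    finally show ?thesis .
  qed
  have "(\<lambda>k. R k \<i>) \<longlonglongrightarrow> 0"
  proof -
    have "Re (D \<i>) > 0" using pos[of \<i>] by simp
    then have "(\<lambda>k. 1 / (1 + real k * Re (D \<i>))) \<longlonglongrightarrow> 0" by real_asymp
    moreover have "norm (R k \<i>) \<le> 1 / (1 + real k * Re (D \<i>))" for k
    proof -
      have "1 + real k * Re (D \<i>) \<le> norm (1 + of_nat k * D \<i>)"
        using complex_Re_le_cmod[of "1 + of_nat k * D \<i>"] by simp
      moreover have "1 + real k * Re (D \<i>) > 0" using \<open>Re (D \<i>) > 0\<close> by (simp add: add_pos_nonneg)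
      ultimately show ?thesis unfolding R_def norm_divide by (simp add: frac_le)
    qed
    ultimately show ?thesis by (intro Lim_null_comparison[of "\<lambda>k. R k \<i>"] always_eventually) auto
  qed
  from tendsto_Re[OF this] have "(\<lambda>k. Re (R k \<i>)) \<longlonglongrightarrow> 0" by simp
  then have "measure cauchy_law B \<le> 0"
    by (rule LIMSEQ_le_const) (use mB in auto)
  then have "emeasure cauchy_law B = 0"
    by (simp add: cauchy.emeasure_eq_measure measure_le_0_iff)
  then have "AE x in cauchy_law. x \<notin> B" by (intro AE_not_in null_setsI) auto
  moreover have "AE x in cauchy_law. \<forall>k. ((\<lambda>y. R k (Complex x y)) \<longlongrightarrow> b k x) (at_right 0)"
    unfolding AE_all_countable using lim by (simp add: AE_cauchy_law_iff)
  ultimately have "AE x in cauchy_law. \<not> ((\<lambda>y. D (Complex x y)) \<longlongrightarrow> 0) (at_right 0)"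
  proof eventually_elim
    case (elim x)
    show ?case
    proof
      assume "((\<lambda>y. D (Complex x y)) \<longlongrightarrow> 0) (at_right 0)"
      then have "((\<lambda>y. R k (Complex x y)) \<longlongrightarrow> 1 / (1 + of_nat k * 0)) (at_right 0)" for k
        unfolding R_def by (intro tendsto_intros) auto
      then have "((\<lambda>y. R k (Complex x y)) \<longlongrightarrow> 1) (at_right 0)" for k by simp
      then have "b k x = 1" for k
        by (rule tendsto_unique[OF trivial_limit_at_right_real spec[OF elim(2)]])
      then show False using elim(1) by (simp add: B_def)
    qed
  qed
  then show ?thesis by (simp add: AE_cauchy_law_iff)
qed

section \<open>Limits of reflectionless Herglotz functions\<close>

lemma herglotz_altdef:
  "herglotz F \<longleftrightarrow> F holomorphic_on {w. Im w > 0} \<and> (\<forall>w. Im w > 0 \<longrightarrow> Im (F w) > 0)"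
  by (auto simp: herglotz_def upper_half_plane_def)

text \<open>Makes Herglotz functions bounded, so that Fatou's theorem applies, and sends the
  imaginary axis into the real line: the condition Re F = 0 becomes the vanishing of an imaginary
  part, which is linear in the boundary function.\<close>

definition cayley :: "complex \<Rightarrow> complex" where
  "cayley w = (w - \<i>) / (w + \<i>)"

lemma norm_cayley_less:
  assumes "Im w > 0"
  shows "norm (cayley w) < 1"
proof -
  have "(norm (w - \<i>))\<^sup>2 < (norm (w + \<i>))\<^sup>2"
    unfolding cmod_power2 using assms by (simp add: power2_eq_square algebra_simps)
  then have "norm (w - \<i>) < norm (w + \<i>)" by (rule power_less_imp_less_base) simp
  moreover from this have "norm (w + \<i>) > 0" by (rule le_less_trans[OF norm_ge_zero])
  ultimately show ?thesis by (simp add: cayley_def norm_divide divide_less_eq_1)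
qed

lemma cayley_herglotz:
  assumes "herglotz F"
  shows "(\<lambda>w. cayley (F w)) holomorphic_on {w. Im w > 0}"
    "\<And>w. Im w > 0 \<Longrightarrow> norm (cayley (F w)) \<le> 1"
proof -
  have "F w + \<i> \<noteq> 0" if "Im w > 0" for w
  proof -
    have "Im (F w + \<i>) > 0" using assms that by (simp add: herglotz_altdef add_pos_pos)
    then show ?thesis by (metis less_irrefl zero_complex.sel(2))
  qed
  then show "(\<lambda>w. cayley (F w)) holomorphic_on {w. Im w > 0}"
    using assms unfolding cayley_def by (intro holomorphic_intros) (auto simp: herglotz_altdef)
  show "norm (cayley (F w)) \<le> 1" if "Im w > 0" for w
    using norm_cayley_less[of "F w"] assms that by (simp add: herglotz_altdef)
qed

text \<open>The boundary function of \<open>cayley (F w)\<close> is real on E and of modulus at most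
  1 elsewhere; averaging it by the Poisson formula gives the harmonic measure of the complement of E
  as a bound. The result concerns interior points only, so it survives pointwise limits.\<close>

lemma Im_cayley_le:
  assumes F: "F \<in> \<N> E" and E: "closed E" and "y > 0"
  shows "\<bar>Im (cayley (F (Complex x y)))\<bar> \<le> (LINT v|cauchy_law. indicator (- E) (x + y * v))"
proof -
  have h: "herglotz F" and r: "reflectionless_on F E"
    using F by (auto simp: herglotz_reflectionless_def)
  obtain b where b [measurable]: "b \<in> borel_measurable borel" and bb: "\<And>x. norm (b x) \<le> 2 * 1"
    and rep: "\<And>x y. y > 0 \<Longrightarrow> cayley (F (Complex x y)) = (LINT v|cauchy_law. b (x + y * v))"
    and lim: "AE x in lborel. ((\<lambda>y. cayley (F (Complex x y))) \<longlongrightarrow> b x) (at_right 0)"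
    using bounded_holomorphic_boundary_function[OF cayley_herglotz[OF h]] by blast
  have [measurable]: "E \<in> sets borel" using E by auto
  have "AE t in lborel. \<bar>Im (b t)\<bar> \<le> indicator (- E) t"
    using lim r[unfolded reflectionless_on_def]
  proof eventually_elim
    case (elim t)
    show ?case
    proof (cases "t \<in> E")
      case False
      \<comment> \<open>Boundary limits give the sharp constant; the representation itself provides
        only the bound 2.\<close>
      have "norm (b t) \<le> 1"
      proof (rule tendsto_upperbound[OF tendsto_norm[OF elim(1)]])
        show "\<forall>\<^sub>F y in at_right 0. norm (cayley (F (Complex t y))) \<le> 1"
          by (intro eventually_mono[OF eventually_at_right_less[of 0]] cayley_herglotz[OF h]) simp
      qed simp
      then show ?thesis using False abs_Im_le_cmod[of "b t"] by simp
    next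
      case True
      then obtain l where l: "((\<lambda>y. F (Complex t y)) \<longlongrightarrow> l) (at_right 0)" "Re l = 0"
        using elim(2) by blast
      have "Im l \<ge> 0"
      proof (rule tendsto_lowerbound[OF tendsto_Im[OF l(1)]])
        show "\<forall>\<^sub>F y in at_right 0. Im (F (Complex t y)) \<ge> 0"
          using h by (intro eventually_mono[OF eventually_at_right_less[of 0]]) (auto simp: herglotz_altdef less_imp_le)
      qed simp
      then have "Im (l + \<i>) > 0" by simp
      then have nz: "l + \<i> \<noteq> 0" by (metis less_irrefl zero_complex.sel(2))
      have "((\<lambda>y. cayley (F (Complex t y))) \<longlongrightarrow> cayley l) (at_right 0)"
        unfolding cayley_def using nz by (intro tendsto_intros l)
      then have "b t = cayley l" by (rule tendsto_unique[OF trivial_limit_at_right_real elim(1)])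
      then show ?thesis using True l(2) by (simp add: cayley_def Im_divide)
    qed
  qed
  from AE_lborel_affine[OF this, of y x]
  have AE: "AE v in cauchy_law. \<bar>Im (b (x + y * v))\<bar> \<le> indicator (- E) (x + y * v)"
    using \<open>y > 0\<close> by (simp add: AE_cauchy_law_iff)
  have intb: "integrable cauchy_law (\<lambda>v. b (x + y * v))"
    using bb by (intro cauchy.integrable_const_bound[where B = 2]) auto
  have "\<bar>Im (cayley (F (Complex x y)))\<bar> = \<bar>LINT v|cauchy_law. Im (b (x + y * v))\<bar>"
    using intb \<open>y > 0\<close> by (simp add: rep)
  also have "\<dots> \<le> (LINT v|cauchy_law. \<bar>Im (b (x + y * v))\<bar>)"
    using integral_norm_bound[of cauchy_law "\<lambda>v. Im (b (x + y * v))"] by simp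
  also have "\<dots> \<le> (LINT v|cauchy_law. indicator (- E) (x + y * v))"
  proof (rule integral_mono_AE[OF _ _ AE])
    show "integrable cauchy_law (\<lambda>v. \<bar>Im (b (x + y * v))\<bar>)" using intb by simp
    show "integrable cauchy_law (\<lambda>v. indicat_real (- E) (x + y * v))"
      by (rule cauchy.integrable_const_bound[where B = 1]) auto
  qed
  finally show ?thesis .
qed

text \<open>The interior inequality passes from \<open>F n\<close> to \<open>G\<close>. Its right
  side tends to 0 at almost every point of E, so the boundary value of \<open>cayley (G w)\<close>
  is real there; where it differs from 1, inverting the Cayley transform gives an imaginary boundary
  value of \<open>G\<close>.\<close>

theorem reflectionless_limit:
  assumes E: "closed E" and F: "\<And>n. F n \<in> \<N> E" and G: "herglotz G"
    and lim: "\<And>w. Im w > 0 \<Longrightarrow> (\<lambda>n. F n w) \<longlonglongrightarrow> G w"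
  shows "G \<in> \<N> E"
proof -
  have [measurable]: "E \<in> sets borel" using E by auto
  let ?U = "\<lambda>x y. LINT v|cauchy_law. indicat_real (- E) (x + y * v)"
  have nz: "w + \<i> \<noteq> 0" if "Im w > 0" for w
  proof -
    have "Im (w + \<i>) > 0" using that by simp
    then show ?thesis by (metis less_irrefl zero_complex.sel(2))
  qed
  have Gp: "Im (G w) > 0" if "Im w > 0" for w using G that by (simp add: herglotz_altdef)
  have le: "\<bar>Im (cayley (G (Complex x y)))\<bar> \<le> ?U x y" if "y > 0" for x y
  proof (rule LIMSEQ_le_const2)
    show "(\<lambda>n. \<bar>Im (cayley (F n (Complex x y)))\<bar>) \<longlonglongrightarrow> \<bar>Im (cayley (G (Complex x y)))\<bar>"
      unfolding cayley_def using nz[OF Gp] that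
      by (intro tendsto_rabs tendsto_Im tendsto_divide tendsto_diff tendsto_add tendsto_const lim) auto
    show "\<exists>N. \<forall>n\<ge>N. \<bar>Im (cayley (F n (Complex x y)))\<bar> \<le> ?U x y"
      using Im_cayley_le[OF F E that] by simp
  qed
  obtain b where b [measurable]: "b \<in> borel_measurable borel" and bb: "\<And>x. norm (b x) \<le> 2 * 1"
    and "\<And>x y. y > 0 \<Longrightarrow> cayley (G (Complex x y)) = (LINT v|cauchy_law. b (x + y * v))"
    and blim: "AE x in lborel. ((\<lambda>y. cayley (G (Complex x y))) \<longlongrightarrow> b x) (at_right 0)"
    using bounded_holomorphic_boundary_function[OF cayley_herglotz[OF G]] by blast
  have Ulim: "AE x in lborel. ((\<lambda>y. LINT v|cauchy_law. complex_of_real (indicator (- E) (x + y * v))) \<longlongrightarrow> of_real (indicator (- E) x)) (at_right 0)"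
    by (rule AE_Poisson_integral_tendsto[where M = 1]) (auto simp: indicator_def)
  \<comment> \<open>The value 1 of the Cayley transform corresponds to infinite boundary values of
    \<open>G\<close>; these occur on a null set only.\<close>
  have "AE x in lborel. \<not> ((\<lambda>y. 1 - cayley (G (Complex x y))) \<longlongrightarrow> 0) (at_right 0)"
  proof (rule AE_not_tendsto_zero)
    show "(\<lambda>w. 1 - cayley (G w)) holomorphic_on {w. Im w > 0}"
      using cayley_herglotz(1)[OF G] by (rule holomorphic_on_diff[OF holomorphic_on_const])
    show "Re (1 - cayley (G w)) > 0" if "Im w > 0" for w
      using norm_cayley_less[OF Gp[OF that]] complex_Re_le_cmod[of "cayley (G w)"] by simp
  qed
  with blim Ulim have "AE t in lborel. t \<in> E \<longrightarrow> (\<exists>l. ((\<lambda>y. G (Complex t y)) \<longlongrightarrow> l) (at_right 0) \<and> Re l = 0)"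
  proof eventually_elim
    case (elim t)
    show ?case
    proof
      assume "t \<in> E"
      have "((\<lambda>y. ?U t y) \<longlongrightarrow> 0) (at_right 0)"
        using tendsto_Re[OF elim(2)] \<open>t \<in> E\<close> by simp
      then have "((\<lambda>y. \<bar>Im (cayley (G (Complex t y)))\<bar>) \<longlongrightarrow> 0) (at_right 0)"
        by (rule Lim_null_comparison[rotated])
           (auto intro!: eventually_mono[OF eventually_at_right_less[of 0]] le)
      then have "\<bar>Im (b t)\<bar> = 0"
        by (rule tendsto_unique[OF trivial_limit_at_right_real tendsto_rabs[OF tendsto_Im[OF elim(1)]]])
      then have Imb: "Im (b t) = 0" by simp
      have "b t \<noteq> 1"
      proof
        assume "b t = 1"
        then have "((\<lambda>y. 1 - cayley (G (Complex t y))) \<longlongrightarrow> 1 - 1) (at_right 0)"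
          using elim(1) by (intro tendsto_intros) simp
        then show False using elim(3) by simp
      qed
      then have "((\<lambda>y. \<i> * (1 + cayley (G (Complex t y))) / (1 - cayley (G (Complex t y)))) \<longlongrightarrow> \<i> * (1 + b t) / (1 - b t)) (at_right 0)"
        by (intro tendsto_intros elim) auto
      moreover have "\<i> * (1 + cayley w) / (1 - cayley w) = w" if "Im w > 0" for w
      proof -
        have "1 + cayley w = 2 * w / (w + \<i>)" "1 - cayley w = 2 * \<i> / (w + \<i>)"
          using nz[OF that] by (simp_all add: cayley_def diff_divide_eq_iff add_divide_eq_iff)
        then show ?thesis using nz[OF that] by simp
      qed
      then have "\<forall>\<^sub>F y in at_right 0. \<i> * (1 + cayley (G (Complex t y))) / (1 - cayley (G (Complex t y))) = G (Complex t y)"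
        by (intro eventually_mono[OF eventually_at_right_less[of 0]]) (simp add: Gp)
      ultimately have "((\<lambda>y. G (Complex t y)) \<longlongrightarrow> \<i> * (1 + b t) / (1 - b t)) (at_right 0)"
        by (rule Lim_transform_eventually)
      moreover have "Re (\<i> * (1 + b t) / (1 - b t)) = 0"
        using Imb by (simp add: Re_divide)
      ultimately show "\<exists>l. ((\<lambda>y. G (Complex t y)) \<longlongrightarrow> l) (at_right 0) \<and> Re l = 0" by blast
    qed
  qed
  then show ?thesis using G by (simp add: herglotz_reflectionless_def reflectionless_on_def)
qed


section \<open>Herglotz functions of laws on the extended line\<close>

text \<open>With \<open>t = tan \<theta>\<close> the function \<open>angular_kernel \<theta>\<close> is \<open>z \<mapsto> (1 + t z) / (t - z)\<close>; the points
  \<open>\<theta> = \<plusminus> \<pi> / 2\<close> correspond to \<open>t = \<infinity>\<close> and give \<open>z \<mapsto> z\<close>.\<close>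

definition angular_kernel :: "real \<Rightarrow> complex \<Rightarrow> complex" where
  "angular_kernel \<theta> z = (of_real (cos \<theta>) + z * of_real (sin \<theta>)) / (of_real (sin \<theta>) - z * of_real (cos \<theta>))"

definition angular_fun :: "real \<Rightarrow> real \<Rightarrow> real \<Rightarrow> real measure \<Rightarrow> complex \<Rightarrow> complex" where
  "angular_fun a b B P z = of_real a + of_real b * z + of_real B * (LINT \<theta>|P. angular_kernel \<theta> z)"

text \<open>Laws are Borel measures on the whole line with a support condition, so that weak
  convergence of real distributions applies to them directly; the common compact support makes every
  family of them tight.\<close>

definition angular_law :: "real measure \<Rightarrow> bool" where
  "angular_law P \<longleftrightarrow> prob_space P \<and> sets P = sets borel \<and> emeasure P {-(pi/2)..pi/2} = 1"

text \<open>The denominator controls cos through its imaginary part, then sin through its real part,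
  and |sin| + |cos| is at least 1. The bound is uniform in the angle, the point at infinity
  included.\<close>

lemma angular_denom_bound:
  assumes "Im z > 0"
  shows "1 \<le> norm (of_real (sin \<theta>) - z * of_real (cos \<theta>)) * (1 + (1 + \<bar>Re z\<bar>) / Im z)"
proof -
  define s where "s = of_real (sin \<theta>) - z * of_real (cos \<theta>)"
  have re: "Re s = sin \<theta> - Re z * cos \<theta>" and im: "Im s = - Im z * cos \<theta>" by (auto simp: s_def)
  have c: "\<bar>cos \<theta>\<bar> \<le> norm s / Im z"
    using abs_Im_le_cmod[of s] assms by (simp add: im abs_mult field_simps)
  have "\<bar>sin \<theta>\<bar> \<le> \<bar>Re s\<bar> + \<bar>Re z\<bar> * \<bar>cos \<theta>\<bar>"
    using abs_triangle_ineq[of "Re s" "Re z * cos \<theta>"] by (simp add: re abs_mult)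
  also have "\<dots> \<le> norm s + \<bar>Re z\<bar> * (norm s / Im z)"
    using c by (intro add_mono abs_Re_le_cmod mult_left_mono) auto
  finally have sn: "\<bar>sin \<theta>\<bar> \<le> norm s + \<bar>Re z\<bar> * (norm s / Im z)" .
  have "1 = \<bar>sin \<theta>\<bar> * \<bar>sin \<theta>\<bar> + \<bar>cos \<theta>\<bar> * \<bar>cos \<theta>\<bar>"
    using sin_cos_squared_add[of \<theta>] by (simp add: power2_eq_square)
  also have "\<dots> \<le> \<bar>sin \<theta>\<bar> * 1 + \<bar>cos \<theta>\<bar> * 1"
    by (intro add_mono mult_left_mono) auto
  also have "\<dots> \<le> norm s + \<bar>Re z\<bar> * (norm s / Im z) + norm s / Im z" using c sn by simp
  also have "\<dots> = norm s * (1 + (1 + \<bar>Re z\<bar>) / Im z)" using assms by (simp add: field_simps)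
  finally show ?thesis by (simp add: s_def)
qed

lemma angular_denom_nonzero:
  assumes "Im z > 0"
  shows "of_real (sin \<theta>) - z * of_real (cos \<theta>) \<noteq> 0"
  using angular_denom_bound[OF assms, of \<theta>] by auto

lemma inverse_angular_denom_bound:
  assumes "Im z > 0"
  shows "norm (1 / (of_real (sin \<theta>) - z * of_real (cos \<theta>))) \<le> 1 + (1 + \<bar>Re z\<bar>) / Im z"
  using angular_denom_bound[OF assms, of \<theta>] angular_denom_nonzero[OF assms, of \<theta>]
  by (simp add: norm_divide divide_le_eq mult.commute)

lemma continuous_angular_kernel:
  assumes "Im z > 0"
  shows "continuous_on UNIV (\<lambda>\<theta>. angular_kernel \<theta> z)"
  unfolding angular_kernel_def
  using angular_denom_nonzero[OF assms] by (intro continuous_intros) auto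

lemma angular_kernel_measurable [measurable]: "(\<lambda>\<theta>. angular_kernel \<theta> z) \<in> borel_measurable borel"
  unfolding angular_kernel_def by measurable

lemma norm_angular_kernel_le:
  assumes "Im z > 0"
  shows "norm (angular_kernel \<theta> z) \<le> (1 + norm z) * (1 + (1 + \<bar>Re z\<bar>) / Im z)"
proof -
  have "norm (of_real (cos \<theta>) + z * of_real (sin \<theta>)) \<le> norm (complex_of_real (cos \<theta>)) + norm (z * of_real (sin \<theta>))"
    by (rule norm_triangle_ineq)
  also have "\<dots> \<le> 1 + norm z * 1" unfolding norm_mult norm_of_real by (intro add_mono mult_left_mono) auto
  finally have "norm (of_real (cos \<theta>) + z * of_real (sin \<theta>)) \<le> 1 + norm z" by simp
  then have "norm ((of_real (cos \<theta>) + z * of_real (sin \<theta>)) * (1 / (of_real (sin \<theta>) - z * of_real (cos \<theta>))))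
      \<le> (1 + norm z) * (1 + (1 + \<bar>Re z\<bar>) / Im z)"
    unfolding norm_mult[of "_ + _"] by (intro mult_mono inverse_angular_denom_bound assms) auto
  then show ?thesis by (simp add: angular_kernel_def)
qed

text \<open>The imaginary part equals Im z over the squared modulus of the denominator. A lower
  bound independent of the angle keeps the integral against any law strictly positive.\<close>

lemma Im_angular_kernel_ge:
  assumes "Im z > 0"
  shows "Im (angular_kernel \<theta> z) \<ge> Im z / (1 + norm z)\<^sup>2"
proof -
  define s where "s = of_real (sin \<theta>) - z * of_real (cos \<theta>)"
  define c where "c = of_real (cos \<theta>) + z * of_real (sin \<theta>)"
  have "norm s \<le> norm (complex_of_real (sin \<theta>)) + norm (z * of_real (cos \<theta>))"
    unfolding s_def by (rule norm_triangle_ineq4)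
  also have "\<dots> \<le> 1 + norm z * 1" unfolding norm_mult norm_of_real by (intro add_mono mult_left_mono) auto
  finally have n: "(norm s)\<^sup>2 \<le> (1 + norm z)\<^sup>2" by (intro power_mono) auto
  have s0: "norm s > 0" using angular_denom_nonzero[OF assms] by (simp add: s_def)
  have "Im (c * cnj s) = Im z * (sin \<theta> * sin \<theta>) + Im z * (cos \<theta> * cos \<theta>)"
    by (simp add: c_def s_def algebra_simps)
  also have "\<dots> = Im z * (sin \<theta> * sin \<theta> + cos \<theta> * cos \<theta>)"
    by (simp only: distrib_left)
  also have "sin \<theta> * sin \<theta> + cos \<theta> * cos \<theta> = 1"
    using sin_cos_squared_add[of \<theta>] by (simp only: power2_eq_square)
  finally have "Im (c * cnj s) = Im z * 1" .
  then have "Im (c * cnj s) = Im z" by simp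
  then have "Im (c / s) = Im z / (norm s)\<^sup>2"
    by (subst complex_div_cnj) (simp add: Im_divide_of_real flip: of_real_power)
  moreover have "Im z / (1 + norm z)\<^sup>2 \<le> Im z / (norm s)\<^sup>2"
    using n s0 assms by (intro divide_left_mono mult_pos_pos) (auto intro: add_pos_nonneg)
  ultimately show ?thesis by (simp add: angular_kernel_def c_def s_def)
qed

lemma angular_law_integrable:
  assumes "angular_law P" "Im z > 0"
  shows "integrable P (\<lambda>\<theta>. angular_kernel \<theta> z)"
proof -
  interpret prob_space P using assms(1) by (simp add: angular_law_def)
  have [measurable_cong]: "sets P = sets borel" using assms(1) by (simp add: angular_law_def)
  show ?thesis
    by (rule integrable_const_bound[OF AE_I2[OF norm_angular_kernel_le[OF assms(2)]]]) measurable
qed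

lemma angular_kernel_diff:
  assumes "Im z > 0" "Im w > 0"
  shows "angular_kernel \<theta> w - angular_kernel \<theta> z =
    (w - z) * (1 / (of_real (sin \<theta>) - z * of_real (cos \<theta>)) * (1 / (of_real (sin \<theta>) - w * of_real (cos \<theta>))))"
proof -
  define S where "S = complex_of_real (sin \<theta>)"
  define C where "C = complex_of_real (cos \<theta>)"
  have "S * S + C * C = of_real ((sin \<theta>)\<^sup>2 + (cos \<theta>)\<^sup>2)"
    by (simp add: S_def C_def power2_eq_square)
  then have SC: "S * S + C * C = 1" by simp
  have nz: "S - z * C \<noteq> 0" "S - w * C \<noteq> 0"
    using angular_denom_nonzero assms by (auto simp: S_def C_def)
  have "(C + w * S) * (S - z * C) - (C + z * S) * (S - w * C) = (w - z) * (S * S + C * C)"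
    by (simp add: algebra_simps)
  then have "(C + w * S) * (S - z * C) - (C + z * S) * (S - w * C) = w - z" by (simp add: SC)
  then have "(C + w * S) / (S - w * C) - (C + z * S) / (S - z * C) = (w - z) / ((S - w * C) * (S - z * C))"
    using nz by (simp add: diff_frac_eq)
  then show ?thesis unfolding angular_kernel_def S_def[symmetric] C_def[symmetric] by (simp add: mult.commute)
qed

lemma herglotz_angular_fun:
  assumes P: "angular_law P" and b: "b \<ge> 0" and B: "B > 0"
  shows "herglotz (angular_fun a b B P)"
proof -
  interpret prob_space P using P by (simp add: angular_law_def)
  have sP [measurable_cong]: "sets P = sets borel" using P by (simp add: angular_law_def)
  define r where "r = (\<lambda>\<theta> z. 1 / (complex_of_real (sin \<theta>) - z * of_real (cos \<theta>)))"
  have rb: "norm (r \<theta> z) \<le> 1 + (1 + \<bar>Re z\<bar>) / Im z" if "Im z > 0" for \<theta> z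
    unfolding r_def by (rule inverse_angular_denom_bound[OF that])
  have [measurable]: "(\<lambda>\<theta>. r \<theta> z) \<in> borel_measurable borel" for z unfolding r_def by measurable
  have intr: "integrable P (\<lambda>\<theta>. r \<theta> z * r \<theta> w)" if "Im z > 0" "Im w > 0" for z w
  proof (rule integrable_const_bound)
    show "AE \<theta> in P. norm (r \<theta> z * r \<theta> w) \<le> (1 + (1 + \<bar>Re z\<bar>) / Im z) * (1 + (1 + \<bar>Re w\<bar>) / Im w)"
      unfolding norm_mult using that by (intro AE_I2 mult_mono rb) auto
  qed measurable
  have der: "((\<lambda>z. LINT \<theta>|P. angular_kernel \<theta> z) has_field_derivative (LINT \<theta>|P. r \<theta> z * r \<theta> z)) (at z)"
    if z: "Im z > 0" for z
    unfolding has_field_derivative_iff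
  proof (rule LIM_zero_cancel, rule Lim_null_comparison)
    define M where "M = 1 + (1 + \<bar>Re z\<bar>) / Im z"
    \<comment> \<open>\<open>M'\<close> bounds \<open>r \<theta> w\<close> uniformly for |w - z| <
      min 1 (Im z / 2): there Im w is at least Im z / 2 and |Re w| at most 1 + |Re z|.\<close>
    define M' where "M' = 1 + (2 + \<bar>Re z\<bar>) / (Im z / 2)"
    have "M \<ge> 0" using z by (simp add: M_def)
    have "\<forall>\<^sub>F w in at z. dist w z < min 1 (Im z / 2)"
      using z by (intro eventually_at_ball[of "min 1 (Im z / 2)" z UNIV, simplified mem_ball, THEN eventually_mono]) (auto simp: dist_commute)
    then show "\<forall>\<^sub>F w in at z. norm (((LINT \<theta>|P. angular_kernel \<theta> w) - (LINT \<theta>|P. angular_kernel \<theta> z)) / (w - z)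
        - (LINT \<theta>|P. r \<theta> z * r \<theta> z)) \<le> norm (w - z) * (M * M * M')"
      using eventually_neq_at_within[of z z UNIV]
    proof eventually_elim
      case (elim w)
      have d: "norm (w - z) < 1" "norm (w - z) < Im z / 2" using elim by (auto simp: dist_norm)
      have imw: "Im w \<ge> Im z / 2" using abs_Im_le_cmod[of "w - z"] d by (simp add: abs_le_iff)
      have rew: "\<bar>Re w\<bar> \<le> 1 + \<bar>Re z\<bar>" using abs_Re_le_cmod[of "w - z"] d unfolding minus_complex.sel by linarith
      have w: "Im w > 0" using imw z by simp
      have "(1 + \<bar>Re w\<bar>) / Im w \<le> (2 + \<bar>Re z\<bar>) / (Im z / 2)"
        using imw rew z by (intro frac_le) auto
      then have rw: "norm (r \<theta> w) \<le> M'" for \<theta> using rb[OF w, of \<theta>] by (simp add: M'_def)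
      have rz: "norm (r \<theta> z) \<le> M" for \<theta> using rb[OF z, of \<theta>] by (simp add: M_def)
      have "(LINT \<theta>|P. angular_kernel \<theta> w) - (LINT \<theta>|P. angular_kernel \<theta> z)
          = (LINT \<theta>|P. angular_kernel \<theta> w - angular_kernel \<theta> z)"
        using angular_law_integrable[OF P] z w by simp
      also have "\<dots> = (LINT \<theta>|P. (w - z) * (r \<theta> z * r \<theta> w))"
        unfolding angular_kernel_diff[OF z w] r_def ..
      also have "\<dots> = (w - z) * (LINT \<theta>|P. r \<theta> z * r \<theta> w)" by simp
      finally have "((LINT \<theta>|P. angular_kernel \<theta> w) - (LINT \<theta>|P. angular_kernel \<theta> z)) / (w - z)
          = (LINT \<theta>|P. r \<theta> z * r \<theta> w)" using elim by simp
      then have "((LINT \<theta>|P. angular_kernel \<theta> w) - (LINT \<theta>|P. angular_kernel \<theta> z)) / (w - z) - (LINT \<theta>|P. r \<theta> z * r \<theta> z)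
          = (LINT \<theta>|P. r \<theta> z * r \<theta> w - r \<theta> z * r \<theta> z)"
        using intr z w by simp
      also have "norm \<dots> \<le> (LINT \<theta>|P. norm (r \<theta> z * r \<theta> w - r \<theta> z * r \<theta> z))"
        by (rule integral_norm_bound)
      also have "\<dots> \<le> (LINT \<theta>|P. norm (w - z) * (M * M * M'))"
      proof (rule integral_mono)
        fix \<theta>
        have nz: "of_real (sin \<theta>) - z * of_real (cos \<theta>) \<noteq> 0" "of_real (sin \<theta>) - w * of_real (cos \<theta>) \<noteq> 0"
          using angular_denom_nonzero z w by auto
        have "r \<theta> w - r \<theta> z = (w - z) * of_real (cos \<theta>) * (r \<theta> z * r \<theta> w)"
          unfolding r_def using nz by (simp add: diff_frac_eq algebra_simps)
        then have "r \<theta> z * r \<theta> w - r \<theta> z * r \<theta> z = (w - z) * of_real (cos \<theta>) * (r \<theta> z * r \<theta> z * r \<theta> w)"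
          by (simp add: right_diff_distrib[symmetric])
        then have "norm (r \<theta> z * r \<theta> w - r \<theta> z * r \<theta> z)
            = norm (w - z) * \<bar>cos \<theta>\<bar> * (norm (r \<theta> z) * norm (r \<theta> z) * norm (r \<theta> w))"
          by (simp add: norm_mult)
        also have "\<dots> \<le> norm (w - z) * 1 * (M * M * M')"
          using rz rw \<open>M \<ge> 0\<close> by (intro mult_mono) auto
        finally show "norm (r \<theta> z * r \<theta> w - r \<theta> z * r \<theta> z) \<le> norm (w - z) * (M * M * M')" by simp
      qed (use intr z w in auto)
      also have "\<dots> = norm (w - z) * (M * M * M')" using prob_space by simp
      finally show ?case .
    qed
    have "((\<lambda>w. norm (w - z) * (M * M * M')) \<longlongrightarrow> norm (z - z) * (M * M * M')) (at z)"
      by (intro tendsto_intros)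
    then show "((\<lambda>w. norm (w - z) * (M * M * M')) \<longlongrightarrow> 0) (at z)" by simp
  qed
  have "(\<lambda>z. LINT \<theta>|P. angular_kernel \<theta> z) holomorphic_on {w. Im w > 0}"
  proof (rule holomorphic_onI)
    fix z assume "z \<in> {w. Im w > 0}"
    then have "(\<lambda>z. LINT \<theta>|P. angular_kernel \<theta> z) field_differentiable (at z)"
      using der unfolding field_differentiable_def by auto
    then show "(\<lambda>z. LINT \<theta>|P. angular_kernel \<theta> z) field_differentiable (at z within {w. Im w > 0})"
      by (rule field_differentiable_at_within)
  qed
  then have "angular_fun a b B P holomorphic_on {w. Im w > 0}"
    unfolding angular_fun_def by (intro holomorphic_intros)
  moreover have "Im (angular_fun a b B P z) > 0" if z: "Im z > 0" for z
  proof -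
    note int = angular_law_integrable[OF P z]
    have "1 + norm z > 0" using norm_ge_zero[of z] by linarith
    then have "0 < Im z / (1 + norm z)\<^sup>2" using z by simp
    also have "\<dots> = (LINT \<theta>|P. Im z / (1 + norm z)\<^sup>2)" using prob_space by simp
    also have "\<dots> \<le> (LINT \<theta>|P. Im (angular_kernel \<theta> z))"
      using int by (intro integral_mono Im_angular_kernel_ge z) auto
    also have "\<dots> = Im (LINT \<theta>|P. angular_kernel \<theta> z)" using int by simp
    finally have "B * Im (LINT \<theta>|P. angular_kernel \<theta> z) > 0" using B by simp
    then show ?thesis using b z by (simp add: angular_fun_def add_nonneg_pos)
  qed
  ultimately show ?thesis by (simp add: herglotz_altdef)
qed


section \<open>Correspondence between Herglotz measures and laws of angles\<close>

definition arctan_image :: "real set \<Rightarrow> real set" where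
  "arctan_image A = {\<theta>. -(pi/2) < \<theta> \<and> \<theta> < pi/2 \<and> tan \<theta> \<in> A}"

lemma tan_measurable [measurable]: "(tan :: real \<Rightarrow> real) \<in> borel_measurable borel"
  unfolding tan_def by measurable

lemma arctan_measurable [measurable]: "arctan \<in> borel_measurable borel"
  by (intro borel_measurable_continuous_onI continuous_intros)

lemma arctan_image_measurable [measurable]:
  assumes [measurable]: "A \<in> sets borel"
  shows "arctan_image A \<in> sets borel"
  unfolding arctan_image_def by measurable

lemma arctan_in_arctan_image [simp]: "arctan t \<in> arctan_image A \<longleftrightarrow> t \<in> A"
  using arctan_lbound[of t] arctan_ubound[of t] by (simp add: arctan_image_def tan_arctan)

lemma angular_kernel_arctan:
  assumes "Im z > 0"
  shows "angular_kernel (arctan t) z = (1 + of_real t * z) / (of_real t - z)"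
proof -
  define r where "r = complex_of_real (cos (arctan t))"
  have "cos (arctan t) \<noteq> 0" by (metis cos_arctan_not_zero)
  then have r: "r \<noteq> 0" by (simp add: r_def)
  have "sin (arctan t) = t * cos (arctan t)"
    by (simp add: sin_arctan cos_arctan)
  then have "angular_kernel (arctan t) z = (r * (1 + of_real t * z)) / (r * (of_real t - z))"
    unfolding angular_kernel_def r_def[symmetric] by (simp add: algebra_simps r_def)
  also have "\<dots> = (1 + of_real t * z) / (of_real t - z)" using r by simp
  finally show ?thesis .
qed

lemma angular_kernel_tan:
  assumes "Im z > 0" "-(pi/2) < \<theta>" "\<theta> < pi/2"
  shows "angular_kernel \<theta> z = (1 + of_real (tan \<theta>) * z) / (of_real (tan \<theta>) - z)"
  using angular_kernel_arctan[OF assms(1), of "tan \<theta>"] arctan_tan[OF assms(2,3)] by simp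

lemma angular_kernel_pi_half: "angular_kernel (pi/2) z = z" "angular_kernel (-(pi/2)) z = z"
  by (simp_all add: angular_kernel_def)

lemma herglotz_kernel_eq:
  assumes "Im z > 0"
  shows "1 / (of_real t - z) - of_real (t / (t\<^sup>2 + 1))
    = (1 + of_real t * z) / (of_real t - z) * of_real (1 / (t\<^sup>2 + 1))"
proof -
  have "of_real t - z \<noteq> 0" using assms by (auto simp: complex_eq_iff)
  moreover have "t\<^sup>2 + 1 \<noteq> 0" using one_plus_square_pos[of t] by (simp add: add.commute)
  then have "complex_of_real (t\<^sup>2 + 1) \<noteq> 0" by (simp only: of_real_eq_0_iff not_False_eq_True)
  then have "(complex_of_real t)\<^sup>2 + 1 \<noteq> 0" by simp
  ultimately show ?thesis
    by (simp add: divide_simps) (simp add: algebra_simps power2_eq_square)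
qed

text \<open>The measure with density 1 / (B (1 + t^2)) relative to \<open>\<nu>\<close> is a
  probability, and \<open>arctan\<close> transports it to angles. The factor 1 / (1 + t^2) is
  exactly the ratio of the Herglotz integrand to the angular kernel, so a and b are
  unchanged.\<close>

lemma angular_law_of_herglotz_measure:
  assumes \<nu>: "herglotz_measure \<nu>" and w: "(\<integral>\<^sup>+t. ennreal (1 / (t\<^sup>2 + 1)) \<partial>\<nu>) = ennreal B" and B: "B > 0"
  obtains P where "angular_law P"
    "\<And>z. Im z > 0 \<Longrightarrow> angular_fun a b B P z = herglotz_fun a b \<nu> z"
    "\<And>A. A \<in> sets borel \<Longrightarrow>
      emeasure \<nu> A = (\<integral>\<^sup>+\<theta>. indicator (arctan_image A) \<theta> * ennreal (B * (1 + (tan \<theta>)\<^sup>2)) \<partial>P)"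
proof -
  have s\<nu> [measurable_cong]: "sets \<nu> = sets borel" using \<nu> by (simp add: herglotz_measure_def)
  have [simp]: "space \<nu> = UNIV" using sets_eq_imp_space_eq[OF s\<nu>] by simp
  have pos: "t\<^sup>2 + 1 > 0" for t :: real using one_plus_square_pos[of t] by (simp add: add.commute)
  define N where "N = density \<nu> (\<lambda>t. ennreal (1 / (B * (t\<^sup>2 + 1))))"
  define P where "P = distr N borel arctan"
  have [measurable_cong]: "sets N = sets borel" by (simp add: N_def s\<nu>)
  have "(\<integral>\<^sup>+t. ennreal (1 / (B * (t\<^sup>2 + 1))) \<partial>\<nu>) = (\<integral>\<^sup>+t. ennreal (1 / B) * ennreal (1 / (t\<^sup>2 + 1)) \<partial>\<nu>)"
    using B pos by (intro nn_integral_cong) (simp add: ennreal_mult[symmetric] less_imp_le)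
  also have "\<dots> = ennreal (1 / B) * ennreal B" by (subst nn_integral_cmult) (auto simp: w)
  also have "\<dots> = 1" using B by (simp flip: ennreal_mult)
  finally have N1: "emeasure N UNIV = 1" by (simp add: N_def emeasure_density)
  interpret N: prob_space N by standard (use N1 in \<open>simp add: N_def\<close>)
  have P: "angular_law P"
    unfolding angular_law_def
  proof (intro conjI)
    show "prob_space P" unfolding P_def by (rule N.prob_space_distr) measurable
    show "sets P = sets borel" by (simp add: P_def)
    have "arctan -` {-(pi/2)..pi/2} = UNIV"
      using arctan_lbound arctan_ubound by (auto simp: less_imp_le)
    then show "emeasure P {-(pi/2)..pi/2} = 1"
      using N1 by (simp add: P_def emeasure_distr N_def)
  qed
  show thesis
  proof (rule that[OF P])
    fix z assume z: "Im z > 0"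
    have "of_real B * (LINT \<theta>|P. angular_kernel \<theta> z) = of_real B * (LINT t|N. angular_kernel (arctan t) z)"
      unfolding P_def by (subst integral_distr) auto
    also have "(LINT t|N. angular_kernel (arctan t) z) = (LINT t|\<nu>. (1 / (B * (t\<^sup>2 + 1))) *\<^sub>R angular_kernel (arctan t) z)"
      unfolding N_def using B pos by (subst integral_density) (auto simp: less_imp_le)
    also have "of_real B * \<dots> = (LINT t|\<nu>. of_real B * ((1 / (B * (t\<^sup>2 + 1))) *\<^sub>R angular_kernel (arctan t) z))"
      by (rule integral_mult_right_zero[symmetric])
    also have "\<dots> = (LINT t|\<nu>. 1 / (of_real t - z) - of_real (t / (t\<^sup>2 + 1)))"
    proof (rule Bochner_Integration.integral_cong)
      fix t
      have "of_real B * ((1 / (B * (t\<^sup>2 + 1))) *\<^sub>R angular_kernel (arctan t) z)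
          = angular_kernel (arctan t) z * of_real (B * (1 / (B * (t\<^sup>2 + 1))))"
        by (simp only: scaleR_conv_of_real of_real_mult mult_ac)
      also have "B * (1 / (B * (t\<^sup>2 + 1))) = 1 / (t\<^sup>2 + 1)" using B by simp
      finally show "of_real B * ((1 / (B * (t\<^sup>2 + 1))) *\<^sub>R angular_kernel (arctan t) z)
          = 1 / (of_real t - z) - of_real (t / (t\<^sup>2 + 1))"
        unfolding herglotz_kernel_eq[OF z] angular_kernel_arctan[OF z] .
    qed simp
    finally show "angular_fun a b B P z = herglotz_fun a b \<nu> z"
      unfolding angular_fun_def herglotz_fun_def by simp
  next
    fix A :: "real set" assume [measurable]: "A \<in> sets borel"
    have "(\<integral>\<^sup>+\<theta>. indicator (arctan_image A) \<theta> * ennreal (B * (1 + (tan \<theta>)\<^sup>2)) \<partial>P)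
        = (\<integral>\<^sup>+t. indicator (arctan_image A) (arctan t) * ennreal (B * (1 + (tan (arctan t))\<^sup>2)) \<partial>N)"
      unfolding P_def by (subst nn_integral_distr) auto
    also have "\<dots> = (\<integral>\<^sup>+t. indicator A t * ennreal (B * (1 + t\<^sup>2)) \<partial>N)"
      by (intro nn_integral_cong) (simp add: indicator_def tan_arctan)
    also have "\<dots> = (\<integral>\<^sup>+t. ennreal (1 / (B * (t\<^sup>2 + 1))) * (indicator A t * ennreal (B * (1 + t\<^sup>2))) \<partial>\<nu>)"
      unfolding N_def by (subst nn_integral_density) auto
    also have "\<dots> = (\<integral>\<^sup>+t. indicator A t \<partial>\<nu>)"
    proof (rule nn_integral_cong)
      fix t
      have "ennreal (1 / (B * (t\<^sup>2 + 1))) * ennreal (B * (1 + t\<^sup>2)) = ennreal (1 / (B * (t\<^sup>2 + 1)) * (B * (1 + t\<^sup>2)))"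
        using B pos[of t] by (intro ennreal_mult[symmetric]) (auto simp: add.commute)
      also have "1 / (B * (t\<^sup>2 + 1)) * (B * (1 + t\<^sup>2)) = 1"
        using B pos[of t] by (simp add: add.commute)
      finally show "ennreal (1 / (B * (t\<^sup>2 + 1))) * (indicator A t * ennreal (B * (1 + t\<^sup>2))) = indicator A t"
        by (simp add: indicator_def)
    qed
    finally show "emeasure \<nu> A = (\<integral>\<^sup>+\<theta>. indicator (arctan_image A) \<theta> * ennreal (B * (1 + (tan \<theta>)\<^sup>2)) \<partial>P)"
      by simp
  qed
qed

text \<open>Mass at the endpoints has no counterpart on the real line. There the angular kernel is
  z, so this mass moves into the linear coefficient, which explains the new value of b.\<close>

lemma herglotz_measure_of_angular_law:
  assumes P: "angular_law P" and B: "B > 0"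
  obtains \<mu> where "herglotz_measure \<mu>"
    "\<And>z. Im z > 0 \<Longrightarrow> herglotz_fun a (b + B * measure P {-(pi/2), pi/2}) \<mu> z = angular_fun a b B P z"
    "\<And>A. A \<in> sets borel \<Longrightarrow>
      emeasure \<mu> A = (\<integral>\<^sup>+\<theta>. indicator (arctan_image A) \<theta> * ennreal (B * (1 + (tan \<theta>)\<^sup>2)) \<partial>P)"
proof -
  interpret prob_space P using P by (simp add: angular_law_def)
  have sP [measurable_cong]: "sets P = sets borel" using P by (simp add: angular_law_def)
  have [simp]: "space P = UNIV" using sets_eq_imp_space_eq[OF sP] by simp
  have pos: "t\<^sup>2 + 1 > 0" for t :: real using one_plus_square_pos[of t] by (simp add: add.commute)
  \<comment> \<open>The indicator cuts off the endpoints: \<open>tan\<close> has the default value 0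
    there, and mass at infinity would otherwise reappear at t = 0.\<close>
  define g where "g = (\<lambda>\<theta>. indicat_real (arctan_image UNIV) \<theta> * (B * (1 + (tan \<theta>)\<^sup>2)))"
  have g0: "g \<theta> \<ge> 0" for \<theta> using B by (simp add: g_def)
  have [measurable]: "g \<in> borel_measurable borel" unfolding g_def by measurable
  define N where "N = density P (\<lambda>\<theta>. ennreal (g \<theta>))"
  have [measurable_cong]: "sets N = sets borel" by (simp add: N_def sP)
  define \<mu> where "\<mu> = distr N borel tan"
  have int\<mu>: "(\<integral>\<^sup>+t. f t \<partial>\<mu>) = (\<integral>\<^sup>+\<theta>. ennreal (g \<theta>) * f (tan \<theta>) \<partial>P)"
    if [measurable]: "f \<in> borel_measurable borel" for f
    unfolding \<mu>_def N_def by (subst nn_integral_distr) (auto simp: nn_integral_density)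
  have AEP: "AE \<theta> in P. -(pi/2) \<le> \<theta> \<and> \<theta> \<le> pi/2"
  proof -
    have "AE \<theta> in P. \<theta> \<in> {-(pi/2)..pi/2}"
      using P by (subst AE_in_set_eq_1) (auto simp: angular_law_def measure_def)
    then show ?thesis by simp
  qed
  show thesis
  proof (rule that)
    have "(\<integral>\<^sup>+t. ennreal (1 / (t\<^sup>2 + 1)) \<partial>\<mu>) = (\<integral>\<^sup>+\<theta>. ennreal (g \<theta>) * ennreal (1 / ((tan \<theta>)\<^sup>2 + 1)) \<partial>P)"
      by (subst int\<mu>) auto
    also have "\<dots> \<le> (\<integral>\<^sup>+\<theta>. ennreal B \<partial>P)"
    proof (rule nn_integral_mono)
      fix \<theta>
      have "g \<theta> * (1 / ((tan \<theta>)\<^sup>2 + 1)) \<le> B"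
        using B pos[of "tan \<theta>"] by (simp add: g_def indicator_def add.commute less_imp_le)
      then show "ennreal (g \<theta>) * ennreal (1 / ((tan \<theta>)\<^sup>2 + 1)) \<le> ennreal B"
        using g0 pos[of "tan \<theta>"] by (subst ennreal_mult[symmetric]) (auto intro!: ennreal_leI simp: less_imp_le)
    qed
    also have "\<dots> < \<infinity>" using emeasure_space_1 by simp
    finally show "herglotz_measure \<mu>" by (simp add: herglotz_measure_def \<mu>_def)
  next
    fix A :: "real set" assume [measurable]: "A \<in> sets borel"
    have "emeasure \<mu> A = (\<integral>\<^sup>+t. indicator A t \<partial>\<mu>)" by (simp add: \<mu>_def)
    also have "\<dots> = (\<integral>\<^sup>+\<theta>. ennreal (g \<theta>) * indicator A (tan \<theta>) \<partial>P)" by (subst int\<mu>) auto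
    also have "\<dots> = (\<integral>\<^sup>+\<theta>. indicator (arctan_image A) \<theta> * ennreal (B * (1 + (tan \<theta>)\<^sup>2)) \<partial>P)"
      by (intro nn_integral_cong) (auto simp: g_def indicator_def arctan_image_def)
    finally show "emeasure \<mu> A = (\<integral>\<^sup>+\<theta>. indicator (arctan_image A) \<theta> * ennreal (B * (1 + (tan \<theta>)\<^sup>2)) \<partial>P)" .
  next
    fix z assume z: "Im z > 0"
    let ?I = "{-(pi/2), pi/2}"
    have "(LINT t|\<mu>. 1 / (of_real t - z) - of_real (t / (t\<^sup>2 + 1)))
        = (LINT \<theta>|P. g \<theta> *\<^sub>R (1 / (of_real (tan \<theta>) - z) - of_real (tan \<theta> / ((tan \<theta>)\<^sup>2 + 1))))"
      unfolding \<mu>_def N_def using g0 by (subst integral_distr) (auto simp: integral_density)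
    also have "\<dots> = (LINT \<theta>|P. of_real B * angular_kernel \<theta> z - of_real B * z * of_real (indicator ?I \<theta>))"
    proof (rule integral_cong_AE)
      show "AE \<theta> in P. g \<theta> *\<^sub>R (1 / (of_real (tan \<theta>) - z) - of_real (tan \<theta> / ((tan \<theta>)\<^sup>2 + 1)))
          = of_real B * angular_kernel \<theta> z - of_real B * z * of_real (indicator ?I \<theta>)"
        using AEP
      proof eventually_elim
        case (elim \<theta>)
        show ?case
        proof (cases "\<theta> \<in> ?I")
          case True
          have "angular_kernel \<theta> z = z" using True by (elim insertE) (simp_all only: angular_kernel_pi_half empty_iff)
          moreover have "g \<theta> = 0" using True by (auto simp: g_def arctan_image_def)
          moreover have "indicat_real ?I \<theta> = 1" using True by (rule indicator_eq_1_iff[THEN iffD2])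
          ultimately show ?thesis by (simp only: scaleR_zero_left of_real_1 mult_1_right diff_self)
        next
          case False
          then have \<theta>: "-(pi/2) < \<theta>" "\<theta> < pi/2" using elim by auto
          have "g \<theta> = B * ((tan \<theta>)\<^sup>2 + 1)" using \<theta> by (simp add: g_def arctan_image_def)
          then have "g \<theta> *\<^sub>R (1 / (of_real (tan \<theta>) - z) - of_real (tan \<theta> / ((tan \<theta>)\<^sup>2 + 1)))
              = angular_kernel \<theta> z * of_real (B * ((tan \<theta>)\<^sup>2 + 1) * (1 / ((tan \<theta>)\<^sup>2 + 1)))"
            unfolding herglotz_kernel_eq[OF z] angular_kernel_tan[OF z \<theta>]
            by (simp only: scaleR_conv_of_real of_real_mult mult_ac)
          also have "B * ((tan \<theta>)\<^sup>2 + 1) * (1 / ((tan \<theta>)\<^sup>2 + 1)) = B" using pos[of "tan \<theta>"] by simp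
          finally show ?thesis using False by (simp add: mult.commute)
        qed
      qed
    qed measurable
    also have "\<dots> = of_real B * (LINT \<theta>|P. angular_kernel \<theta> z) - of_real B * z * of_real (measure P ?I)"
    proof (subst Bochner_Integration.integral_diff)
      show "integrable P (\<lambda>\<theta>. of_real B * angular_kernel \<theta> z)"
        using angular_law_integrable[OF P z] by simp
      have "integrable P (indicat_real ?I)" by (intro integrable_const_bound[where B = 1]) auto
      then show "integrable P (\<lambda>\<theta>. of_real B * z * of_real (indicat_real ?I \<theta>))" by (intro integrable_mult_right integrable_of_real)
      have "(LINT \<theta>|P. complex_of_real (indicat_real ?I \<theta>)) = of_real (measure P ?I)"
        unfolding integral_complex_of_real by simp
      then show "(LINT \<theta>|P. of_real B * angular_kernel \<theta> z) - (LINT \<theta>|P. of_real B * z * of_real (indicat_real ?I \<theta>))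
          = of_real B * (LINT \<theta>|P. angular_kernel \<theta> z) - of_real B * z * of_real (measure P ?I)"
        by (simp only: integral_mult_right_zero)
    qed
    finally show "herglotz_fun a (b + B * measure P ?I) \<mu> z = angular_fun a b B P z"
      unfolding herglotz_fun_def angular_fun_def by (simp add: algebra_simps)
  qed
qed


section \<open>Sweeping an interval\<close>

text \<open>The integrand is the mean of 1 / (1 - i r v) and 1 / (1 + i r v). The first is bounded
  and holomorphic in the upper half plane with value 1 / (1 + r) at i; the second has the same
  expectation by symmetry of the Cauchy law.\<close>

lemma cauchy_law_expectation_square:
  assumes r: "Re r > 0"
  shows "(LINT v|cauchy_law. 1 / (1 + r\<^sup>2 * of_real (v\<^sup>2))) = 1 / (1 + r)"
    "integrable cauchy_law (\<lambda>v. 1 / (1 + r\<^sup>2 * of_real (v\<^sup>2)))"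
proof -
  define f where "f = (\<lambda>w. 1 / (1 - \<i> * r * w))"
  \<comment> \<open>The pole of \<open>f\<close> is -i / r, at depth \<open>\<delta>\<close> below
    the real line.\<close>
  define \<delta> where "\<delta> = Re (1 / r)"
  have r0: "r \<noteq> 0" using r by auto
  have "\<delta> > 0"
    using r by (auto simp: \<delta>_def Re_divide sum_power2_gt_zero_iff intro!: divide_pos_pos)
  have fact: "1 - \<i> * r * w = - \<i> * r * (w + \<i> / r)" for w
    using r0 by (simp add: field_simps)
  have imp: "Im (\<i> / r) = \<delta>" unfolding \<delta>_def by (simp add: Re_divide Im_divide)
  have nz: "1 - \<i> * r * w \<noteq> 0" if "Im w > - \<delta>" for w
  proof -
    have "Im (w + \<i> / r) > 0" using that imp by simp
    then have "w + \<i> / r \<noteq> 0" by (metis less_irrefl zero_complex.sel(2))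
    then show ?thesis unfolding fact using r0 by simp
  qed
  have hol: "f holomorphic_on {w. Im w > - \<delta>}"
    unfolding f_def using nz by (intro holomorphic_intros) auto
  have bdd: "norm (f w) \<le> 1 / (norm r * \<delta>)" if "Im w \<ge> 0" for w
  proof -
    have "\<delta> \<le> Im (w + \<i> / r)" using that imp by simp
    also have "\<dots> \<le> norm (w + \<i> / r)" using abs_Im_le_cmod[of "w + \<i> / r"] by linarith
    finally have "norm r * \<delta> \<le> norm (1 - \<i> * r * w)"
      unfolding fact norm_mult by (simp add: mult_left_mono)
    then show ?thesis
      unfolding f_def norm_divide using r0 \<open>\<delta> > 0\<close> by (simp add: frac_le)
  qed
  have "\<i> * r * \<i> = - r" by (simp add: ac_simps)
  then have fi: "(LINT v|cauchy_law. f (of_real v)) = 1 / (1 + r)"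
    using Poisson_formula_i[OF hol \<open>\<delta> > 0\<close> bdd] by (simp add: f_def)
  have [measurable]: "f \<in> borel_measurable borel" unfolding f_def by measurable
  have int: "integrable cauchy_law (\<lambda>v. f (of_real v))"
    by (rule cauchy.integrable_const_bound[where B = "1 / (norm r * \<delta>)"]) (auto intro!: AE_I2 bdd)
  have "(LINT v|cauchy_law. f (of_real v)) = (LINT v|distr cauchy_law borel uminus. f (of_real v))"
    by (simp add: distr_uminus_cauchy_law)
  also have "\<dots> = (LINT v|cauchy_law. f (of_real (- v)))" by (subst integral_distr) auto
  finally have fi': "(LINT v|cauchy_law. f (of_real (- v))) = 1 / (1 + r)" using fi by simp
  have int': "integrable cauchy_law (\<lambda>v. f (of_real (- v)))"
    by (rule cauchy.integrable_const_bound[where B = "1 / (norm r * \<delta>)"]) (auto intro!: AE_I2 bdd)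
  have eq: "1 / (1 + r\<^sup>2 * of_real (v\<^sup>2)) = (f (of_real v) + f (of_real (- v))) / 2" for v
  proof -
    have n: "1 - \<i> * r * of_real v \<noteq> 0" "1 + \<i> * r * of_real v \<noteq> 0"
      using nz[of "of_real v"] nz[of "of_real (- v)"] \<open>\<delta> > 0\<close> by auto
    have pr: "(1 - \<i> * r * of_real v) * (1 + \<i> * r * of_real v) = 1 + r\<^sup>2 * of_real (v\<^sup>2)"
      by (simp add: algebra_simps power2_eq_square)
    have fs: "f (of_real v) + f (of_real (- v)) = 2 / ((1 - \<i> * r * of_real v) * (1 + \<i> * r * of_real v))"
      unfolding f_def using n by (simp add: add_frac_eq)
    have half: "(2 / X) / 2 = 1 / X" for X :: complex by simp
    show ?thesis by (simp only: fs half pr)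
  qed
  show "(LINT v|cauchy_law. 1 / (1 + r\<^sup>2 * of_real (v\<^sup>2))) = 1 / (1 + r)"
  proof -
    have "(x + x) / 2 = x" for x :: complex by simp
    then show ?thesis
      by (simp only: eq integral_divide_zero Bochner_Integration.integral_add[OF int int'] fi fi')
  qed
  show "integrable cauchy_law (\<lambda>v. 1 / (1 + r\<^sup>2 * of_real (v\<^sup>2)))"
    unfolding eq using int int' by simp
qed

text \<open>The square root of \<open>(t - c) / (d - t)\<close> maps the complement of \<open>\<real> - (c, d)\<close> in the Riemann
  sphere onto the right half plane, where harmonic measure is a Cauchy law on the imaginary axis.
  Hence for a Cauchy variable \<open>v\<close> the law of \<open>sweep_point c d t v\<close> is the harmonic measure of this
  complement with respect to \<open>t\<close>. (The denominator vanishes for at most two values of \<open>v\<close>.)\<close>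

definition sweep_point :: "real \<Rightarrow> real \<Rightarrow> real \<Rightarrow> real \<Rightarrow> real" where
  "sweep_point c d t v = (c * (d - t) - d * (t - c) * v\<^sup>2) / ((d - t) - (t - c) * v\<^sup>2)"

text \<open>A branch of i / sqrt ((c - z) (d - z)). The quotient under the root lies in the upper
  half plane when z does, and is positive for real z outside [c, d], so the branch cut of
  \<open>csqrt\<close> is avoided in both cases.\<close>

definition sweep_factor :: "real \<Rightarrow> real \<Rightarrow> complex \<Rightarrow> complex" where
  "sweep_factor c d z = \<i> * csqrt ((of_real d - z) / (of_real c - z)) / (of_real d - z)"

lemma Im_sweep_quotient_pos:
  assumes "c < d" "Im z > 0"
  shows "Im ((of_real d - z) / (of_real c - z)) > 0"
proof -
  have nz: "of_real c - z \<noteq> 0" using assms by (auto simp: complex_eq_iff)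
  have "(of_real d - z) / (of_real c - z) = 1 + of_real (d - c) / (of_real c - z)"
    using nz by (simp add: field_simps)
  moreover have "Im (of_real (d - c) / (of_real c - z)) > 0"
    using assms nz by (simp add: Im_divide sum_power2_gt_zero_iff zero_less_mult_iff)
  ultimately show ?thesis by simp
qed

text \<open>As a function of v^2, 1 / (s - z) at s = \<open>sweep_point c d t v\<close> is a Moebius
  transformation, hence a constant plus a multiple of 1 / (1 + r^2 v^2), whose expectation is
  known.\<close>

lemma sweep_point_expectation:
  assumes cd: "c < t" "t < d" and z: "Im z > 0"
  shows "(LINT v|cauchy_law. 1 / (of_real (sweep_point c d t v) - z))
    = 1 / (of_real t - z) + sweep_factor c d z * of_real (sqrt ((t - c) * (d - t))) / (of_real t - z)"
    and "integrable cauchy_law (\<lambda>v. 1 / (of_real (sweep_point c d t v) - z))"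
proof -
  define q where "q = (of_real d - z) / (of_real c - z)"
  define s where "s = sqrt ((t - c) / (d - t))"
  \<comment> \<open>r^2 is (t - c) / (d - t) divided by (z - c) / (d - z); thus r is the ratio of
    the images of t and z under the square root map, with the sign that makes Re r positive.\<close>
  define r where "r = - \<i> * csqrt q * of_real s"
  have s0: "s > 0" and s2: "s\<^sup>2 = (t - c) / (d - t)" using cd by (auto simp: s_def)
  have Imq: "Im q > 0" unfolding q_def using cd z by (intro Im_sweep_quotient_pos) auto
  have "Im (csqrt q) > 0"
  proof -
    define u where "u = csqrt q"
    have "u\<^sup>2 = q" "Re u \<ge> 0" using Re_csqrt[of q] by (simp_all add: u_def)
    moreover have "Im (u\<^sup>2) = 2 * (Re u * Im u)" by (simp add: power2_eq_square)
    ultimately have "Re u * Im u > 0" using Imq by (simp add: mult.commute)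
    then show ?thesis using \<open>Re u \<ge> 0\<close> unfolding u_def[symmetric] by (auto simp: zero_less_mult_iff)
  qed
  then have Rer: "Re r > 0" using s0 by (simp add: r_def)
  have r2: "r\<^sup>2 = - q * of_real (s\<^sup>2)" by (simp add: r_def power_mult_distrib)
  define C where "C = of_real c - z"
  define D where "D = of_real d - z"
  have C0: "C \<noteq> 0" and D0: "D \<noteq> 0" and T0: "of_real t - z \<noteq> 0"
    using z by (auto simp: C_def D_def complex_eq_iff)
  have k1: "- r\<^sup>2 = D / C * of_real ((t - c) / (d - t))" unfolding r2 q_def s2 C_def D_def by simp
  have dt0: "complex_of_real (d - t) \<noteq> 0" using cd unfolding of_real_eq_0_iff by simp
  have pw: "1 / (of_real (sweep_point c d t v) - z) = 1 / D + (D - C) / (D * C) * (1 / (1 + r\<^sup>2 * of_real (v\<^sup>2)))"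
    if v: "(d - t) - (t - c) * v\<^sup>2 \<noteq> 0" for v
  proof -
    define e where "e = complex_of_real ((d - t) - (t - c) * v\<^sup>2)"
    have e0: "e \<noteq> 0" using v unfolding e_def of_real_eq_0_iff .
    define n where "n = C * of_real (d - t) - D * of_real ((t - c) * v\<^sup>2)"
    have "of_real (sweep_point c d t v) - z = n / e"
    proof -
      define N where "N = complex_of_real (c * (d - t) - d * (t - c) * v\<^sup>2)"
      have num: "N - z * e = n"
        unfolding N_def e_def n_def C_def D_def by (simp add: algebra_simps)
      have "complex_of_real (sweep_point c d t v) = N / e"
        unfolding sweep_point_def e_def N_def by (rule of_real_divide)
      then show ?thesis using e0 unfolding num[symmetric] by (simp add: diff_divide_distrib)
    qed
    moreover have nr: "n = C * of_real (d - t) * (1 + r\<^sup>2 * of_real (v\<^sup>2))"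
    proof -
      have "r\<^sup>2 = - (D / C * (of_real (t - c) / of_real (d - t)))"
        using k1 by (metis add.inverse_inverse of_real_divide)
      then show ?thesis unfolding n_def of_real_mult using C0 dt0 by (simp add: algebra_simps del: of_real_diff)
    qed
    moreover have m0: "1 + r\<^sup>2 * of_real (v\<^sup>2) \<noteq> 0"
    proof
      assume "1 + r\<^sup>2 * of_real (v\<^sup>2) = 0"
      then have "of_real (sweep_point c d t v) - z = 0" using calculation by simp
      then show False using z by (auto simp: complex_eq_iff)
    qed
    moreover have "e * D = n + (D - C) * of_real (d - t)"
      unfolding e_def n_def by (simp add: algebra_simps)
    then have "e / n = 1 / D + (D - C) * of_real (d - t) / (D * n)"
      using D0 calculation m0 C0 dt0 by (simp add: divide_simps) (simp add: algebra_simps)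
    moreover have "(D - C) * of_real (d - t) / (D * n) = (D - C) / (D * C) * (1 / (1 + r\<^sup>2 * of_real (v\<^sup>2)))"
      unfolding nr using dt0 by simp
    ultimately show ?thesis by simp
  qed
  have AEv: "AE v in cauchy_law. (d - t) - (t - c) * v\<^sup>2 \<noteq> 0"
  proof -
    have "(d - t) - (t - c) * v\<^sup>2 \<noteq> 0" if "v \<notin> {1 / s, - (1 / s)}" for v
    proof
      assume "(d - t) - (t - c) * v\<^sup>2 = 0"
      then have "s\<^sup>2 * v\<^sup>2 = 1" using cd by (simp add: s2 field_simps)
      then have "(s * v)\<^sup>2 = 1\<^sup>2" by (simp add: power_mult_distrib)
      then have "s * v = 1 \<or> s * v = -1" by (metis power2_eq_iff)
      then have "v = 1 / s \<or> v = - (1 / s)" using s0 by (auto simp: field_simps)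
      then show False using that by auto
    qed
    moreover have "AE v in lborel. v \<notin> {1 / s, - (1 / s)}"
      by (intro AE_not_in null_setsI) (auto simp: emeasure_lborel_countable)
    ultimately show ?thesis unfolding AE_cauchy_law_iff by (auto elim: AE_mp)
  qed
  note E = cauchy_law_expectation_square[OF Rer]
  have [measurable]: "(\<lambda>v. 1 / (of_real (sweep_point c d t v) - z)) \<in> borel_measurable borel"
    unfolding sweep_point_def by measurable
  have AEeq: "AE v in cauchy_law. 1 / (of_real (sweep_point c d t v) - z)
      = 1 / D + (D - C) / (D * C) * (1 / (1 + r\<^sup>2 * of_real (v\<^sup>2)))"
    using AEv by eventually_elim (rule pw)
  have intR: "integrable cauchy_law (\<lambda>v. 1 / D + (D - C) / (D * C) * (1 / (1 + r\<^sup>2 * of_real (v\<^sup>2))))"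
    by (intro Bochner_Integration.integrable_add integrable_mult_right E(2)) simp
  then show "integrable cauchy_law (\<lambda>v. 1 / (of_real (sweep_point c d t v) - z))"
    by (subst integrable_cong_AE[OF _ _ AEeq]) measurable
  have "(LINT v|cauchy_law. 1 / (of_real (sweep_point c d t v) - z))
      = (LINT v|cauchy_law. 1 / D + (D - C) / (D * C) * (1 / (1 + r\<^sup>2 * of_real (v\<^sup>2))))"
    by (rule integral_cong_AE[OF _ _ AEeq]) measurable
  also have "\<dots> = 1 / D + (D - C) / (D * C) * (1 / (1 + r))"
  proof -
    have "(LINT v|cauchy_law. 1 / D) = 1 / D" using cauchy.prob_space by simp
    moreover have "integrable cauchy_law (\<lambda>v. 1 / D)" by simp
    ultimately show ?thesis
      by (simp only: Bochner_Integration.integral_add integrable_mult_right[OF E(2)] integral_mult_right_zero E(1))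
  qed
  also have "\<dots> = 1 / (of_real t - z) + sweep_factor c d z * of_real (sqrt ((t - c) * (d - t))) / (of_real t - z)"
  proof -
    have r1: "1 + r \<noteq> 0" using Rer by (auto simp: complex_eq_iff)
    have DC: "D - C = of_real (d - c)" by (simp add: C_def D_def)
    have m: "1 - r\<^sup>2 = (of_real t - z) * of_real (d - c) / (C * of_real (d - t))"
    proof -
      have "r\<^sup>2 = - (D / C * (of_real (t - c) / of_real (d - t)))"
        using k1 by (metis add.inverse_inverse of_real_divide)
      then have "1 - r\<^sup>2 = (C * of_real (d - t) + D * of_real (t - c)) / (C * of_real (d - t))"
        using C0 dt0 by (simp add: add_divide_distrib del: of_real_diff)
      also have "C * of_real (d - t) + D * of_real (t - c) = (of_real t - z) * of_real (d - c)"
        by (simp add: C_def D_def algebra_simps)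
      finally show ?thesis .
    qed
    have dc0: "complex_of_real (d - c) \<noteq> 0" using cd unfolding of_real_eq_0_iff by simp
    have m0: "1 - r\<^sup>2 \<noteq> 0" unfolding m using T0 dc0 C0 dt0 by simp
    \<comment> \<open>Rationalising separates the even from the odd part in r: the even part
      recombines with 1 / D to 1 / (t - z), and the part linear in r becomes the term with
      \<open>sweep_factor\<close>.\<close>
    have "1 / (1 + r) = (1 - r) / (1 - r\<^sup>2)"
      using r1 m0 by (simp add: divide_simps) (simp add: algebra_simps power2_eq_square)
    also have "(D - C) / (D * C) * \<dots> = (1 - r) * of_real (d - t) / (D * (of_real t - z))"
      unfolding m DC using C0 dt0 dc0 by simp
    also have "1 / D + \<dots> = ((of_real t - z) + (1 - r) * of_real (d - t)) / (D * (of_real t - z))"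
      using D0 T0 by (simp add: add_frac_eq divide_simps)
    also have "(of_real t - z) + (1 - r) * of_real (d - t) = D - r * of_real (d - t)"
      by (simp add: D_def algebra_simps)
    also have "\<dots> / (D * (of_real t - z)) = 1 / (of_real t - z) + (- r * of_real (d - t)) / D / (of_real t - z)"
      using D0 by (simp add: diff_divide_distrib)
    also have "- r * of_real (d - t) = \<i> * csqrt q * of_real (s * (d - t))"
      by (simp add: r_def)
    also have "s * (d - t) = sqrt ((t - c) * (d - t))"
    proof -
      have "s * (d - t) = sqrt ((t - c) / (d - t)) * sqrt ((d - t)\<^sup>2)" using cd by (simp add: s_def)
      also have "\<dots> = sqrt ((t - c) * (d - t))"
        unfolding real_sqrt_mult[symmetric] using cd by (simp add: power2_eq_square)
      finally show ?thesis .
    qed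
    finally show ?thesis by (simp add: sweep_factor_def q_def D_def)
  qed
  finally show "(LINT v|cauchy_law. 1 / (of_real (sweep_point c d t v) - z))
    = 1 / (of_real t - z) + sweep_factor c d z * of_real (sqrt ((t - c) * (d - t))) / (of_real t - z)" .
qed


section \<open>Sweeping as an operation on laws\<close>

lemma angular_lawD:
  assumes "angular_law P"
  shows "prob_space P" "sets P = sets borel" "space P = UNIV" "emeasure P {-(pi/2)..pi/2} = 1"
  using assms sets_eq_imp_space_eq[of P borel] by (auto simp: angular_law_def)

definition sweep_angle :: "real \<Rightarrow> real \<Rightarrow> real \<times> real \<Rightarrow> real" where
  "sweep_angle c d = (\<lambda>(\<theta>, v). if \<theta> \<in> arctan_image {c<..<d} then arctan (sweep_point c d (tan \<theta>) v) else \<theta>)"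

text \<open>The swept law is the law of a random angle that is moved by an independent Cauchy
  variable. Total mass is preserved by construction, since the weight 1 / (1 + t^2) is already part
  of the law.\<close>

definition sweep :: "real \<Rightarrow> real \<Rightarrow> real measure \<Rightarrow> real measure" where
  "sweep c d P = distr (P \<Otimes>\<^sub>M cauchy_law) borel (sweep_angle c d)"

lemma sweep_angle_measurable [measurable]: "sweep_angle c d \<in> borel_measurable (borel \<Otimes>\<^sub>M borel)"
  unfolding sweep_angle_def sweep_point_def by measurable

lemma sweep_angle_measurable':
  assumes "sets P = sets borel"
  shows "sweep_angle c d \<in> borel_measurable (P \<Otimes>\<^sub>M cauchy_law)"
  using sweep_angle_measurable measurable_cong_sets[OF sets_pair_measure_cong[OF assms sets_cauchy_law] refl] by blast

lemma emeasure_sweep: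
  assumes P: "angular_law P" and [measurable]: "S \<in> sets borel"
  shows "emeasure (sweep c d P) S = emeasure (P \<Otimes>\<^sub>M cauchy_law) {(\<theta>, v). sweep_angle c d (\<theta>, v) \<in> S}"
proof -
  have "emeasure (sweep c d P) S = emeasure (P \<Otimes>\<^sub>M cauchy_law) (sweep_angle c d -` S \<inter> space (P \<Otimes>\<^sub>M cauchy_law))"
    unfolding sweep_def using sweep_angle_measurable'[OF angular_lawD(2)[OF P]] by (intro emeasure_distr) auto
  also have "sweep_angle c d -` S \<inter> space (P \<Otimes>\<^sub>M cauchy_law) = {(\<theta>, v). sweep_angle c d (\<theta>, v) \<in> S}"
    by (auto simp: space_pair_measure angular_lawD(3)[OF P])
  finally show ?thesis .
qed

lemma angular_law_sweep:
  assumes P: "angular_law P"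
  shows "angular_law (sweep c d P)"
proof -
  interpret P: prob_space P by (rule angular_lawD[OF P])
  interpret PC: pair_prob_space P cauchy_law ..
  have ps: "prob_space (sweep c d P)"
    unfolding sweep_def by (rule PC.prob_space_distr) (rule sweep_angle_measurable'[OF angular_lawD(2)[OF P]])
  have [measurable_cong]: "sets P = sets borel" by (rule angular_lawD[OF P])
  have "1 = emeasure P {-(pi/2)..pi/2} * emeasure cauchy_law UNIV"
    using angular_lawD(4)[OF P] cauchy.emeasure_space_1 by simp
  also have "\<dots> = emeasure (P \<Otimes>\<^sub>M cauchy_law) ({-(pi/2)..pi/2} \<times> UNIV)"
    by (rule cauchy.emeasure_pair_measure_Times[symmetric]) auto
  also have "\<dots> \<le> emeasure (P \<Otimes>\<^sub>M cauchy_law) {(\<theta>, v). sweep_angle c d (\<theta>, v) \<in> {-(pi/2)..pi/2}}"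
  proof (rule emeasure_mono)
    have "sweep_angle c d -` {-(pi/2)..pi/2} \<inter> space (P \<Otimes>\<^sub>M cauchy_law) \<in> sets (P \<Otimes>\<^sub>M cauchy_law)"
      by (rule measurable_sets[OF sweep_angle_measurable'[OF angular_lawD(2)[OF P]]]) simp
    then show "{(\<theta>, v). sweep_angle c d (\<theta>, v) \<in> {-(pi/2)..pi/2}} \<in> sets (P \<Otimes>\<^sub>M cauchy_law)"
      by (simp add: space_pair_measure angular_lawD(3)[OF P] vimage_def case_prod_beta')
    have "arctan s * 2 \<le> pi" "- (pi / 2) \<le> arctan s" for s
      using arctan_lbound[of s] arctan_ubound[of s] by simp_all
    then show "{-(pi/2)..pi/2} \<times> UNIV \<subseteq> {(\<theta>, v). sweep_angle c d (\<theta>, v) \<in> {-(pi/2)..pi/2}}"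
      by (auto simp: sweep_angle_def)
  qed
  also have "\<dots> = emeasure (sweep c d P) {-(pi/2)..pi/2}" by (simp add: emeasure_sweep[OF P])
  finally have "emeasure (sweep c d P) {-(pi/2)..pi/2} \<ge> 1" .
  moreover have "emeasure (sweep c d P) {-(pi/2)..pi/2} \<le> 1"
    using prob_space.measure_le_1[OF ps] by simp
  ultimately show ?thesis using ps by (auto simp: angular_law_def sweep_def)
qed

text \<open>The kernel (1 + s z) / (s - z) equals (1 + z^2) / (s - z) + z, so the expectation of 1 /
  (s - z) decides everything. By Fubini the correction is a function of z alone times a Cauchy
  integral of a real density over (c, d).\<close>

lemma sweep_integral:
  assumes P: "angular_law P" and z: "Im z > 0" and "c < d"
  shows "(LINT \<theta>|sweep c d P. angular_kernel \<theta> z) = (LINT \<theta>|P. angular_kernel \<theta> z)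
    + (1 + z\<^sup>2) * sweep_factor c d z *
      (LINT \<theta>|P. of_real (indicator (arctan_image {c<..<d}) \<theta> * sqrt ((tan \<theta> - c) * (d - tan \<theta>))) / (of_real (tan \<theta>) - z))"
    (is "_ = _ + _ * (LINT \<theta>|P. ?h \<theta>)")
    and "integrable P (\<lambda>\<theta>. of_real (indicator (arctan_image {c<..<d}) \<theta> * sqrt ((tan \<theta> - c) * (d - tan \<theta>))) / (of_real (tan \<theta>) - z))"
proof -
  interpret P: prob_space P by (rule angular_lawD[OF P])
  interpret PC: pair_prob_space P cauchy_law ..
  have [measurable_cong]: "sets P = sets borel" by (rule angular_lawD[OF P])
  note sm [measurable] = sweep_angle_measurable'[OF angular_lawD(2)[OF P]]
  have hb: "norm (?h \<theta>) \<le> (d - c) / Im z" for \<theta>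
  proof (cases "\<theta> \<in> arctan_image {c<..<d}")
    case True
    then have t: "c < tan \<theta>" "tan \<theta> < d" by (auto simp: arctan_image_def)
    have "(tan \<theta> - c) * (d - tan \<theta>) \<le> (d - c) * (d - c)" using t by (intro mult_mono) auto
    then have "sqrt ((tan \<theta> - c) * (d - tan \<theta>)) \<le> sqrt ((d - c)\<^sup>2)"
      by (intro real_sqrt_le_mono) (simp add: power2_eq_square)
    then have 1: "sqrt ((tan \<theta> - c) * (d - tan \<theta>)) \<le> d - c" using \<open>c < d\<close> by simp
    have 2: "norm (of_real (tan \<theta>) - z) \<ge> Im z"
      using abs_Im_le_cmod[of "of_real (tan \<theta>) - z"] z by simp
    show ?thesis
      unfolding norm_divide norm_of_real using True t z 1 2 \<open>c < d\<close> by (intro frac_le) (auto simp: abs_mult)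
  qed (use z \<open>c < d\<close> in simp)
  show inth: "integrable P ?h"
    by (rule P.integrable_const_bound[OF AE_I2[OF hb]]) measurable
  have int2: "integrable (P \<Otimes>\<^sub>M cauchy_law) (\<lambda>x. angular_kernel (sweep_angle c d x) z)"
    by (rule PC.integrable_const_bound[OF AE_I2[OF norm_angular_kernel_le[OF z]]]) measurable
  have inner: "(LINT v|cauchy_law. angular_kernel (sweep_angle c d (\<theta>, v)) z)
      = angular_kernel \<theta> z + (1 + z\<^sup>2) * sweep_factor c d z * ?h \<theta>" for \<theta>
  proof (cases "\<theta> \<in> arctan_image {c<..<d}")
    case True
    then have t: "c < tan \<theta>" "tan \<theta> < d" "-(pi/2) < \<theta>" "\<theta> < pi/2" by (auto simp: arctan_image_def)
    note E = sweep_point_expectation[OF t(1,2) z]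
    have ker: "(1 + of_real s * z) / (of_real s - z) = (1 + z\<^sup>2) * (1 / (of_real s - z)) + z" for s
    proof -
      have "of_real s - z \<noteq> 0" using z by (auto simp: complex_eq_iff)
      then show ?thesis by (simp add: divide_simps) (simp add: algebra_simps power2_eq_square)
    qed
    have "(LINT v|cauchy_law. angular_kernel (sweep_angle c d (\<theta>, v)) z)
        = (LINT v|cauchy_law. (1 + z\<^sup>2) * (1 / (of_real (sweep_point c d (tan \<theta>) v) - z)) + z)"
      using True by (simp add: sweep_angle_def angular_kernel_arctan[OF z] ker)
    also have "\<dots> = (1 + z\<^sup>2) * (LINT v|cauchy_law. 1 / (of_real (sweep_point c d (tan \<theta>) v) - z)) + z"
    proof -
      have "(LINT v|cauchy_law. z) = z" using cauchy.prob_space by simp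
      moreover have "integrable cauchy_law (\<lambda>v. z)" by simp
      ultimately show ?thesis
        by (simp only: Bochner_Integration.integral_add integrable_mult_right[OF E(2)] integral_mult_right_zero)
    qed
    also have "\<dots> = (1 + z\<^sup>2) * (1 / (of_real (tan \<theta>) - z)) + z
        + (1 + z\<^sup>2) * sweep_factor c d z * (of_real (sqrt ((tan \<theta> - c) * (d - tan \<theta>))) / (of_real (tan \<theta>) - z))"
      unfolding E(1) by (simp only: distrib_left times_divide_eq_right mult.assoc add_ac)
    also have "(1 + z\<^sup>2) * (1 / (of_real (tan \<theta>) - z)) + z = angular_kernel \<theta> z"
      unfolding ker[symmetric] by (rule angular_kernel_tan[OF z t(3,4), symmetric])
    finally show ?thesis using True by simp
  next
    case False
    then show ?thesis using cauchy.prob_space by (simp add: sweep_angle_def)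
  qed
  have "(LINT \<theta>|sweep c d P. angular_kernel \<theta> z) = (LINT x|(P \<Otimes>\<^sub>M cauchy_law). angular_kernel (sweep_angle c d x) z)"
    unfolding sweep_def by (subst integral_distr) auto
  also have "\<dots> = (LINT \<theta>|P. LINT v|cauchy_law. angular_kernel (sweep_angle c d (\<theta>, v)) z)"
    by (rule PC.integral_fst'[OF int2, symmetric])
  also have "\<dots> = (LINT \<theta>|P. angular_kernel \<theta> z + (1 + z\<^sup>2) * sweep_factor c d z * ?h \<theta>)"
    by (simp only: inner)
  also have "\<dots> = (LINT \<theta>|P. angular_kernel \<theta> z) + (1 + z\<^sup>2) * sweep_factor c d z * (LINT \<theta>|P. ?h \<theta>)"
    by (simp only: Bochner_Integration.integral_add[OF angular_law_integrable[OF P z] integrable_mult_right[OF inth]] integral_mult_right_zero)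
  finally show "(LINT \<theta>|sweep c d P. angular_kernel \<theta> z) = (LINT \<theta>|P. angular_kernel \<theta> z)
    + (1 + z\<^sup>2) * sweep_factor c d z * (LINT \<theta>|P. ?h \<theta>)" .
qed

text \<open>At real points outside \<open>[c, d]\<close> the added term is imaginary, because \<open>sweep_factor\<close> is.\<close>

lemma sweep_reflectionless:
  assumes P: "angular_law P" and cd: "c < d" and disj: "{c..d} \<inter> E = {}" and bB: "b \<ge> 0" "B > 0"
    and F: "angular_fun a b B P \<in> \<N> E"
  shows "angular_fun a b B (sweep c d P) \<in> \<N> E"
proof -
  interpret P: prob_space P by (rule angular_lawD[OF P])
  have [measurable_cong]: "sets P = sets borel" by (rule angular_lawD[OF P])
  define g where "g = (\<lambda>\<theta>. indicator (arctan_image {c<..<d}) \<theta> * sqrt ((tan \<theta> - c) * (d - tan \<theta>)))"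
  have [measurable]: "g \<in> borel_measurable borel" unfolding g_def by measurable
  have g: "\<bar>g \<theta>\<bar> \<le> d - c" and gsupp: "g \<theta> \<noteq> 0 \<Longrightarrow> c < tan \<theta> \<and> tan \<theta> < d" for \<theta>
  proof -
    show gs: "g \<theta> \<noteq> 0 \<Longrightarrow> c < tan \<theta> \<and> tan \<theta> < d"
      by (auto simp: g_def indicator_def arctan_image_def split: if_splits)
    show "\<bar>g \<theta>\<bar> \<le> d - c"
    proof (cases "g \<theta> = 0")
      case False
      then have t: "c < tan \<theta>" "tan \<theta> < d" using gs by auto
      have "(tan \<theta> - c) * (d - tan \<theta>) \<le> (d - c) * (d - c)" using t by (intro mult_mono) auto
      then have "sqrt ((tan \<theta> - c) * (d - tan \<theta>)) \<le> sqrt ((d - c)\<^sup>2)"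
        by (intro real_sqrt_le_mono) (simp add: power2_eq_square)
      then show ?thesis using t cd by (auto simp: g_def indicator_def)
    qed (use cd in simp)
  qed
  define H where "H = (\<lambda>z. LINT \<theta>|P. complex_of_real (g \<theta>) / (of_real (tan \<theta>) - z))"
  have diff: "angular_fun a b B (sweep c d P) z
      = angular_fun a b B P z + of_real B * ((1 + z\<^sup>2) * sweep_factor c d z * H z)" if "Im z > 0" for z
    unfolding angular_fun_def sweep_integral(1)[OF P that cd] H_def g_def by (simp only: distrib_left add_ac)
  have lim: "\<exists>r. ((\<lambda>y. of_real B * ((1 + (Complex x y)\<^sup>2) * sweep_factor c d (Complex x y) * H (Complex x y))) \<longlongrightarrow> \<i> * of_real r) (at_right 0)"
    if x: "x \<notin> {c..d}" for x
  proof -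
    have Clim: "((\<lambda>y. Complex x y) \<longlongrightarrow> of_real x) (at_right 0)"
      by (rule tendsto_eq_rhs[OF tendsto_Complex[OF tendsto_const tendsto_ident_at]]) (simp add: complex_eq_iff)
    have xc: "complex_of_real c - of_real x \<noteq> 0" "complex_of_real d - of_real x \<noteq> 0"
      using x cd by (auto simp flip: of_real_diff)
    define q where "q = (d - x) / (c - x)"
    have q: "q > 0" using x cd by (auto simp: q_def zero_less_divide_iff)
    have qc: "(complex_of_real d - of_real x) / (of_real c - of_real x) = of_real q"
      by (simp add: q_def)
    have "isCont csqrt (of_real q)"
      using q by (intro continuous_at_csqrt) (auto simp: complex_nonpos_Reals_iff)
    moreover have "((\<lambda>y. (of_real d - Complex x y) / (of_real c - Complex x y)) \<longlongrightarrow> of_real q) (at_right 0)"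
      unfolding qc[symmetric] by (intro tendsto_intros Clim xc)
    ultimately have "((\<lambda>y. csqrt ((of_real d - Complex x y) / (of_real c - Complex x y))) \<longlongrightarrow> csqrt (of_real q)) (at_right 0)"
      by (rule isCont_tendsto_compose)
    then have S: "((\<lambda>y. sweep_factor c d (Complex x y)) \<longlongrightarrow> \<i> * csqrt (of_real q) / (of_real d - of_real x)) (at_right 0)"
      unfolding sweep_factor_def by (intro tendsto_intros Clim xc)
    \<comment> \<open>The distance from x to [c, d]. It keeps the Cauchy integral \<open>H\<close>
      regular at x, with error at most y (d - c) / m^2 relative to the real limit
      \<open>R\<close>.\<close>
    define m where "m = min \<bar>x - c\<bar> \<bar>x - d\<bar>"
    have m: "m > 0" using x cd by (auto simp: m_def)
    have dist: "m \<le> \<bar>tan \<theta> - x\<bar>" if "g \<theta> \<noteq> 0" for \<theta>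
      using gsupp[OF that] x by (auto simp: m_def)
    define R where "R = (LINT \<theta>|P. g \<theta> / (tan \<theta> - x))"
    have bx: "\<bar>g \<theta> / (tan \<theta> - x)\<bar> \<le> (d - c) / m" for \<theta>
      using dist[of \<theta>] g[of \<theta>] m by (cases "g \<theta> = 0") (auto intro!: frac_le divide_nonneg_nonneg simp: cd less_imp_le)
    have intx: "integrable P (\<lambda>\<theta>. g \<theta> / (tan \<theta> - x))"
      by (rule P.integrable_const_bound[where B = "(d - c) / m"]) (use bx in auto)
    have "((\<lambda>y. H (Complex x y)) \<longlongrightarrow> of_real R) (at_right 0)"
    proof (rule LIM_zero_cancel, rule Lim_null_comparison)
      show "\<forall>\<^sub>F y in at_right 0. norm (H (Complex x y) - of_real R) \<le> y * ((d - c) / (m * m))"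
        using eventually_at_right_less[of 0]
      proof eventually_elim
        case (elim y)
        then have y: "Im (Complex x y) > 0" by simp
        have inty: "integrable P (\<lambda>\<theta>. complex_of_real (g \<theta>) / (of_real (tan \<theta>) - Complex x y))"
          using sweep_integral(2)[OF P y cd] by (simp only: g_def)
        have intx': "integrable P (\<lambda>\<theta>. complex_of_real (g \<theta> / (tan \<theta> - x)))"
          using intx by (rule integrable_of_real)
        have "H (Complex x y) - of_real R
            = (LINT \<theta>|P. of_real (g \<theta>) / (of_real (tan \<theta>) - Complex x y) - of_real (g \<theta> / (tan \<theta> - x)))"
          unfolding H_def R_def by (simp only: Bochner_Integration.integral_diff[OF inty intx'] integral_complex_of_real)
        also have "norm \<dots> \<le> (LINT \<theta>|P. norm (of_real (g \<theta>) / (of_real (tan \<theta>) - Complex x y) - of_real (g \<theta> / (tan \<theta> - x))))"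
          by (rule integral_norm_bound)
        also have "\<dots> \<le> (LINT \<theta>|P. y * ((d - c) / (m * m)))"
        proof (rule integral_mono)
          show "integrable P (\<lambda>\<theta>. norm (of_real (g \<theta>) / (of_real (tan \<theta>) - Complex x y) - complex_of_real (g \<theta> / (tan \<theta> - x))))"
            by (intro integrable_norm Bochner_Integration.integrable_diff inty intx')
          show "integrable P (\<lambda>\<theta>. y * ((d - c) / (m * m)))" by simp
          fix \<theta>
          show "norm (of_real (g \<theta>) / (of_real (tan \<theta>) - Complex x y) - complex_of_real (g \<theta> / (tan \<theta> - x))) \<le> y * ((d - c) / (m * m))"
          proof (cases "g \<theta> = 0")
            case False
            define u where "u = tan \<theta> - x"
            have u: "m \<le> \<bar>u\<bar>" "u \<noteq> 0" using dist[OF False] m by (auto simp: u_def)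
            define w where "w = of_real (tan \<theta>) - Complex x y"
            have w: "w = of_real u - \<i> * of_real y" by (simp add: w_def u_def complex_eq_iff)
            have wm: "m \<le> norm w" using u(1) abs_Re_le_cmod[of w] by (simp add: w)
            then have w0: "w \<noteq> 0" using m by auto
            have "of_real (g \<theta>) / w - complex_of_real (g \<theta> / u) = of_real (g \<theta>) * (of_real u - w) / (w * of_real u)"
              using w0 u by (simp add: field_simps)
            also have "of_real u - w = \<i> * of_real y" by (simp add: w)
            finally have "norm (of_real (g \<theta>) / w - complex_of_real (g \<theta> / u)) = \<bar>g \<theta>\<bar> * y / (norm w * \<bar>u\<bar>)"
              using elim by (simp add: norm_mult norm_divide)
            also have "\<dots> \<le> (d - c) * y / (m * m)"
              using g[of \<theta>] elim m wm u cd by (intro frac_le mult_mono mult_right_mono) auto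
            finally show ?thesis unfolding w_def u_def by (simp add: mult.commute)
          qed (use elim cd m in simp)
        qed
        also have "\<dots> = y * ((d - c) / (m * m))" using P.prob_space by simp
        finally show ?case .
      qed
      have "((\<lambda>y. y * ((d - c) / (m * m))) \<longlongrightarrow> 0 * ((d - c) / (m * m))) (at_right 0)"
        by (intro tendsto_intros)
      then show "((\<lambda>y. y * ((d - c) / (m * m))) \<longlongrightarrow> 0) (at_right 0)" by simp
    qed
    then have "((\<lambda>y. of_real B * ((1 + (Complex x y)\<^sup>2) * sweep_factor c d (Complex x y) * H (Complex x y)))
        \<longlongrightarrow> of_real B * ((1 + (of_real x)\<^sup>2) * (\<i> * csqrt (of_real q) / (of_real d - of_real x)) * of_real R)) (at_right 0)"
      by (intro tendsto_intros Clim S)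
    also have "of_real B * ((1 + (of_real x)\<^sup>2) * (\<i> * csqrt (of_real q) / (of_real d - of_real x)) * of_real R)
        = \<i> * of_real (B * ((1 + x\<^sup>2) * (sqrt q / (d - x)) * R))"
      using q by (simp add: csqrt_of_real_nonneg)
    finally show ?thesis by blast
  qed
  have "reflectionless_on (angular_fun a b B (sweep c d P)) E"
    unfolding reflectionless_on_def
  proof -
    have "AE t in lborel. t \<in> E \<longrightarrow> (\<exists>l. ((\<lambda>y. angular_fun a b B P (Complex t y)) \<longlongrightarrow> l) (at_right 0) \<and> Re l = 0)"
      using F by (simp add: herglotz_reflectionless_def reflectionless_on_def)
    then show "AE t in lborel. t \<in> E \<longrightarrow> (\<exists>l. ((\<lambda>y. angular_fun a b B (sweep c d P) (Complex t y)) \<longlongrightarrow> l) (at_right 0) \<and> Re l = 0)"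
    proof eventually_elim
      case (elim t)
      show ?case
      proof
        assume t: "t \<in> E"
        then obtain l where l: "((\<lambda>y. angular_fun a b B P (Complex t y)) \<longlongrightarrow> l) (at_right 0)" "Re l = 0"
          using elim by auto
        have "t \<notin> {c..d}" using t disj by auto
        from lim[OF this] obtain r where r: "((\<lambda>y. of_real B * ((1 + (Complex t y)\<^sup>2) * sweep_factor c d (Complex t y) * H (Complex t y))) \<longlongrightarrow> \<i> * of_real r) (at_right 0)" ..
        have "((\<lambda>y. angular_fun a b B (sweep c d P) (Complex t y)) \<longlongrightarrow> l + \<i> * of_real r) (at_right 0)"
          by (rule Lim_transform_eventually[OF tendsto_add[OF l(1) r] eventually_mono[OF eventually_at_right_less[of 0]]])
             (simp add: diff)
        moreover have "Re (l + \<i> * of_real r) = 0" using l(2) by simp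
        ultimately show "\<exists>l. ((\<lambda>y. angular_fun a b B (sweep c d P) (Complex t y)) \<longlongrightarrow> l) (at_right 0) \<and> Re l = 0"
          by (intro exI conjI)
      qed
    qed
  qed
  then show ?thesis
    using herglotz_angular_fun[OF angular_law_sweep[OF P] bB] by (simp add: herglotz_reflectionless_def)
qed


lemma angular_law_real_distribution:
  assumes "angular_law P"
  shows "real_distribution P"
  using angular_lawD[OF assms] by (auto simp: real_distribution_def real_distribution_axioms_def)

text \<open>Mass already in S stays, since S misses the swept interval, and the mass sent from the
  interval to E arrives in S: two disjoint events in the product space. With E empty it shows that
  no mass on S is lost; with the given E it quantifies the gain.\<close>

lemma emeasure_sweep_ge:
  assumes P: "angular_law P" and S [measurable]: "S \<in> sets borel" and E [measurable]: "E \<in> sets borel"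
    and disj: "S \<inter> arctan_image {c<..<d} = {}" and sub: "arctan_image E \<subseteq> S"
  shows "emeasure (sweep c d P) S \<ge> emeasure P S +
    (\<integral>\<^sup>+\<theta>. indicator (arctan_image {c<..<d}) \<theta> * emeasure cauchy_law {v. sweep_point c d (tan \<theta>) v \<in> E} \<partial>P)"
proof -
  interpret P: prob_space P by (rule angular_lawD[OF P])
  interpret PC: pair_prob_space P cauchy_law ..
  have sP [measurable_cong]: "sets P = sets borel" by (rule angular_lawD[OF P])
  have spP [simp]: "space P = UNIV" by (rule angular_lawD[OF P])
  have [simp]: "space (P \<Otimes>\<^sub>M cauchy_law) = UNIV" by (simp add: space_pair_measure)
  define G where "G = {x :: real \<times> real. fst x \<in> arctan_image {c<..<d} \<and> sweep_point c d (tan (fst x)) (snd x) \<in> E}"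
  have "G \<inter> space (P \<Otimes>\<^sub>M cauchy_law) \<in> sets (P \<Otimes>\<^sub>M cauchy_law)"
    unfolding G_def sweep_point_def by measurable
  then have G: "G \<in> sets (P \<Otimes>\<^sub>M cauchy_law)" by simp
  have ST: "S \<times> UNIV \<in> sets (P \<Otimes>\<^sub>M cauchy_law)" by simp
  have "(\<integral>\<^sup>+\<theta>. indicator (arctan_image {c<..<d}) \<theta> * emeasure cauchy_law {v. sweep_point c d (tan \<theta>) v \<in> E} \<partial>P)
      = (\<integral>\<^sup>+\<theta>. emeasure cauchy_law (Pair \<theta> -` G) \<partial>P)"
    by (intro nn_integral_cong) (auto simp: G_def indicator_def vimage_def)
  also have "\<dots> = emeasure (P \<Otimes>\<^sub>M cauchy_law) G"
    by (rule cauchy.emeasure_pair_measure_alt[OF G, symmetric])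
  finally have I: "(\<integral>\<^sup>+\<theta>. indicator (arctan_image {c<..<d}) \<theta> * emeasure cauchy_law {v. sweep_point c d (tan \<theta>) v \<in> E} \<partial>P)
      = emeasure (P \<Otimes>\<^sub>M cauchy_law) G" .
  have "emeasure P S = emeasure (P \<Otimes>\<^sub>M cauchy_law) (S \<times> UNIV)"
    using cauchy.emeasure_space_1 by (subst cauchy.emeasure_pair_measure_Times) auto
  then have "emeasure P S + emeasure (P \<Otimes>\<^sub>M cauchy_law) G
      = emeasure (P \<Otimes>\<^sub>M cauchy_law) (S \<times> UNIV) + emeasure (P \<Otimes>\<^sub>M cauchy_law) G" by (rule arg_cong)
  also have "\<dots> = emeasure (P \<Otimes>\<^sub>M cauchy_law) (S \<times> UNIV \<union> G)"
    using disj by (intro plus_emeasure ST G) (auto simp: G_def)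
  also have "\<dots> \<le> emeasure (P \<Otimes>\<^sub>M cauchy_law) {(\<theta>, v). sweep_angle c d (\<theta>, v) \<in> S}"
  proof (rule emeasure_mono)
    have "sweep_angle c d -` S \<inter> space (P \<Otimes>\<^sub>M cauchy_law) \<in> sets (P \<Otimes>\<^sub>M cauchy_law)"
      by (rule measurable_sets[OF sweep_angle_measurable'[OF sP] S])
    then show "{(\<theta>, v). sweep_angle c d (\<theta>, v) \<in> S} \<in> sets (P \<Otimes>\<^sub>M cauchy_law)"
      by (simp add: vimage_def case_prod_beta')
    have "arctan s \<in> S" if "s \<in> E" for s using that sub by auto
    then show "S \<times> UNIV \<union> G \<subseteq> {(\<theta>, v). sweep_angle c d (\<theta>, v) \<in> S}"
      using disj by (auto simp: sweep_angle_def G_def)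
  qed
  also have "\<dots> = emeasure (sweep c d P) S" by (simp add: emeasure_sweep[OF P])
  finally show ?thesis unfolding I .
qed

text \<open>E is covered by the image, under the map v -> \<open>sweep_point c d t v\<close>, of its
  own preimage. Where the denominator is nonzero the map is differentiable and sends null sets to
  null sets, so a null preimage would make E null.\<close>

lemma sweep_point_charges:
  assumes cd: "c < t" "t < d" and disj: "{c..d} \<inter> E = {}" and E [measurable]: "E \<in> sets borel"
    and pos: "emeasure lborel E \<noteq> 0"
  shows "emeasure cauchy_law {v. sweep_point c d t v \<in> E} \<noteq> 0"
proof
  have [measurable]: "(\<lambda>v. sweep_point c d t v) \<in> borel_measurable borel"
    unfolding sweep_point_def by measurable
  assume "emeasure cauchy_law {v. sweep_point c d t v \<in> E} = 0"
  then have "AE v in cauchy_law. sweep_point c d t v \<notin> E"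
    by (subst AE_iff_measurable[OF _ refl]) auto
  then have "AE v in lborel. sweep_point c d t v \<notin> E" by (simp add: AE_cauchy_law_iff)
  then have N0: "{v. sweep_point c d t v \<in> E} \<in> null_sets lborel"
    by (subst (asm) AE_iff_null) auto
  define N where "N = {v. sweep_point c d t v \<in> E \<and> (d - t) - (t - c) * v\<^sup>2 \<noteq> 0}"
  have "negligible {v. sweep_point c d t v \<in> E}"
    using N0 by (simp add: negligible_iff_null_sets null_sets_completionI)
  then have "negligible N" by (rule negligible_subset) (auto simp: N_def)
  moreover have "sweep_point c d t differentiable_on N"
    unfolding sweep_point_def[abs_def] differentiable_on_def
    by (intro ballI differentiable_divide derivative_intros) (auto simp: N_def)
  ultimately have "negligible (sweep_point c d t ` N)"
    by (intro negligible_differentiable_image_negligible) auto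
  moreover have "E \<subseteq> sweep_point c d t ` N"
  proof
    fix x assume x: "x \<in> E"
    then have "x \<notin> {c..d}" using disj by auto
    then have xcd: "x < c \<or> x > d" by auto
    \<comment> \<open>The solution of \<open>sweep_point c d t v = x\<close> for v^2; it is
      nonnegative because x lies outside [c, d].\<close>
    define u where "u = (x - c) * (d - t) / ((x - d) * (t - c))"
    have "(x - c) / (x - d) \<ge> 0" using xcd cd by (auto simp: zero_le_divide_iff)
    then have "((x - c) / (x - d)) * ((d - t) / (t - c)) \<ge> 0" using cd by (intro mult_nonneg_nonneg) auto
    then have u: "u \<ge> 0" by (simp add: u_def)
    have nz: "x - d \<noteq> 0" "t - c \<noteq> 0" "d - t \<noteq> 0" "c - d \<noteq> 0" using xcd cd by auto
    have tu: "(t - c) * u = (d - t) * (x - c) / (x - d)"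
      using nz by (simp add: u_def)
    have den: "(d - t) - (t - c) * u = (d - t) * (c - d) / (x - d)"
      unfolding tu using nz by (simp add: field_simps)
    have num: "c * (d - t) - d * (t - c) * u = (d - t) * (c - d) / (x - d) * x"
      unfolding mult.assoc tu using nz by (simp add: field_simps)
    have "sweep_point c d t (sqrt u) = x"
      unfolding sweep_point_def using u num den nz by simp
    moreover have "sqrt u \<in> N"
    proof -
      have "(d - t) * (c - d) / (x - d) \<noteq> 0" using nz by simp
      then have "(d - t) - (t - c) * u \<noteq> 0" unfolding den .
      then show ?thesis using calculation x u by (simp add: N_def)
    qed
    ultimately show "x \<in> sweep_point c d t ` N" by force
  qed
  ultimately have "negligible E" using negligible_subset by blast
  then have "E \<in> null_sets lborel"
    by (simp add: negligible_iff_null_sets null_sets_completion_iff)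
  then show False using pos by auto
qed

text \<open>Each point of (c, d) sends a positive fraction of its mass to E, so a charged interval
  yields a positive total gain; the inequality is strict because the mass of S is finite.\<close>

lemma sweep_increases:
  assumes P: "angular_law P" and S: "S \<in> sets borel" and E: "E \<in> sets borel"
    and disj: "S \<inter> arctan_image {c<..<d} = {}" and sub: "arctan_image E \<subseteq> S"
    and cd: "{c..d} \<inter> E = {}" and pos: "emeasure lborel E \<noteq> 0"
    and J: "emeasure P (arctan_image {c<..<d}) \<noteq> 0"
  shows "emeasure (sweep c d P) S > emeasure P S"
proof -
  interpret P: prob_space P by (rule angular_lawD[OF P])
  have sP [measurable_cong]: "sets P = sets borel" by (rule angular_lawD[OF P])
  note [measurable] = E
  let ?f = "\<lambda>\<theta>. indicator (arctan_image {c<..<d}) \<theta> * emeasure cauchy_law {v. sweep_point c d (tan \<theta>) v \<in> E}"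
  have "(\<integral>\<^sup>+\<theta>. ?f \<theta> \<partial>P) \<noteq> 0"
  proof
    assume "(\<integral>\<^sup>+\<theta>. ?f \<theta> \<partial>P) = 0"
    moreover have "(\<lambda>\<theta>. emeasure cauchy_law {v. sweep_point c d (tan \<theta>) v \<in> E}) \<in> borel_measurable P"
    proof -
      have "{x \<in> space (P \<Otimes>\<^sub>M cauchy_law). sweep_point c d (tan (fst x)) (snd x) \<in> E} \<in> sets (P \<Otimes>\<^sub>M cauchy_law)"
        unfolding sweep_point_def by measurable
      from cauchy.measurable_emeasure_Pair[OF this] show ?thesis
        by (simp add: vimage_def space_pair_measure angular_lawD(3)[OF P])
    qed
    ultimately have "AE \<theta> in P. ?f \<theta> = 0"
      by (subst (asm) nn_integral_0_iff_AE) auto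
    then have "AE \<theta> in P. \<theta> \<notin> arctan_image {c<..<d}"
    proof eventually_elim
      case (elim \<theta>)
      show ?case
      proof
        assume \<theta>: "\<theta> \<in> arctan_image {c<..<d}"
        then have "c < tan \<theta>" "tan \<theta> < d" by (auto simp: arctan_image_def)
        from sweep_point_charges[OF this cd E pos] show False using elim \<theta> by simp
      qed
    qed
    then have "emeasure P (arctan_image {c<..<d}) = 0"
      by (subst (asm) AE_iff_measurable[OF _ refl]) (auto simp: angular_lawD(3)[OF P])
    then show False using J by simp
  qed
  then have "emeasure P S < emeasure P S + (\<integral>\<^sup>+\<theta>. ?f \<theta> \<partial>P)"
    using ennreal_add_left_cancel_less[of "emeasure P S" 0 "\<integral>\<^sup>+\<theta>. ?f \<theta> \<partial>P"] P.emeasure_finite[of S]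
    by (simp add: zero_less_iff_neq_zero)
  also have "\<dots> \<le> emeasure (sweep c d P) S" by (rule emeasure_sweep_ge[OF P S E disj sub])
  finally show ?thesis .
qed

section \<open>A law of maximal mass\<close>

text \<open>The closed set part of the portmanteau theorem: bounded continuous tent functions lie
  above the indicator of C and decrease to it, so a lower bound on the masses of C survives the weak
  limit.\<close>

lemma weak_conv_closed_ge:
  assumes M: "\<And>n. real_distribution (M n)" and L: "real_distribution L" and w: "weak_conv_m M L"
    and C: "closed C" and c: "c \<longlonglongrightarrow> c'" and le: "\<And>n. c n \<le> measure (M n) C"
  shows "c' \<le> measure L C"
proof (cases "C = {}")
  case True
  then show ?thesis using le by (intro LIMSEQ_le_const2[OF c]) auto
next
  case False
  interpret L: real_distribution L by fact
  define f where "f = (\<lambda>k x. max 0 (1 - real k * infdist x C))"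
  have f01: "0 \<le> f k x" "f k x \<le> 1" for k x
    by (auto simp: f_def infdist_nonneg)
  have cont: "isCont (f k) x" for k x
    unfolding f_def by (intro continuous_intros)
  have [measurable]: "f k \<in> borel_measurable borel" for k
    using cont by (intro borel_measurable_continuous_onI continuous_at_imp_continuous_on) auto
  have [measurable]: "C \<in> sets borel" using C by auto
  have fC: "f k x = 1" if "x \<in> C" for k x using that by (simp add: f_def)
  have step: "c' \<le> (LINT x|L. f k x)" for k
  proof (rule LIMSEQ_le[OF c])
    show "(\<lambda>n. LINT x|M n. f k x) \<longlonglongrightarrow> (LINT x|L. f k x)"
      using f01 by (intro weak_conv_imp_integral_bdd_continuous_conv[OF M L w cont, where B = 1]) auto
    have "c n \<le> (LINT x|M n. f k x)" for n
    proof -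
      interpret Mn: real_distribution "M n" by (rule M)
      have "c n \<le> (LINT x|M n. indicator C x)" using le[of n] by simp
      also have "\<dots> \<le> (LINT x|M n. f k x)"
        using f01 fC
        by (intro integral_mono Mn.integrable_const_bound[where B = 1]) (auto simp: indicator_def)
      finally show ?thesis .
    qed
    then show "\<exists>N. \<forall>n\<ge>N. c n \<le> (LINT x|M n. f k x)" by blast
  qed
  have "(\<lambda>k. LINT x|L. f k x) \<longlonglongrightarrow> (LINT x|L. indicator C x)"
  proof (rule integral_dominated_convergence[where w = "\<lambda>_. 1"])
    show "AE x in L. (\<lambda>k. f k x) \<longlonglongrightarrow> indicator C x"
    proof (rule AE_I2)
      fix x
      show "(\<lambda>k. f k x) \<longlonglongrightarrow> indicator C x"
      proof (cases "x \<in> C")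
        case False
        then have p: "infdist x C > 0" using in_closed_iff_infdist_zero[OF C \<open>C \<noteq> {}\<close>, of x] infdist_nonneg[of x C] by linarith
        obtain K :: nat where K: "1 / infdist x C < real K" using reals_Archimedean2 by blast
        have "f k x = 0" if "k \<ge> K" for k
        proof -
          have "1 < real K * infdist x C" using K p by (simp add: field_simps)
          also have "\<dots> \<le> real k * infdist x C" using that p by (intro mult_right_mono) auto
          finally show ?thesis by (simp add: f_def)
        qed
        then have "\<forall>\<^sub>F k in sequentially. f k x = indicator C x"
          using False by (intro eventually_mono[OF eventually_ge_at_top[of K]]) auto
        then show ?thesis by (rule tendsto_eventually)
      qed (simp add: fC)
    qed
  qed (use f01 in auto)
  then have "c' \<le> (LINT x|L. indicator C x)"
    by (rule LIMSEQ_le_const) (use step in blast)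
  then show ?thesis by simp
qed

text \<open>For unbounded E the image under arctan can accumulate at the endpoints. They have to be
  added, which is why the maximised mass includes the point at infinity.\<close>

lemma closed_arctan_image_Un:
  assumes "closed E"
  shows "closed (arctan_image E \<union> {-(pi/2), pi/2})"
proof -
  have "continuous_on {-(pi/2)<..<pi/2} (tan :: real \<Rightarrow> real)"
    by (intro continuous_on_tan continuous_on_id) (metis cos_gt_zero_pi greaterThanLessThan_iff less_irrefl)
  then have "open ({-(pi/2)<..<pi/2} \<inter> tan -` (- E))"
    using assms by (intro continuous_open_preimage) auto
  then have "open ({-(pi/2)<..<pi/2} \<inter> tan -` (- E) \<union> {..<-(pi/2)} \<union> {pi/2<..})"
    by (intro open_Un) auto
  moreover have "- (arctan_image E \<union> {-(pi/2), pi/2}) = {-(pi/2)<..<pi/2} \<inter> tan -` (- E) \<union> {..<-(pi/2)} \<union> {pi/2<..}"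
    by (auto simp: arctan_image_def)
  ultimately show ?thesis by (simp add: closed_def)
qed


lemma arctan_image_disjoint:
  assumes "{c..d} \<inter> E = {}"
  shows "arctan_image E \<inter> arctan_image {c<..<d} = {}"
proof -
  have "tan \<theta> \<in> {c..d} \<inter> E" if "\<theta> \<in> arctan_image E" "\<theta> \<in> arctan_image {c<..<d}" for \<theta>
    using that by (auto simp: arctan_image_def)
  then show ?thesis using assms by blast
qed

text \<open>Collects properties stable under both sweeps and weak limits. Comparison with the
  initial law is demanded on E only; the mass in the gaps and at infinity is free to change.\<close>

definition sweep_class :: "real set \<Rightarrow> real \<Rightarrow> real \<Rightarrow> real \<Rightarrow> real measure \<Rightarrow> real measure set" where
  "sweep_class E a b B P\<^sub>0 = {P. angular_law P \<and> angular_fun a b B P \<in> \<N> E \<and>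
     (\<forall>A\<in>sets borel. A \<subseteq> arctan_image E \<longrightarrow> emeasure P\<^sub>0 A \<le> emeasure P A)}"

text \<open>For fixed z the kernel is bounded and continuous in the angle, so weak convergence gives
  pointwise convergence of the Herglotz functions. Domination passes to the limit on compact sets,
  and inner regularity of the initial law extends it to Borel sets.\<close>

lemma sweep_class_weak_limit:
  assumes E: "closed E" and bB: "b \<ge> 0" "B > 0" and P0: "angular_law P\<^sub>0"
    and P: "\<And>n. P n \<in> sweep_class E a b B P\<^sub>0"
    and M: "real_distribution M" and w: "weak_conv_m P M"
  shows "M \<in> sweep_class E a b B P\<^sub>0"
proof -
  have law: "angular_law (P n)" and refl: "angular_fun a b B (P n) \<in> \<N> E"
    and dom: "A \<in> sets borel \<Longrightarrow> A \<subseteq> arctan_image E \<Longrightarrow> emeasure P\<^sub>0 A \<le> emeasure (P n) A" for n A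
    using P[of n] by (auto simp: sweep_class_def)
  have rd: "real_distribution (P n)" for n by (rule angular_law_real_distribution[OF law])
  interpret M: real_distribution M by fact
  interpret P0: prob_space P\<^sub>0 by (rule angular_lawD[OF P0])
  have Eb [measurable]: "E \<in> sets borel" using E by auto
  have sP0 [measurable_cong]: "sets P\<^sub>0 = sets borel" by (rule angular_lawD[OF P0])
  have "1 \<le> measure M {-(pi/2)..pi/2}"
  proof (rule weak_conv_closed_ge[OF rd M w])
    show "1 \<le> measure (P n) {-(pi/2)..pi/2}" for n
      using angular_lawD(4)[OF law[of n]] by (simp add: measure_def)
  qed auto
  then have "emeasure M {-(pi/2)..pi/2} = 1"
    using M.prob_le_1[of "{-(pi/2)..pi/2}"] by (simp add: M.emeasure_eq_measure)
  then have lawM: "angular_law M" using M.prob_space_axioms by (simp add: angular_law_def)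
  have "angular_fun a b B M \<in> \<N> E"
  proof (rule reflectionless_limit[OF E refl herglotz_angular_fun[OF lawM bB]])
    fix z assume z: "Im z > 0"
    have "(\<lambda>n. LINT \<theta>|P n. angular_kernel \<theta> z) \<longlonglongrightarrow> (LINT \<theta>|M. angular_kernel \<theta> z)"
      using continuous_angular_kernel[OF z]
      by (intro weak_conv_imp_integral_bdd_continuous_conv[OF rd M w _ norm_angular_kernel_le[OF z]])
         (simp add: continuous_on_eq_continuous_at)
    then show "(\<lambda>n. angular_fun a b B (P n) z) \<longlonglongrightarrow> angular_fun a b B M z"
      unfolding angular_fun_def by (intro tendsto_intros)
  qed
  moreover have "emeasure P\<^sub>0 A \<le> emeasure M A" if A: "A \<in> sets borel" "A \<subseteq> arctan_image E" for A
  proof -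
    have "emeasure P\<^sub>0 K \<le> emeasure M A" if K: "K \<subseteq> A" "compact K" for K
    proof -
      have cK: "closed K" using K by (simp add: compact_imp_closed)
      have Kb: "K \<in> sets borel" using cK by auto
      have "measure P\<^sub>0 K \<le> measure M K"
      proof (rule weak_conv_closed_ge[OF rd M w cK])
        show "measure P\<^sub>0 K \<le> measure (P n) K" for n
        proof -
          interpret Pn: real_distribution "P n" by (rule rd)
          have "emeasure P\<^sub>0 K \<le> emeasure (P n) K" using Kb K A by (intro dom) auto
          then show ?thesis by (simp add: Pn.emeasure_eq_measure P0.emeasure_eq_measure)
        qed
      qed simp
      then have "emeasure P\<^sub>0 K \<le> emeasure M K" by (simp add: M.emeasure_eq_measure P0.emeasure_eq_measure)
      also have "\<dots> \<le> emeasure M A" using K A by (intro emeasure_mono) auto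
      finally show ?thesis .
    qed
    moreover have "emeasure P\<^sub>0 (space P\<^sub>0) \<noteq> \<infinity>" using P0.emeasure_finite by simp
    ultimately show ?thesis
      by (subst inner_regular[OF sP0 _ A(1)]) (auto intro!: SUP_least)
  qed
  ultimately show ?thesis using lawM by (simp add: sweep_class_def)
qed

lemma sweep_class_sweep:
  assumes E: "closed E" and bB: "b \<ge> 0" "B > 0"
    and P: "P \<in> sweep_class E a b B P\<^sub>0" and cd: "c < d" and disj: "{c..d} \<inter> E = {}"
  shows "sweep c d P \<in> sweep_class E a b B P\<^sub>0"
proof -
  have law: "angular_law P" and refl: "angular_fun a b B P \<in> \<N> E"
    and dom: "A \<in> sets borel \<Longrightarrow> A \<subseteq> arctan_image E \<Longrightarrow> emeasure P\<^sub>0 A \<le> emeasure P A" for A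
    using P by (auto simp: sweep_class_def)
  have "emeasure P\<^sub>0 A \<le> emeasure (sweep c d P) A" if A: "A \<in> sets borel" "A \<subseteq> arctan_image E" for A
  proof -
    have "A \<inter> arctan_image {c<..<d} = {}" using A(2) arctan_image_disjoint[OF disj] by blast
    \<comment> \<open>Here the target set is empty: only the fact that mass on A stays is
      used.\<close>
    then have "emeasure P A + (\<integral>\<^sup>+\<theta>. indicator (arctan_image {c<..<d}) \<theta> *
        emeasure cauchy_law {v. sweep_point c d (tan \<theta>) v \<in> {}} \<partial>P) \<le> emeasure (sweep c d P) A"
      by (intro emeasure_sweep_ge[OF law A(1)]) (auto simp: arctan_image_def)
    then show ?thesis using dom[OF A] by simp
  qed
  then show ?thesis
    using angular_law_sweep[OF law] sweep_reflectionless[OF law cd disj bB refl] by (simp add: sweep_class_def)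
qed

text \<open>A law with maximal mass on the compact set \<open>arctan E \<union> {\<plusminus> \<pi> / 2}\<close> exists by compactness, and it
  has no mass in an interval disjoint from \<open>E\<close>, since sweeping such an interval would move some of
  the mass to \<open>E\<close>.\<close>

lemma exists_supported_law:
  assumes E: "closed E" and Epos: "emeasure lborel E \<noteq> 0" and bB: "b \<ge> 0" "B > 0"
    and P0: "P\<^sub>0 \<in> sweep_class E a b B P\<^sub>0"
  obtains P where "P \<in> sweep_class E a b B P\<^sub>0" "emeasure P (arctan_image (- E)) = 0"
proof -
  define K where "K = arctan_image E \<union> {-(pi/2), pi/2}"
  have clK: "closed K" unfolding K_def by (rule closed_arctan_image_Un[OF E])
  have Eb [measurable]: "E \<in> sets borel" using E by auto
  have Kb: "K \<in> sets borel" using clK by auto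
  let ?S = "sweep_class E a b B P\<^sub>0"
  have lawS: "angular_law P" if "P \<in> ?S" for P using that by (simp add: sweep_class_def)
  have bdd: "bdd_above ((\<lambda>P. measure P K) ` ?S)"
  proof (rule bdd_aboveI2)
    fix P assume "P \<in> ?S"
    then interpret prob_space P by (rule angular_lawD(1)[OF lawS])
    show "measure P K \<le> 1" by simp
  qed
  define s where "s = (SUP P\<in>?S. measure P K)"
  have ex: "\<exists>P\<in>?S. s - 1 / real (Suc n) < measure P K" for n
  proof -
    have "s - 1 / real (Suc n) < s" by simp
    then show ?thesis unfolding s_def using P0 bdd by (subst (asm) less_cSUP_iff) auto
  qed
  define Q where "Q = (\<lambda>n. SOME P. P \<in> ?S \<and> s - 1 / real (Suc n) < measure P K)"
  have Q: "Q n \<in> ?S \<and> s - 1 / real (Suc n) < measure (Q n) K" for n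
    unfolding Q_def by (rule someI_ex) (use ex[of n] in blast)
  have rdQ: "real_distribution (Q n)" for n
    using Q[of n] by (intro angular_law_real_distribution lawS) simp
  have tight: "tight Q"
    unfolding tight_def
  proof (intro conjI allI impI)
    show "real_distribution (Q n)" for n by (rule rdQ)
    fix e :: real assume "e > 0"
    \<comment> \<open>All laws live on [-pi/2, pi/2]; the larger half-open interval has the shape
      that \<open>tight\<close> asks for.\<close>
    have "1 - e < measure (Q n) {-pi<..pi}" for n
    proof -
      interpret Qn: real_distribution "Q n" by (rule rdQ)
      have "1 = measure (Q n) {-(pi/2)..pi/2}"
        using angular_lawD(4)[of "Q n"] Q lawS by (simp add: measure_def)
      also have "\<dots> \<le> measure (Q n) {-pi<..pi}" 
      proof (rule Qn.finite_measure_mono)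
        show "{-(pi/2)..pi/2} \<subseteq> {-pi<..pi}"
        proof
          fix x assume "x \<in> {-(pi/2)..pi/2}"
          then have "-(pi/2) \<le> x" "x \<le> pi/2" by simp_all
          then show "x \<in> {-pi<..pi}"
            using pi_gt_zero by (intro greaterThanAtMost_iff[THEN iffD2] conjI) linarith+
        qed
      qed simp
      finally show ?thesis using \<open>e > 0\<close> by simp
    qed
    then show "\<exists>x y. x < y \<and> (\<forall>n. 1 - e < measure (Q n) {x<..y})"
      by (intro exI[of _ "-pi"] exI[of _ pi]) auto
  qed
  obtain r M where r: "strict_mono (r :: nat \<Rightarrow> nat)" and M: "real_distribution M"
    and w: "weak_conv_m (Q \<circ> id \<circ> r) M"
    using tight_imp_convergent_subsubsequence[OF tight strict_mono_id] by auto
  have MS: "M \<in> ?S"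
    by (rule sweep_class_weak_limit[OF E bB lawS[OF P0] _ M w]) (use Q in simp)
  have "s \<le> measure M K"
  proof (rule weak_conv_closed_ge[OF _ M w clK])
    show "real_distribution ((Q \<circ> id \<circ> r) n)" for n
      using rdQ by simp
    have "(\<lambda>n. s - 1 / real (Suc n)) \<longlonglongrightarrow> s - 0"
      by (intro tendsto_intros LIMSEQ_Suc lim_1_over_n)
    from LIMSEQ_subseq_LIMSEQ[OF this r] show "(\<lambda>n. s - 1 / real (Suc (r n))) \<longlonglongrightarrow> s" by (simp add: o_def)
    show "s - 1 / real (Suc (r n)) \<le> measure ((Q \<circ> id \<circ> r) n) K" for n
      using Q[of "r n"] by simp
  qed
  then have max: "measure P K \<le> measure M K" if "P \<in> ?S" for P
    using cSUP_upper[OF that bdd] by (simp add: s_def)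
  interpret M: real_distribution M by fact
  have null: "emeasure M (arctan_image {c<..<d}) = 0" if cd: "c < d" "{c..d} \<inter> E = {}" for c d
  proof (rule ccontr)
    assume J: "emeasure M (arctan_image {c<..<d}) \<noteq> 0"
    have sw: "sweep c d M \<in> ?S" by (rule sweep_class_sweep[OF E bB MS cd])
    interpret sw: real_distribution "sweep c d M" by (rule angular_law_real_distribution[OF lawS[OF sw]])
    have "emeasure M K < emeasure (sweep c d M) K"
    proof (rule sweep_increases[OF lawS[OF MS] Kb Eb _ _ cd(2) Epos J])
      show "K \<inter> arctan_image {c<..<d} = {}"
        using arctan_image_disjoint[OF cd(2)] by (auto simp: K_def arctan_image_def)
    qed (auto simp: K_def)
    then have "measure M K < measure (sweep c d M) K"
      by (simp add: M.emeasure_eq_measure sw.emeasure_eq_measure ennreal_less_iff)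
    then show False using max[OF sw] by simp
  qed
  \<comment> \<open>Rational endpoints reduce the complement of E to countably many intervals, each
    of them null.\<close>
  define I where "I = {(c, d). c \<in> \<rat> \<and> d \<in> \<rat> \<and> c < d \<and> {c..d} \<inter> E = {}}"
  have "countable I"
    by (rule countable_subset[of _ "\<rat> \<times> \<rat>"]) (auto simp: I_def countable_rat)
  have cover: "arctan_image (- E) \<subseteq> (\<Union>(c, d)\<in>I. arctan_image {c<..<d})"
  proof
    fix \<theta> assume \<theta>: "\<theta> \<in> arctan_image (- E)"
    define t where "t = tan \<theta>"
    have "t \<in> - E" "open (- E)" using \<theta> E by (auto simp: t_def arctan_image_def)
    then obtain e where e: "e > 0" "cball t e \<subseteq> - E" using open_contains_cball by blast
    obtain c where c: "c \<in> \<rat>" "t - e < c" "c < t" using Rats_dense_in_real[of "t - e" t] e by auto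
    obtain d where d: "d \<in> \<rat>" "t < d" "d < t + e" using Rats_dense_in_real[of t "t + e"] e by auto
    have "{c..d} \<subseteq> cball t e" using c d by (auto simp: dist_real_def)
    then have "(c, d) \<in> I" using c d e by (auto simp: I_def)
    moreover have "\<theta> \<in> arctan_image {c<..<d}" using \<theta> c d by (auto simp: arctan_image_def t_def)
    ultimately show "\<theta> \<in> (\<Union>(c, d)\<in>I. arctan_image {c<..<d})" by blast
  qed
  have "(\<Union>x\<in>I. case x of (c, d) \<Rightarrow> arctan_image {c<..<d}) \<in> null_sets M"
  proof (rule null_sets_UN'[OF \<open>countable I\<close>])
    fix x assume "x \<in> I"
    then show "(case x of (c, d) \<Rightarrow> arctan_image {c<..<d}) \<in> null_sets M"
      using null by (auto simp: I_def intro!: null_setsI)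
  qed
  then have "arctan_image (- E) \<in> null_sets M"
    by (rule null_sets_subset) (use cover in auto)
  then show thesis using that[OF MS] by auto
qed

section \<open>Return from laws to measures, and the theorem\<close>

lemma herglotz_reflectionless_cong:
  assumes "\<And>z. Im z > 0 \<Longrightarrow> F z = G z" "F \<in> \<N> E"
  shows "G \<in> \<N> E"
proof -
  have F: "herglotz F" "reflectionless_on F E" using assms(2) by (auto simp: herglotz_reflectionless_def)
  have "G holomorphic_on {w. Im w > 0}"
    using F(1) assms(1) by (auto simp: herglotz_altdef intro: holomorphic_transform)
  then have "herglotz G" using F(1) assms(1) by (simp add: herglotz_altdef)
  moreover have "((\<lambda>y. F (Complex t y)) \<longlongrightarrow> l) (at_right 0) \<longleftrightarrow> ((\<lambda>y. G (Complex t y)) \<longlongrightarrow> l) (at_right 0)" for t l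
    by (intro tendsto_cong eventually_mono[OF eventually_at_right_less[of 0]] assms(1)) simp
  then have "reflectionless_on G E" using F(2) by (simp add: reflectionless_on_def)
  ultimately show ?thesis by (simp add: herglotz_reflectionless_def)
qed

text \<open>A law in the sweep class without mass in the gaps is converted back to a measure. Mass
  that ended at infinity enters the coefficient b, which membership in \<open>\<R> E\<close> leaves
  free. A nonzero \<open>\<nu>\<close> makes the total mass B positive, as the normalisation
  demands.\<close>

lemma exists_supported_measure:
  assumes E: "closed E" and \<nu>: "\<nu> \<in> \<R> E" and nz: "emeasure \<nu> UNIV \<noteq> 0"
  obtains \<mu> where "\<mu> \<in> \<R>\<^sub>0 E" "\<And>A. A \<in> sets borel \<Longrightarrow> A \<subseteq> E \<Longrightarrow> emeasure \<nu> A \<le> emeasure \<mu> A"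
proof -
  obtain a b where h: "herglotz_measure \<nu>" and b: "b \<ge> 0" and F: "herglotz_fun a b \<nu> \<in> \<N> E"
    using \<nu> by (auto simp: reflectionless_measures_def)
  have Eb [measurable]: "E \<in> sets borel" using E by auto
  have s\<nu> [measurable_cong]: "sets \<nu> = sets borel" using h by (simp add: herglotz_measure_def)
  have sp: "space \<nu> = UNIV" using sets_eq_imp_space_eq[OF s\<nu>] by simp
  have pos: "t\<^sup>2 + 1 > 0" for t :: real using one_plus_square_pos[of t] by (simp add: add.commute)
  let ?w = "\<integral>\<^sup>+t. ennreal (1 / (t\<^sup>2 + 1)) \<partial>\<nu>"
  have "?w < \<infinity>" using h by (simp add: herglotz_measure_def)
  moreover have "?w \<noteq> 0"
  proof
    assume "?w = 0"
    then have "AE t in \<nu>. ennreal (1 / (t\<^sup>2 + 1)) = 0" by (subst (asm) nn_integral_0_iff_AE) auto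
    then have "AE t in \<nu>. False"
    proof eventually_elim
      case (elim t)
      then show ?case using pos[of t] by (simp add: ennreal_eq_0_iff divide_le_0_iff)
    qed
    then show False using nz by (subst (asm) AE_iff_measurable[OF _ refl]) (auto simp: sp)
  qed
  ultimately obtain B where B: "?w = ennreal B" "B > 0"
    by (cases ?w) (auto simp: less_le)
  obtain P\<^sub>0 where P0: "angular_law P\<^sub>0"
    and fun0: "\<And>z. Im z > 0 \<Longrightarrow> angular_fun a b B P\<^sub>0 z = herglotz_fun a b \<nu> z"
    and em0: "\<And>A. A \<in> sets borel \<Longrightarrow>
      emeasure \<nu> A = (\<integral>\<^sup>+\<theta>. indicator (arctan_image A) \<theta> * ennreal (B * (1 + (tan \<theta>)\<^sup>2)) \<partial>P\<^sub>0)"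
    by (rule angular_law_of_herglotz_measure[OF h B, where a = a and b = b]) blast
  have S0: "P\<^sub>0 \<in> sweep_class E a b B P\<^sub>0"
    using P0 herglotz_reflectionless_cong[OF fun0[symmetric] F] by (simp add: sweep_class_def)
  have "\<exists>P\<in>sweep_class E a b B P\<^sub>0. emeasure P (arctan_image (- E)) = 0"
  proof (cases "emeasure lborel E = 0")
    case False
    show ?thesis by (rule exists_supported_law[OF E False b B(2) S0]) blast
  next
    case True
    interpret P0: prob_space P\<^sub>0 by (rule angular_lawD[OF P0])
    have sP0 [measurable_cong]: "sets P\<^sub>0 = sets borel" by (rule angular_lawD[OF P0])
    have spP0 [simp]: "space P\<^sub>0 = UNIV" by (rule angular_lawD[OF P0])
    \<comment> \<open>For a null set E sweeping sends no mass to E; instead all mass outside E is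
      moved to the angle pi/2, that is, to infinity.\<close>
    define f where "f = (\<lambda>\<theta>. if \<theta> \<in> arctan_image E then \<theta> else pi / 2)"
    have fm [measurable]: "f \<in> borel_measurable P\<^sub>0" unfolding f_def by measurable
    define P where "P = distr P\<^sub>0 borel f"
    have em: "emeasure P A = emeasure P\<^sub>0 (f -` A)" if "A \<in> sets borel" for A
      unfolding P_def using that by (simp add: emeasure_distr)
    have fr: "- (pi / 2) \<le> f \<theta> \<and> f \<theta> \<le> pi / 2" for \<theta> by (auto simp: f_def arctan_image_def)
    then have "f -` {-(pi/2)..pi/2} = UNIV" by auto
    then have "emeasure P {-(pi/2)..pi/2} = 1" using P0.emeasure_space_1 by (simp add: em)
    moreover have "prob_space P" unfolding P_def by (rule P0.prob_space_distr[OF fm])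
    moreover have "sets P = sets borel" by (simp add: P_def)
    ultimately have law: "angular_law P" by (simp add: angular_law_def)
    have "AE t in lborel. t \<notin> E" using True by (intro AE_not_in null_setsI) auto
    then have "angular_fun a b B P \<in> \<N> E"
      using herglotz_angular_fun[OF law b B(2)]
      by (auto simp: herglotz_reflectionless_def reflectionless_on_def elim!: AE_mp)
    moreover have "emeasure P\<^sub>0 A \<le> emeasure P A" if A: "A \<in> sets borel" "A \<subseteq> arctan_image E" for A
      unfolding em[OF A(1)] using A measurable_sets[OF fm A(1)]
      by (intro emeasure_mono) (auto simp: f_def)
    moreover have "f -` arctan_image (- E) = {}" by (auto simp: f_def arctan_image_def)
    then have "emeasure P (arctan_image (- E)) = 0" by (simp add: em)
    ultimately show ?thesis using law by (intro bexI[of _ P]) (auto simp: sweep_class_def)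
  qed
  then obtain P where P: "P \<in> sweep_class E a b B P\<^sub>0" and supp: "emeasure P (arctan_image (- E)) = 0" ..
  have law: "angular_law P" and refl: "angular_fun a b B P \<in> \<N> E"
    and dom: "\<And>A. A \<in> sets borel \<Longrightarrow> A \<subseteq> arctan_image E \<Longrightarrow> emeasure P\<^sub>0 A \<le> emeasure P A"
    using P by (auto simp: sweep_class_def)
  have [measurable_cong]: "sets P = sets borel" "sets P\<^sub>0 = sets borel" using angular_lawD law P0 by auto
  have [simp]: "space P = UNIV" using angular_lawD law by auto
  obtain \<mu> where h\<mu>: "herglotz_measure \<mu>"
    and fun\<mu>: "\<And>z. Im z > 0 \<Longrightarrow> herglotz_fun a (b + B * measure P {-(pi/2), pi/2}) \<mu> z = angular_fun a b B P z"
    and em\<mu>: "\<And>A. A \<in> sets borel \<Longrightarrow>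
      emeasure \<mu> A = (\<integral>\<^sup>+\<theta>. indicator (arctan_image A) \<theta> * ennreal (B * (1 + (tan \<theta>)\<^sup>2)) \<partial>P)"
    by (rule herglotz_measure_of_angular_law[OF law B(2), where a = a and b = b]) blast
  show thesis
  proof (rule that)
    have "AE \<theta> in P. \<theta> \<notin> arctan_image (- E)"
      using supp by (intro AE_not_in null_setsI) auto
    then have "(\<integral>\<^sup>+\<theta>. indicator (arctan_image (- E)) \<theta> * ennreal (B * (1 + (tan \<theta>)\<^sup>2)) \<partial>P) = (\<integral>\<^sup>+\<theta>. 0 \<partial>P)"
      by (intro nn_integral_cong_AE, eventually_elim) simp
    then have "emeasure \<mu> (- E) = 0" by (subst em\<mu>) auto
    moreover have "herglotz_fun a (b + B * measure P {-(pi/2), pi/2}) \<mu> \<in> \<N> E"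
      by (rule herglotz_reflectionless_cong[OF fun\<mu>[symmetric] refl])
    moreover have "b + B * measure P {-(pi/2), pi/2} \<ge> 0" using b B(2) by simp
    ultimately have "emeasure \<mu> (- E) = 0" "\<mu> \<in> \<R> E"
      unfolding reflectionless_measures_def using h\<mu> by blast+
    then show "\<mu> \<in> \<R>\<^sub>0 E" by (simp add: reflectionless_measures_supported_def)
  next
    fix A assume A [measurable]: "A \<in> sets borel" and AE: "A \<subseteq> E"
    let ?g = "\<lambda>\<theta>. ennreal (B * (1 + (tan \<theta>)\<^sup>2))"
    \<comment> \<open>Domination is known only inside \<open>arctan_image E\<close>. Restricting
      both laws to \<open>arctan_image A\<close> turns it into an inequality of measures, against
      which the unbounded weight \<open>1 + (tan \<theta>)\<^sup>2\<close> can be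
      integrated.\<close>
    let ?D = "\<lambda>P. density P (indicator (arctan_image A))"
    have Dem: "emeasure (?D R) X = emeasure R (arctan_image A \<inter> X)"
      if "sets R = sets borel" "X \<in> sets borel" for R X
      using that by (simp add: emeasure_density flip: indicator_inter_arith)
    have "?D P\<^sub>0 \<le> ?D P"
    proof -
      have "emeasure (?D P\<^sub>0) X \<le> emeasure (?D P) X" for X
      proof (cases "X \<in> sets borel")
        case True
        then show ?thesis using AE angular_lawD(2)[OF law] angular_lawD(2)[OF P0]
          by (simp add: Dem) (rule dom, auto simp: arctan_image_def)
      next
        case False
        then show ?thesis using angular_lawD(2)[OF law] angular_lawD(2)[OF P0] by (simp add: emeasure_notin_sets)
      qed
      then show ?thesis
        using angular_lawD(2,3)[OF law] angular_lawD(2,3)[OF P0] by (simp add: le_measure_iff le_fun_def)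
    qed
    then have "(\<integral>\<^sup>+\<theta>. ?g \<theta> \<partial>?D P\<^sub>0) \<le> (\<integral>\<^sup>+\<theta>. ?g \<theta> \<partial>?D P)"
      using angular_lawD(2)[OF law] angular_lawD(2)[OF P0] by (intro nn_integral_mono_measure) auto
    then show "emeasure \<nu> A \<le> emeasure \<mu> A"
      unfolding em0[OF A] em\<mu>[OF A] by (simp add: nn_integral_density)
  qed
qed

theorem theorem1p3:
  fixes E :: "real set"
  assumes "closed E"
    and "\<forall>\<mu> \<in> \<R>\<^sub>0 E. emeasure (singular_part \<mu>) E = 0"
  shows "\<forall>\<nu> \<in> \<R> E. emeasure (singular_part \<nu>) E = 0"
proof
  fix \<nu> assume \<nu>: "\<nu> \<in> \<R> E"
  then have h: "herglotz_measure \<nu>" by (simp add: reflectionless_measures_def)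
  have Eb: "E \<in> sets borel" using assms(1) by auto
  obtain \<nu>ac where d\<nu>: "lebesgue_decomposition \<nu> \<nu>ac (singular_part \<nu>)"
    using lebesgue_decomposition_exists[OF h] by blast
  show "emeasure (singular_part \<nu>) E = 0"
  proof (cases "emeasure \<nu> UNIV = 0")
    case True
    have "emeasure (singular_part \<nu>) E \<le> emeasure \<nu> E"
      using d\<nu> Eb by (simp add: lebesgue_decomposition_def)
    also have "\<dots> \<le> emeasure \<nu> UNIV"
      using h by (intro emeasure_mono) (auto simp: herglotz_measure_def)
    finally show ?thesis using True by simp
  next
    case False
    obtain \<mu> where \<mu>: "\<mu> \<in> \<R>\<^sub>0 E"
      and le: "\<And>A. A \<in> sets borel \<Longrightarrow> A \<subseteq> E \<Longrightarrow> emeasure \<nu> A \<le> emeasure \<mu> A"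
      by (rule exists_supported_measure[OF assms(1) \<nu> False]) blast
    have "herglotz_measure \<mu>"
      using \<mu> by (simp add: reflectionless_measures_supported_def reflectionless_measures_def)
    then obtain \<mu>ac where d\<mu>: "lebesgue_decomposition \<mu> \<mu>ac (singular_part \<mu>)"
      using lebesgue_decomposition_exists by blast
    obtain N where N: "N \<in> null_sets lborel"
      "\<And>M A. M \<in> null_sets lborel \<Longrightarrow> N \<subseteq> M \<Longrightarrow> A \<in> sets borel \<Longrightarrow> emeasure (singular_part \<nu>) A = emeasure \<nu> (A \<inter> M)"
      using lebesgue_decomposition_singular[OF d\<nu>] by metis
    obtain N' where N': "N' \<in> null_sets lborel"
      "\<And>M A. M \<in> null_sets lborel \<Longrightarrow> N' \<subseteq> M \<Longrightarrow> A \<in> sets borel \<Longrightarrow> emeasure (singular_part \<mu>) A = emeasure \<mu> (A \<inter> M)"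
      using lebesgue_decomposition_singular[OF d\<mu>] by metis
    \<comment> \<open>On a common null set containing both carriers, each singular part is the
      restriction of its measure, so domination on E passes to the singular parts.\<close>
    have U: "N \<union> N' \<in> null_sets lborel" using N N' by auto
    have "E \<inter> (N \<union> N') \<in> sets borel" using U Eb by auto
    then have "emeasure \<nu> (E \<inter> (N \<union> N')) \<le> emeasure \<mu> (E \<inter> (N \<union> N'))" by (rule le) auto
    then have "emeasure (singular_part \<nu>) E \<le> emeasure (singular_part \<mu>) E"
      using N(2)[OF U _ Eb] N'(2)[OF U _ Eb] by simp
    then show ?thesis using assms(2) \<mu> by simp
  qed
qed


end
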